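(* Let $n, d \ge 1$ be integers, let $\beta \ge 0$ be a real number, and let $X_1, \ldots, X_n$ be independent random vectors in $\mathbb{R}^d$ (not necessarily identically distributed), each with mean zero and the same covariance matrix $\Sigma$, such that $\|X_i\| \le \beta$ almost surely for each $i$. Let $S_n = \frac{1}{\sqrt{n}} \sum_{i=1}^n X_i$, and let $Z$ be a mean-zero Gaussian random vector in $\mathbb{R}^d$ with covariance $\Sigma$. Then $$ \mathcal{W}_2(S_n, Z) \le \frac{5 \sqrt{d}\, \beta\, (1 + \log n)}{\sqrt{n}}. $$
   Context: $\|\cdot\|$ is the Euclidean norm on $\mathbb{R}^d$ and $\log$ is the natural logarithm. For probability measures $\mu, \nu$ on $\mathbb{R}^d$, the quadratic transportation (Wasserstein) distance is $$\mathcal{W}_2(\mu,\nu) = \left( \inf_{\gamma \in \Gamma(\mu,\nu)} \int \|x-y\|^2 \, d\gamma(x,y) \right)^{1/2},$$ where $\Gamma(\mu,\nu)$ is the set of probability measures on $\mathbb{R}^d \times \mathbb{R}^d$ with marginals $\mu$ and $\nu$. For random vectors $X, Y$ with laws $\mu, \nu$, one writes $\mathcal{W}_2(X,Y) = \mathcal{W}_2(\mu,\nu)$. *)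

theory Defs
  imports "HOL-Probability.Probability"
begin

definition couplings ::
  "'a::euclidean_space measure \<Rightarrow> 'a measure \<Rightarrow> ('a \<times> 'a) measure set" where
  "couplings \<mu> \<nu> = {\<gamma>. prob_space \<gamma> \<and> sets \<gamma> = sets (borel \<Otimes>\<^sub>M borel) \<and>
     distr \<gamma> borel fst = \<mu> \<and> distr \<gamma> borel snd = \<nu>}"

definition ennsqrt :: "ennreal \<Rightarrow> ennreal" where
  "ennsqrt x = (if x = \<top> then \<top> else ennreal (sqrt (enn2real x)))"

text \<open>The distance takes values in \<open>ennreal\<close>, so that a missing second moment yields
  \<open>\<top>\<close> rather than a finite default value.\<close>

definition W2 :: "'a::euclidean_space measure \<Rightarrow> 'a measure \<Rightarrow> ennreal" where
  "W2 \<mu> \<nu> = ennsqrt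
     (INF \<gamma>\<in>couplings \<mu> \<nu>. \<integral>\<^sup>+ (x, y). ennreal ((norm (x - y))\<^sup>2) \<partial>\<gamma>)"

definition covariance_matrix :: "'w measure \<Rightarrow> ('w \<Rightarrow> real ^ 'd) \<Rightarrow> real ^ 'd ^ 'd" where
  "covariance_matrix M X = (\<chi> i j.
     (\<integral>\<omega>. (X \<omega> $ i - (\<integral>\<eta>. X \<eta> $ i \<partial>M)) * (X \<omega> $ j - (\<integral>\<eta>. X \<eta> $ j \<partial>M)) \<partial>M))"

text \<open>The normal law with mean \<open>m\<close> and standard deviation \<open>\<sigma> \<ge> 0\<close>. The case \<open>\<sigma> = 0\<close> is the
  Dirac mass at \<open>m\<close>; \<open>normal_density m 0\<close> is identically zero and would give the null measure.\<close>

definition normal_law :: "real \<Rightarrow> real \<Rightarrow> real measure" where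
  "normal_law m \<sigma> = (if \<sigma> = 0 then return borel m
     else density lborel (\<lambda>x. ennreal (normal_density m \<sigma> x)))"

text \<open>A random vector is Gaussian if each of its linear functionals is a (possibly degenerate)
  normal variable; this allows a singular covariance matrix.\<close>

definition gaussian_vector :: "'w measure \<Rightarrow> ('w \<Rightarrow> 'a::euclidean_space) \<Rightarrow> bool" where
  "gaussian_vector M Z \<longleftrightarrow> Z \<in> borel_measurable M \<and>
     (\<forall>u. \<exists>m \<sigma>. \<sigma> \<ge> 0 \<and> distr M borel (\<lambda>\<omega>. u \<bullet> Z \<omega>) = normal_law m \<sigma>)"

end

theory Submission imports Defs begin

text \<open>Lindeberg's replacement, with every step carried out in \<open>W2\<close>. Convolving both laws with
  \<open>N(0, 3 \<beta>\<^sup>2 I)\<close> costs \<open>\<surd>3 \<surd>d \<beta>\<close> on either side. After that it suffices that replacing one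
  Gaussian summand by a bounded one \<open>Y\<close> with the same covariance costs little:
  \<open>W2 (N(0, v)) (Y + N(0, v - s)) \<le> 5 \<surd>d \<beta> / (m + 4)\<close> for \<open>v = 3 \<beta>\<^sup>2 I + (m + 1) \<Sigma>\<close> and \<open>s = \<Sigma>\<close>;
  the sum over \<open>m\<close> is harmonic.

  For one step, transport \<open>\<rho>0 = N(0, v)\<close> to the half mixture \<open>\<rho>h = (\<rho>0 + \<rho>1) / 2\<close>, whose density
  with respect to \<open>\<rho>0\<close> is at least \<open>1/2\<close>. In one dimension the cost of the monotone map is
  controlled by a weighted Hardy inequality, the weight being the Stein kernel, and the Knothe map
  reduces \<open>d\<close> dimensions to one. This bounds the squared cost by the Fisher-type energy
  \<open>\<integral> \<parallel>v \<nabla>f\<parallel>\<^sup>2 d\<rho>0\<close>, which Mehler's formula turns into a double integral over two copies of \<open>Y\<close>.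
  There the first order terms cancel, because means and covariances agree. Finally
  \<open>W2 \<rho>0 \<rho>1 \<le> W2 \<rho>0 \<rho>h + W2 \<rho>h \<rho>1 \<le> W2 \<rho>0 \<rho>h + W2 \<rho>0 \<rho>1 / \<surd>2\<close>, so passing to the mixture only
  loses the factor \<open>2 + \<surd>2\<close>.\<close>

section \<open>Couplings\<close>

text \<open>\<open>\<Sigma>\<close> may be singular and the summands discrete, so without smoothing
  there need be no densities to compare. The amount \<open>3 \<beta>\<^sup>2\<close> keeps the
  exponent of the Mehler kernel bounded, and together with
  \<open>\<Sigma> \<le> \<beta>\<^sup>2 I\<close> it gives \<open>v \<ge> (m + 4) \<Sigma>\<close>,
  the source of the rate. The mixture is there because the cost of the monotone map is divided by a
  lower bound of the target density, and \<open>\<rho>1\<close> in general has none relative to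
  \<open>\<rho>0\<close>. In coordinates that diagonalise \<open>\<Sigma>\<close> the law
  \<open>\<rho>0\<close> is a product; the Knothe map then needs only the marginal densities, whose
  derivatives are no larger in L2 than those of the full density. With
  \<open>D = d / (m + 4)\<^sup>2\<close> the energy is at most \<open>4 \<beta>\<^sup>2 D\<close>,
  the squared cost half of the energy, and \<open>(2 + \<surd>2) \<surd>2 < 5\<close>. All this is
  for \<open>D \<le> 1/20\<close>; for larger \<open>D\<close> a direct coupling is good enough. In
  units of \<open>\<surd>d \<beta>\<close> the two smoothings cost less than \<open>15/4\<close> and
  the harmonic sum at most \<open>5 (1/4 + ln n)\<close>, together
  \<open>5 (1 + ln n)\<close>.\<close>

definition transport_cost :: "('a::euclidean_space \<times> 'a) measure \<Rightarrow> ennreal" where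
  "transport_cost \<gamma> = (\<integral>\<^sup>+ (x, y). ennreal ((norm (x - y))\<^sup>2) \<partial>\<gamma>)"

lemma ennsqrt_le_iff:
  assumes "0 \<le> A"
  shows "ennsqrt x \<le> ennreal A \<longleftrightarrow> x \<le> ennreal (A\<^sup>2)"
proof (cases x)
  case (real r)
  then show ?thesis
    using assms by (auto simp: ennsqrt_def ennreal_le_iff real_sqrt_le_iff sqrt_le_D real_le_lsqrt)
next
  case top
  then show ?thesis by (simp add: ennsqrt_def top_unique)
qed

lemma W2_le_iff:
  assumes "0 \<le> A"
  shows "W2 \<mu> \<nu> \<le> ennreal A \<longleftrightarrow> (INF \<gamma>\<in>couplings \<mu> \<nu>. transport_cost \<gamma>) \<le> ennreal (A\<^sup>2)"
  unfolding W2_def transport_cost_def using ennsqrt_le_iff[OF assms] by simp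

lemma W2_le_coupling:
  assumes "\<gamma> \<in> couplings \<mu> \<nu>" "transport_cost \<gamma> \<le> ennreal (A\<^sup>2)" "0 \<le> A"
  shows "W2 \<mu> \<nu> \<le> ennreal A"
  using assms by (auto simp: W2_le_iff intro: INF_lower2)

lemma coupling_of_W2_le:
  assumes "W2 \<mu> \<nu> \<le> ennreal A" "0 \<le> A" "A < A'"
  obtains \<gamma> where "\<gamma> \<in> couplings \<mu> \<nu>" "transport_cost \<gamma> \<le> ennreal (A'\<^sup>2)"
proof -
  have "(INF \<gamma>\<in>couplings \<mu> \<nu>. transport_cost \<gamma>) \<le> ennreal (A\<^sup>2)"
    using assms W2_le_iff by blast
  also have "\<dots> < ennreal (A'\<^sup>2)"
    using assms by (simp add: ennreal_less_iff power_strict_mono)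
  finally obtain \<gamma> where "\<gamma> \<in> couplings \<mu> \<nu>" "transport_cost \<gamma> < ennreal (A'\<^sup>2)"
    by (auto simp: INF_less_iff)
  then show ?thesis using that by (simp add: order.strict_implies_order)
qed

text \<open>The joint law of two random vectors on a common space is a coupling of their laws. Upper
  bounds on \<open>W2\<close> are produced in this form below.\<close>

lemma W2_distr_le:
  fixes f g :: "'c \<Rightarrow> 'a::euclidean_space"
  assumes "prob_space K" and [measurable]: "f \<in> borel_measurable K" "g \<in> borel_measurable K"
    and "(\<integral>\<^sup>+ \<omega>. ennreal ((norm (f \<omega> - g \<omega>))\<^sup>2) \<partial>K) \<le> ennreal (A\<^sup>2)" "0 \<le> A"
  shows "W2 (distr K borel f) (distr K borel g) \<le> ennreal A"
proof -
  interpret prob_space K by fact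
  let ?\<gamma> = "distr K (borel \<Otimes>\<^sub>M borel) (\<lambda>\<omega>. (f \<omega>, g \<omega>))"
  have "?\<gamma> \<in> couplings (distr K borel f) (distr K borel g)"
    unfolding couplings_def by (auto intro!: prob_space_distr simp: distr_distr comp_def)
  moreover have "transport_cost ?\<gamma> \<le> ennreal (A\<^sup>2)"
    using assms(4) by (simp add: transport_cost_def nn_integral_distr split_beta')
  ultimately show ?thesis using assms(5) by (rule W2_le_coupling)
qed

lemma couplingsD:
  assumes "\<gamma> \<in> couplings \<mu> \<nu>"
  shows "prob_space \<gamma>" "sets \<gamma> = sets (borel \<Otimes>\<^sub>M borel)"
    "\<mu> = distr \<gamma> borel fst" "\<nu> = distr \<gamma> borel snd"
  using assms by (auto simp: couplings_def)

lemma W2_le_limit: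
  assumes "\<And>A'. A < A' \<Longrightarrow> W2 \<mu> \<nu> \<le> ennreal A'"
  shows "W2 \<mu> \<nu> \<le> ennreal A"
proof (cases "0 \<le> A")
  case True
  show ?thesis
  proof (rule ennreal_le_epsilon)
    fix e :: real assume "0 < e"
    then show "W2 \<mu> \<nu> \<le> ennreal A + ennreal e"
      using assms[of "A + e"] True by (simp add: ennreal_plus)
  qed
next
  \<comment> \<open>\<open>ennreal\<close> sends negative numbers to \<open>0\<close>, so the
    hypothesis at \<open>A' = 0\<close> already is the claim.\<close>
  case False
  then show ?thesis using assms[of 0] by (simp add: ennreal_neg)
qed

text \<open>Cauchy--Schwarz with weights. When \<open>A\<close>, \<open>B\<close>, \<open>C\<close>
  bound the L2 norms of \<open>a\<close>, \<open>b\<close>, \<open>c\<close>, integrating it gives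
  Minkowski's inequality for three summands without a square root of an integral.\<close>

lemma add3_sq_le:
  fixes a b c A B C :: real
  assumes "0 < A" "0 < B" "0 < C"
  shows "(a + b + c)\<^sup>2 \<le> (A + B + C) * (a\<^sup>2 / A + b\<^sup>2 / B + c\<^sup>2 / C)"
proof -
  have *: "2 * a * b \<le> a\<^sup>2 * B / A + b\<^sup>2 * A / B" if "0 < A" "0 < B" for a b A B :: real
  proof -
    have "0 \<le> (a * B - b * A)\<^sup>2 / (A * B)" using that by simp
    also have "\<dots> = a\<^sup>2 * B / A + b\<^sup>2 * A / B - 2 * a * b"
      using that by (simp add: field_simps power2_eq_square)
    finally show ?thesis by simp
  qed
  have "(A + B + C) * (a\<^sup>2 / A + b\<^sup>2 / B + c\<^sup>2 / C) =
      a\<^sup>2 + b\<^sup>2 + c\<^sup>2 + (a\<^sup>2 * B / A + b\<^sup>2 * A / B) + (a\<^sup>2 * C / A + c\<^sup>2 * A / C) + (b\<^sup>2 * C / B + c\<^sup>2 * B / C)"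
    using assms by (simp add: field_simps)
  then show ?thesis
    using *[of A B a b] *[of A C a c] *[of B C b c] assms
    by (simp add: power2_eq_square algebra_simps)
qed

text \<open>Disintegration is avoided in the gluing of two couplings: the intermediate variable is
  quantized by \<open>q\<close>, and the couplings are made conditionally independent given its cell.\<close>

lemma ex_quantization:
  assumes "0 < (\<epsilon>::real)"
  obtains q :: "'a::euclidean_space \<Rightarrow> nat" where "q \<in> measurable borel (count_space UNIV)"
    "\<And>x y. q x = q y \<Longrightarrow> norm (x - y) \<le> \<epsilon>"
proof -
  obtain D :: "'a set" where D: "countable D" "\<And>X. open X \<Longrightarrow> X \<noteq> {} \<Longrightarrow> \<exists>d\<in>D. d \<in> X"
    using countable_dense_exists by (metis)
  have "D \<noteq> {}" using D(2)[of UNIV] by auto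
  define g where "g = from_nat_into D"
  define q where "q x = (LEAST n. dist x (g n) < \<epsilon> / 2)" for x
  have ex: "\<exists>n. dist x (g n) < \<epsilon> / 2" for x
  proof -
    obtain d where "d \<in> D" "d \<in> ball x (\<epsilon> / 2)" using D(2)[of "ball x (\<epsilon> / 2)"] assms by auto
    then show ?thesis using D(1) from_nat_into_surj[of D d] by (auto simp: g_def)
  qed
  have q: "dist x (g (q x)) < \<epsilon> / 2" for x
    unfolding q_def using ex by (rule LeastI_ex)
  show ?thesis
  proof
    show "q \<in> measurable borel (count_space UNIV)"
      unfolding q_def by measurable
    fix x y assume "q x = q y"
    then have "dist x y < \<epsilon> / 2 + \<epsilon> / 2"
      using q[of x] q[of y] dist_triangle2[of x y "g (q x)"] by auto
    then show "norm (x - y) \<le> \<epsilon>" by (simp add: dist_norm)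
  qed
qed

lemma glue_couplings:
  fixes \<mu> \<nu> \<rho> :: "'a::euclidean_space measure" and q :: "'a \<Rightarrow> nat"
  assumes \<gamma>1: "\<gamma>1 \<in> couplings \<mu> \<nu>" and \<gamma>2: "\<gamma>2 \<in> couplings \<nu> \<rho>"
    and q[measurable]: "q \<in> measurable borel (count_space UNIV)"
  obtains \<Theta> where "prob_space \<Theta>" "sets \<Theta> = sets (\<gamma>1 \<Otimes>\<^sub>M \<gamma>2)"
    "distr \<Theta> \<gamma>1 fst = \<gamma>1" "distr \<Theta> \<gamma>2 snd = \<gamma>2"
    "AE ((x, y), (y', z)) in \<Theta>. q y = q y'"
proof -
  interpret G1: prob_space \<gamma>1 using couplingsD(1)[OF \<gamma>1] .
  interpret G2: prob_space \<gamma>2 using couplingsD(1)[OF \<gamma>2] .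
  interpret pair_prob_space \<gamma>1 \<gamma>2 ..
  note [measurable_cong] = couplingsD(2)[OF \<gamma>1] couplingsD(2)[OF \<gamma>2]
  have [measurable]: "snd \<in> borel_measurable \<gamma>1" "fst \<in> borel_measurable \<gamma>2"
    by measurable
  define w where "w n = emeasure \<nu> (q -` {n})" for n
  have im: "(\<lambda>p. indicator {n} (q (snd p)) :: ennreal) \<in> borel_measurable \<gamma>1" for n
    by (rule measurable_compose[OF measurable_compose[OF _ q]]) auto
  have im: "(\<lambda>p. indicator {n} (q (snd p)) :: ennreal) \<in> borel_measurable \<gamma>1"
    "(\<lambda>p. indicator {n} (q (fst p)) :: ennreal) \<in> borel_measurable \<gamma>2" for n
    by (rule measurable_compose[OF measurable_compose[OF _ q]]; auto)+
  have w1: "w n = (\<integral>\<^sup>+ p. indicator {n} (q (snd p)) \<partial>\<gamma>1)" for n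
  proof -
    have "w n = emeasure \<gamma>1 (snd -` (q -` {n}) \<inter> space \<gamma>1)"
      unfolding w_def couplingsD(4)[OF \<gamma>1]
      by (subst emeasure_distr) (auto intro!: measurable_sets_borel[OF q])
    also have "\<dots> = (\<integral>\<^sup>+ p. indicator (snd -` (q -` {n}) \<inter> space \<gamma>1) p \<partial>\<gamma>1)"
      by (subst nn_integral_indicator) (auto intro!: measurable_sets[where A=borel] measurable_sets_borel[OF q])
    also have "\<dots> = (\<integral>\<^sup>+ p. indicator {n} (q (snd p)) \<partial>\<gamma>1)"
      by (intro nn_integral_cong) (auto split: split_indicator)
    finally show ?thesis .
  qed
  have w2: "w n = (\<integral>\<^sup>+ p. indicator {n} (q (fst p)) \<partial>\<gamma>2)" for n
  proof -
    have "w n = emeasure \<gamma>2 (fst -` (q -` {n}) \<inter> space \<gamma>2)"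
      unfolding w_def couplingsD(3)[OF \<gamma>2]
      by (subst emeasure_distr) (auto intro!: measurable_sets_borel[OF q])
    also have "\<dots> = (\<integral>\<^sup>+ p. indicator (fst -` (q -` {n}) \<inter> space \<gamma>2) p \<partial>\<gamma>2)"
      by (subst nn_integral_indicator) (auto intro!: measurable_sets[where A=borel] measurable_sets_borel[OF q])
    also have "\<dots> = (\<integral>\<^sup>+ p. indicator {n} (q (fst p)) \<partial>\<gamma>2)"
      by (intro nn_integral_cong) (auto split: split_indicator)
    finally show ?thesis .
  qed
  have wfin: "w n \<noteq> \<top>" for n
  proof -
    have "w n \<le> (\<integral>\<^sup>+ p. 1 \<partial>\<gamma>1)" unfolding w1 by (intro nn_integral_mono) (auto split: split_indicator)
    also have "\<dots> = 1" by (simp add: G1.emeasure_space_1)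
    finally show ?thesis by (auto simp: top_unique)
  qed
  \<comment> \<open>Cells of mass zero have to be avoided, because \<open>w n / w n\<close> is
    \<open>1\<close> only for \<open>w n \<noteq> 0\<close>.\<close>
  have w0: "AE p in \<gamma>1. w (q (snd p)) \<noteq> 0" "AE p in \<gamma>2. w (q (fst p)) \<noteq> 0"
  proof -
    have "AE p in \<gamma>1. \<forall>n. w n = 0 \<longrightarrow> q (snd p) \<noteq> n"
      unfolding AE_all_countable
    proof
      fix n show "AE p in \<gamma>1. w n = 0 \<longrightarrow> q (snd p) \<noteq> n"
      proof (cases "w n = 0")
        case True
        then have "AE p in \<gamma>1. indicator {n} (q (snd p)) = (0::ennreal)"
          unfolding w1 by (subst nn_integral_0_iff_AE[symmetric]) (auto simp: im)
        then show ?thesis by (auto elim!: eventually_mono split: split_indicator_asm)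
      qed auto
    qed
    then show "AE p in \<gamma>1. w (q (snd p)) \<noteq> 0" by (auto elim!: eventually_mono)
    have "AE p in \<gamma>2. \<forall>n. w n = 0 \<longrightarrow> q (fst p) \<noteq> n"
      unfolding AE_all_countable
    proof
      fix n show "AE p in \<gamma>2. w n = 0 \<longrightarrow> q (fst p) \<noteq> n"
      proof (cases "w n = 0")
        case True
        then have "AE p in \<gamma>2. indicator {n} (q (fst p)) = (0::ennreal)"
          unfolding w2 by (subst nn_integral_0_iff_AE[symmetric]) (auto simp: im)
        then show ?thesis by (auto elim!: eventually_mono split: split_indicator_asm)
      qed auto
    qed
    then show "AE p in \<gamma>2. w (q (fst p)) \<noteq> 0" by (auto elim!: eventually_mono)
  qed
  \<comment> \<open>The density, relative to the product, of the two couplings made independent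
    given the cell. Both couplings give the cell \<open>n\<close> the same mass \<open>w n\<close>,
    that of the common marginal \<open>\<nu>\<close>, so integrating out either factor leaves
    \<open>w n / w n\<close>. The form \<open>h'\<close> names the cell by the other middle point,
    which is the same cell wherever the numerator does not vanish.\<close>
  define h where "h = (\<lambda>(p :: 'a \<times> 'a, p' :: 'a \<times> 'a). indicator {q (snd p)} (q (fst p')) / w (q (snd p)) :: ennreal)"
  have h': "h = (\<lambda>(p, p'). indicator {q (fst p')} (q (snd p)) / w (q (fst p')) :: ennreal)"
    by (auto simp: h_def fun_eq_iff split: split_indicator)
  have indm: "(\<lambda>(m, n). indicator {m} n :: ennreal) \<in> borel_measurable (count_space UNIV \<Otimes>\<^sub>M count_space (UNIV::nat set))"
    by (simp add: pair_measure_countable)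
  have [measurable]: "h \<in> borel_measurable (\<gamma>1 \<Otimes>\<^sub>M \<gamma>2)"
  proof -
    have "(\<lambda>x. (\<lambda>(m, n). indicator {m} n :: ennreal) (q (snd (fst x)), q (fst (snd x)))) \<in> borel_measurable (\<gamma>1 \<Otimes>\<^sub>M \<gamma>2)"
      by (rule measurable_compose[OF _ indm]) measurable
    then show ?thesis unfolding h_def split_beta' by simp
  qed
  define \<Theta> where "\<Theta> = density (\<gamma>1 \<Otimes>\<^sub>M \<gamma>2) h"
  have cancel: "w n / w n = 1" if "w n \<noteq> 0" for n
    using that wfin[of n] by (simp add: ennreal_divide_self less_top)
  have m1: "AE p in \<gamma>1. (\<integral>\<^sup>+ p'. h (p, p') \<partial>\<gamma>2) = 1"
    using w0(1)
  proof eventually_elim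
    case (elim p)
    have "(\<integral>\<^sup>+ p'. h (p, p') \<partial>\<gamma>2) = w (q (snd p)) / w (q (snd p))"
      unfolding h_def by (simp add: nn_integral_divide im flip: w2)
    then show ?case using cancel elim by simp
  qed
  have m2: "AE p' in \<gamma>2. (\<integral>\<^sup>+ p. h (p, p') \<partial>\<gamma>1) = 1"
    using w0(2)
  proof eventually_elim
    case (elim p')
    have "(\<integral>\<^sup>+ p. h (p, p') \<partial>\<gamma>1) = w (q (fst p')) / w (q (fst p'))"
      unfolding h' by (simp add: nn_integral_divide im flip: w1)
    then show ?case using cancel elim by simp
  qed
  have d1: "distr \<Theta> \<gamma>1 fst = \<gamma>1"
  proof (rule measure_eqI)
    fix A assume "A \<in> sets (distr \<Theta> \<gamma>1 fst)"
    then have [measurable]: "A \<in> sets \<gamma>1" by simp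
    have "emeasure (distr \<Theta> \<gamma>1 fst) A = (\<integral>\<^sup>+ x. indicator A x \<partial>distr \<Theta> \<gamma>1 fst)" by simp
    also have "\<dots> = (\<integral>\<^sup>+ x. h x * indicator A (fst x) \<partial>(\<gamma>1 \<Otimes>\<^sub>M \<gamma>2))"
      unfolding \<Theta>_def by (subst nn_integral_distr) (auto simp: nn_integral_density)
    also have "\<dots> = (\<integral>\<^sup>+ p. \<integral>\<^sup>+ p'. h (p, p') * indicator A p \<partial>\<gamma>2 \<partial>\<gamma>1)"
      by (subst G2.nn_integral_fst[symmetric]) auto
    also have "\<dots> = (\<integral>\<^sup>+ p. (\<integral>\<^sup>+ p'. h (p, p') \<partial>\<gamma>2) * indicator A p \<partial>\<gamma>1)"
      by (intro nn_integral_cong nn_integral_multc) auto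
    also have "\<dots> = (\<integral>\<^sup>+ p. indicator A p \<partial>\<gamma>1)"
      using m1 by (intro nn_integral_cong_AE) (auto elim!: eventually_mono)
    finally show "emeasure (distr \<Theta> \<gamma>1 fst) A = emeasure \<gamma>1 A" by simp
  qed simp
  have d2: "distr \<Theta> \<gamma>2 snd = \<gamma>2"
  proof (rule measure_eqI)
    fix A assume "A \<in> sets (distr \<Theta> \<gamma>2 snd)"
    then have [measurable]: "A \<in> sets \<gamma>2" by simp
    have "emeasure (distr \<Theta> \<gamma>2 snd) A = (\<integral>\<^sup>+ x. indicator A x \<partial>distr \<Theta> \<gamma>2 snd)" by simp
    also have "\<dots> = (\<integral>\<^sup>+ x. h x * indicator A (snd x) \<partial>(\<gamma>1 \<Otimes>\<^sub>M \<gamma>2))"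
      unfolding \<Theta>_def by (subst nn_integral_distr) (auto simp: nn_integral_density)
    also have "\<dots> = (\<integral>\<^sup>+ p'. \<integral>\<^sup>+ p. h (p, p') * indicator A p' \<partial>\<gamma>1 \<partial>\<gamma>2)"
      by (subst nn_integral_snd[symmetric]) auto
    also have "\<dots> = (\<integral>\<^sup>+ p'. (\<integral>\<^sup>+ p. h (p, p') \<partial>\<gamma>1) * indicator A p' \<partial>\<gamma>2)"
      by (intro nn_integral_cong nn_integral_multc) auto
    also have "\<dots> = (\<integral>\<^sup>+ p'. indicator A p' \<partial>\<gamma>2)"
      using m2 by (intro nn_integral_cong_AE) (auto elim!: eventually_mono)
    finally show "emeasure (distr \<Theta> \<gamma>2 snd) A = emeasure \<gamma>2 A" by simp
  qed simp
  show ?thesis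
  proof
    show "prob_space \<Theta>"
    proof (rule prob_space_distrD)
      show "fst \<in> measurable \<Theta> \<gamma>1" unfolding \<Theta>_def by simp
      show "prob_space (distr \<Theta> \<gamma>1 fst)" unfolding d1 by (rule G1.prob_space_axioms)
    qed
    show "sets \<Theta> = sets (\<gamma>1 \<Otimes>\<^sub>M \<gamma>2)" unfolding \<Theta>_def by simp
    show "AE ((x, y), (y', z)) in \<Theta>. q y = q y'"
      unfolding \<Theta>_def by (subst AE_density) (auto simp: h_def split: split_indicator_asm)
  qed (fact d1 d2)+
qed

section \<open>Triangle inequality and behaviour under convolution, scaling, noise and
  mixing\<close>

lemma W2_triangle_le:
  fixes \<mu> \<nu> \<rho> :: "'a::euclidean_space measure"
  assumes W1: "W2 \<mu> \<nu> \<le> ennreal A" and W2: "W2 \<nu> \<rho> \<le> ennreal B" and AB: "0 \<le> A" "0 \<le> B"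
  shows "W2 \<mu> \<rho> \<le> ennreal (A + B)"
proof (rule W2_le_limit)
  fix C assume "A + B < C"
  \<comment> \<open>The slack is split into three: one part for each nearly optimal coupling and one
    for the mesh of the quantization. It also makes all three weights in \<open>add3_sq_le\<close>
    positive when \<open>A\<close> or \<open>B\<close> is \<open>0\<close>.\<close>
  define \<epsilon> where "\<epsilon> = (C - (A + B)) / 3"
  have \<epsilon>: "0 < \<epsilon>" "A + \<epsilon> + (B + \<epsilon>) + \<epsilon> = C" using \<open>A + B < C\<close> by (auto simp: \<epsilon>_def field_simps)
  obtain \<gamma>1 where \<gamma>1: "\<gamma>1 \<in> couplings \<mu> \<nu>" and c1: "transport_cost \<gamma>1 \<le> ennreal ((A + \<epsilon>)\<^sup>2)"
    using coupling_of_W2_le[OF W1, of "A + \<epsilon>"] AB \<epsilon> by auto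
  obtain \<gamma>2 where \<gamma>2: "\<gamma>2 \<in> couplings \<nu> \<rho>" and c2: "transport_cost \<gamma>2 \<le> ennreal ((B + \<epsilon>)\<^sup>2)"
    using coupling_of_W2_le[OF W2, of "B + \<epsilon>"] AB \<epsilon> by auto
  obtain q :: "'a \<Rightarrow> nat" where q[measurable]: "q \<in> measurable borel (count_space UNIV)"
    and qd: "\<And>x y. q x = q y \<Longrightarrow> norm (x - y) \<le> \<epsilon>"
    using ex_quantization[OF \<epsilon>(1)] by metis
  obtain \<Theta> where "prob_space \<Theta>" and s\<Theta>: "sets \<Theta> = sets (\<gamma>1 \<Otimes>\<^sub>M \<gamma>2)"
    and d1: "distr \<Theta> \<gamma>1 fst = \<gamma>1" and d2: "distr \<Theta> \<gamma>2 snd = \<gamma>2"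
    and ae: "AE ((x, y), (y', z)) in \<Theta>. q y = q y'"
    using glue_couplings[OF \<gamma>1 \<gamma>2 q] by metis
  interpret prob_space \<Theta> by fact
  note [measurable_cong] = couplingsD(2)[OF \<gamma>1] couplingsD(2)[OF \<gamma>2] s\<Theta>
  have [measurable]: "fst \<in> measurable \<Theta> \<gamma>1" "snd \<in> measurable \<Theta> \<gamma>2"
    by simp_all
  have \<mu>: "\<mu> = distr \<Theta> borel (\<lambda>p. fst (fst p))"
  proof -
    have "\<mu> = distr (distr \<Theta> \<gamma>1 fst) borel fst" using couplingsD(3)[OF \<gamma>1] d1 by simp
    then show ?thesis by (simp add: distr_distr comp_def)
  qed
  have \<rho>: "\<rho> = distr \<Theta> borel (\<lambda>p. snd (snd p))"
  proof -
    have "\<rho> = distr (distr \<Theta> \<gamma>2 snd) borel snd" using couplingsD(4)[OF \<gamma>2] d2 by simp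
    then show ?thesis by (simp add: distr_distr comp_def)
  qed
  have c1': "(\<integral>\<^sup>+ p. ennreal ((norm (fst (fst p) - snd (fst p)))\<^sup>2) \<partial>\<Theta>) \<le> ennreal ((A + \<epsilon>)\<^sup>2)"
    using c1 unfolding transport_cost_def
    by (subst (asm) d1[symmetric]) (simp add: nn_integral_distr split_beta')
  have c2': "(\<integral>\<^sup>+ p. ennreal ((norm (fst (snd p) - snd (snd p)))\<^sup>2) \<partial>\<Theta>) \<le> ennreal ((B + \<epsilon>)\<^sup>2)"
    using c2 unfolding transport_cost_def
    by (subst (asm) d2[symmetric]) (simp add: nn_integral_distr split_beta')
  define a where "a p = norm (fst (fst p) - snd (fst p))" for p :: "('a \<times> 'a) \<times> ('a \<times> 'a)"
  define b where "b p = norm (fst (snd p) - snd (snd p))" for p :: "('a \<times> 'a) \<times> ('a \<times> 'a)"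
  have [measurable]: "a \<in> borel_measurable \<Theta>" "b \<in> borel_measurable \<Theta>"
    unfolding a_def b_def by measurable
  have pos: "0 < A + \<epsilon>" "0 < B + \<epsilon>" using AB \<epsilon> by auto
  have "(\<integral>\<^sup>+ p. ennreal ((norm (fst (fst p) - snd (snd p)))\<^sup>2) \<partial>\<Theta>)
      \<le> (\<integral>\<^sup>+ p. ennreal C * (ennreal ((a p)\<^sup>2) / ennreal (A + \<epsilon>) + ennreal ((b p)\<^sup>2) / ennreal (B + \<epsilon>) + ennreal \<epsilon>) \<partial>\<Theta>)"
  proof (intro nn_integral_mono_AE, use ae in eventually_elim)
    fix p :: "('a \<times> 'a) \<times> ('a \<times> 'a)"
    assume "case p of (xa, xb) \<Rightarrow> (case xa of (x, y) \<Rightarrow> \<lambda>(y', z). q y = q y') xb"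
    then have "norm (snd (fst p) - fst (snd p)) \<le> \<epsilon>" using qd by (auto simp: split_beta')
    moreover have "norm (fst (fst p) - snd (snd p)) \<le> a p + b p + norm (snd (fst p) - fst (snd p))"
      unfolding a_def b_def
      using norm_triangle_ineq[of "fst (fst p) - snd (fst p)" "snd (fst p) - snd (snd p)"]
        norm_triangle_ineq[of "snd (fst p) - fst (snd p)" "fst (snd p) - snd (snd p)"] by simp
    ultimately have "norm (fst (fst p) - snd (snd p)) \<le> a p + b p + \<epsilon>" by simp
    then have "(norm (fst (fst p) - snd (snd p)))\<^sup>2 \<le> (a p + b p + \<epsilon>)\<^sup>2" by (intro power_mono) auto
    also have "\<dots> \<le> C * ((a p)\<^sup>2 / (A + \<epsilon>) + (b p)\<^sup>2 / (B + \<epsilon>) + \<epsilon>\<^sup>2 / \<epsilon>)"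
      using add3_sq_le[of "A + \<epsilon>" "B + \<epsilon>" \<epsilon> "a p" "b p" \<epsilon>] pos \<epsilon> by simp
    also have "\<epsilon>\<^sup>2 / \<epsilon> = \<epsilon>" using \<epsilon> by (simp add: power2_eq_square)
    finally have "ennreal ((norm (fst (fst p) - snd (snd p)))\<^sup>2) \<le> ennreal (C * ((a p)\<^sup>2 / (A + \<epsilon>) + (b p)\<^sup>2 / (B + \<epsilon>) + \<epsilon>))"
      by (rule ennreal_leI)
    also have "\<dots> = ennreal C * (ennreal ((a p)\<^sup>2) / ennreal (A + \<epsilon>) + ennreal ((b p)\<^sup>2) / ennreal (B + \<epsilon>) + ennreal \<epsilon>)"
      using pos \<epsilon> by (simp add: ennreal_mult ennreal_plus divide_ennreal)
    finally show "ennreal ((norm (fst (fst p) - snd (snd p)))\<^sup>2)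
       \<le> ennreal C * (ennreal ((a p)\<^sup>2) / ennreal (A + \<epsilon>) + ennreal ((b p)\<^sup>2) / ennreal (B + \<epsilon>) + ennreal \<epsilon>)" .
  qed
  also have "\<dots> = ennreal C * ((\<integral>\<^sup>+ p. ennreal ((a p)\<^sup>2) \<partial>\<Theta>) / ennreal (A + \<epsilon>)
      + (\<integral>\<^sup>+ p. ennreal ((b p)\<^sup>2) \<partial>\<Theta>) / ennreal (B + \<epsilon>) + ennreal \<epsilon>)"
    by (simp add: nn_integral_cmult nn_integral_add nn_integral_divide emeasure_space_1)
  also have "\<dots> \<le> ennreal C * (ennreal ((A + \<epsilon>)\<^sup>2) / ennreal (A + \<epsilon>) + ennreal ((B + \<epsilon>)\<^sup>2) / ennreal (B + \<epsilon>) + ennreal \<epsilon>)"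
    using c1' c2' unfolding a_def b_def by (intro mult_left_mono add_mono divide_right_mono_ennreal) auto
  also have "\<dots> = ennreal (C * (A + \<epsilon> + (B + \<epsilon>) + \<epsilon>))"
    unfolding divide_ennreal[OF zero_le_power2 pos(1)] divide_ennreal[OF zero_le_power2 pos(2)]
    using pos \<epsilon> by (simp add: power2_eq_square ennreal_mult'' flip: ennreal_plus)
  also have "\<dots> = ennreal (C\<^sup>2)" using \<epsilon> by (simp add: power2_eq_square)
  finally show "W2 \<mu> \<rho> \<le> ennreal C"
    unfolding \<mu> \<rho> using \<open>A + B < C\<close> AB prob_space_axioms by (intro W2_distr_le) auto
qed

text \<open>One independent draw from \<open>\<mu>\<close> is added to both points of a coupled
  pair, which does not change their difference. This carries a bound for a single summand over to
  the whole sum.\<close>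

lemma W2_convolution_le:
  fixes \<mu> \<rho> \<rho>' :: "'a::ordered_euclidean_space measure"
  assumes "prob_space \<mu>" and [measurable_cong, simp]: "sets \<mu> = sets borel"
    and W: "W2 \<rho> \<rho>' \<le> ennreal A" and "0 \<le> A"
  shows "W2 (\<mu> \<star> \<rho>) (\<mu> \<star> \<rho>') \<le> ennreal A"
proof (rule W2_le_limit)
  fix A' assume "A < A'"
  then obtain \<gamma> where \<gamma>: "\<gamma> \<in> couplings \<rho> \<rho>'" and c: "transport_cost \<gamma> \<le> ennreal (A'\<^sup>2)"
    using coupling_of_W2_le[OF W] \<open>0 \<le> A\<close> by metis
  interpret \<mu>: prob_space \<mu> by fact
  interpret G: prob_space \<gamma> using couplingsD(1)[OF \<gamma>] .
  interpret pair_prob_space \<mu> \<gamma> ..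
  note [measurable_cong] = couplingsD(2)[OF \<gamma>]
  have [measurable]: "fst \<in> borel_measurable \<gamma>" "snd \<in> borel_measurable \<gamma>"
    by measurable
  have \<mu>id: "distr \<mu> borel (\<lambda>x. x) = \<mu>" by (rule distr_id2) simp
  have conv: "\<mu> \<star> distr \<gamma> borel p = distr (\<mu> \<Otimes>\<^sub>M \<gamma>) borel (\<lambda>(s, x). s + p x)"
    if [measurable]: "p \<in> borel_measurable \<gamma>" for p
  proof -
    interpret D: prob_space "distr \<gamma> borel p" by (rule G.prob_space_distr) simp
    have "\<mu> \<Otimes>\<^sub>M distr \<gamma> borel p = distr \<mu> borel (\<lambda>x. x) \<Otimes>\<^sub>M distr \<gamma> borel p" unfolding \<mu>id ..
    also have "\<dots> = distr (\<mu> \<Otimes>\<^sub>M \<gamma>) (borel \<Otimes>\<^sub>M borel) (\<lambda>(s, x). (s, p x))"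
      by (rule pair_measure_distr) (auto intro: D.sigma_finite_measure)
    finally show ?thesis
      unfolding convolution_def by (simp add: distr_distr comp_def split_beta')
  qed
  have "(\<integral>\<^sup>+ z. ennreal ((norm ((case z of (s, x) \<Rightarrow> s + fst x) - (case z of (s, x) \<Rightarrow> s + snd x)))\<^sup>2) \<partial>(\<mu> \<Otimes>\<^sub>M \<gamma>))
      = (\<integral>\<^sup>+ s. \<integral>\<^sup>+ x. ennreal ((norm (fst x - snd x))\<^sup>2) \<partial>\<gamma> \<partial>\<mu>)"
    by (subst G.nn_integral_fst[symmetric]) (auto simp: split_beta')
  also have "\<dots> \<le> ennreal (A'\<^sup>2)"
    using c by (simp add: transport_cost_def split_beta' \<mu>.emeasure_space_1)
  finally show "W2 (\<mu> \<star> \<rho>) (\<mu> \<star> \<rho>') \<le> ennreal A'"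
    unfolding couplingsD(3)[OF \<gamma>] couplingsD(4)[OF \<gamma>]
    using \<open>0 \<le> A\<close> \<open>A < A'\<close> prob_space_axioms
    by (subst (1 2) conv) (auto intro!: W2_distr_le)
qed

lemma W2_scaleR_le:
  fixes \<mu> \<nu> :: "'a::euclidean_space measure"
  assumes W: "W2 \<mu> \<nu> \<le> ennreal A" and "0 \<le> A" "0 < c"
  shows "W2 (distr \<mu> borel (\<lambda>x. c *\<^sub>R x)) (distr \<nu> borel (\<lambda>x. c *\<^sub>R x)) \<le> ennreal (c * A)"
proof (rule W2_le_limit)
  fix B assume "c * A < B"
  then have "A < B / c" using \<open>0 < c\<close> by (simp add: field_simps)
  then obtain \<gamma> where \<gamma>: "\<gamma> \<in> couplings \<mu> \<nu>" and c: "transport_cost \<gamma> \<le> ennreal ((B / c)\<^sup>2)"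
    using coupling_of_W2_le[OF W] \<open>0 \<le> A\<close> by metis
  interpret G: prob_space \<gamma> using couplingsD(1)[OF \<gamma>] .
  note [measurable_cong] = couplingsD(2)[OF \<gamma>]
  have [measurable]: "fst \<in> borel_measurable \<gamma>" "snd \<in> borel_measurable \<gamma>"
    by measurable
  have "(\<integral>\<^sup>+ z. ennreal ((norm (c *\<^sub>R fst z - c *\<^sub>R snd z))\<^sup>2) \<partial>\<gamma>)
      = (\<integral>\<^sup>+ z. ennreal (c\<^sup>2) * ennreal ((norm (fst z - snd z))\<^sup>2) \<partial>\<gamma>)"
    by (intro nn_integral_cong)
      (simp add: power_mult_distrib flip: scaleR_diff_right ennreal_mult)
  also have "\<dots> = ennreal (c\<^sup>2) * transport_cost \<gamma>"
    by (simp add: nn_integral_cmult transport_cost_def split_beta')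
  also have "\<dots> \<le> ennreal (c\<^sup>2) * ennreal ((B / c)\<^sup>2)"
    using c by (intro mult_left_mono) auto
  also have "\<dots> = ennreal (B\<^sup>2)"
    using \<open>0 < c\<close> by (simp add: field_simps flip: ennreal_mult)
  finally show "W2 (distr \<mu> borel (\<lambda>x. c *\<^sub>R x)) (distr \<nu> borel (\<lambda>x. c *\<^sub>R x)) \<le> ennreal B"
    unfolding couplingsD(3)[OF \<gamma>] couplingsD(4)[OF \<gamma>]
    using \<open>0 \<le> A\<close> \<open>0 < c\<close> \<open>c * A < B\<close> G.prob_space_axioms
    by (auto simp: distr_distr comp_def intro!: W2_distr_le order.strict_implies_order[OF le_less_trans[OF _ \<open>c * A < B\<close>]])
qed

lemma W2_sym_le:
  assumes "W2 \<mu> \<nu> \<le> ennreal A" "0 \<le> A"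
  shows "W2 \<nu> \<mu> \<le> ennreal A"
proof (rule W2_le_limit)
  fix A' assume "A < A'"
  then obtain \<gamma> where \<gamma>: "\<gamma> \<in> couplings \<mu> \<nu>" and c: "transport_cost \<gamma> \<le> ennreal (A'\<^sup>2)"
    using coupling_of_W2_le[OF assms] by metis
  interpret G: prob_space \<gamma> using couplingsD(1)[OF \<gamma>] .
  note [measurable_cong] = couplingsD(2)[OF \<gamma>]
  show "W2 \<nu> \<mu> \<le> ennreal A'"
    unfolding couplingsD(3)[OF \<gamma>] couplingsD(4)[OF \<gamma>]
    using c assms \<open>A < A'\<close> G.prob_space_axioms
    by (intro W2_distr_le) (auto simp: transport_cost_def split_beta' norm_minus_commute)
qed

lemma emeasure_convolution_distr:
  fixes f :: "'v \<Rightarrow> 'a::ordered_euclidean_space" and g :: "'w \<Rightarrow> 'a"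
  assumes "prob_space N" "prob_space M" and [measurable]: "f \<in> borel_measurable N" "g \<in> borel_measurable M" "S \<in> sets borel"
  shows "emeasure (distr N borel f \<star> distr M borel g) S = (\<integral>\<^sup>+ x. \<integral>\<^sup>+ y. indicator S (f x + g y) \<partial>M \<partial>N)"
proof -
  interpret N: prob_space N by fact
  interpret M: prob_space M by fact
  interpret f: prob_space "distr N borel f" by (rule N.prob_space_distr) simp
  interpret g: prob_space "distr M borel g" by (rule M.prob_space_distr) simp
  have "emeasure (distr N borel f \<star> distr M borel g) S = (\<integral>\<^sup>+ x. \<integral>\<^sup>+ y. indicator S (x + y) \<partial>distr M borel g \<partial>distr N borel f)"
    by (rule convolution_emeasure') (auto intro: f.finite_measure_axioms g.finite_measure_axioms)
  also have "\<dots> = (\<integral>\<^sup>+ x. \<integral>\<^sup>+ y. indicator S (x + g y) \<partial>M \<partial>distr N borel f)"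
    by (intro nn_integral_cong nn_integral_distr) auto
  also have "\<dots> = (\<integral>\<^sup>+ x. \<integral>\<^sup>+ y. indicator S (f x + g y) \<partial>M \<partial>N)"
    by (rule nn_integral_distr) auto
  finally show ?thesis .
qed

text \<open>Coupling \<open>x\<close> with \<open>x + y\<close> makes the displacement the noise
  \<open>y\<close> itself.\<close>

lemma W2_add_noise:
  fixes \<mu> \<rho> :: "'a::ordered_euclidean_space measure"
  assumes \<mu>: "prob_space \<mu>" "sets \<mu> = sets borel" and \<rho>: "prob_space \<rho>" "sets \<rho> = sets borel"
    and c: "(\<integral>\<^sup>+ y. ennreal ((norm y)\<^sup>2) \<partial>\<rho>) \<le> ennreal (A\<^sup>2)" and "0 \<le> A"
  shows "W2 \<mu> (\<mu> \<star> \<rho>) \<le> ennreal A"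
proof -
  interpret M: prob_space \<mu> by fact
  interpret R: prob_space \<rho> by fact
  interpret pair_prob_space \<mu> \<rho> ..
  note [measurable_cong] = \<mu>(2) \<rho>(2)
  have f: "distr (\<mu> \<Otimes>\<^sub>M \<rho>) borel fst = \<mu>"
  proof (rule measure_eqI)
    fix S assume "S \<in> sets (distr (\<mu> \<Otimes>\<^sub>M \<rho>) borel fst)"
    then have [measurable]: "S \<in> sets borel" by simp
    have "emeasure (distr (\<mu> \<Otimes>\<^sub>M \<rho>) borel fst) S = (\<integral>\<^sup>+ p. indicator S (fst p) \<partial>(\<mu> \<Otimes>\<^sub>M \<rho>))"
      by (simp flip: nn_integral_indicator add: nn_integral_distr)
    also have "\<dots> = (\<integral>\<^sup>+ x. \<integral>\<^sup>+ y. indicator S x \<partial>\<rho> \<partial>\<mu>)"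
      by (subst R.nn_integral_fst[symmetric]) auto
    also have "\<dots> = emeasure \<mu> S" by (simp add: R.emeasure_space_1 \<mu>(2))
    finally show "emeasure (distr (\<mu> \<Otimes>\<^sub>M \<rho>) borel fst) S = emeasure \<mu> S" .
  qed (simp add: \<mu>(2))
  have "(\<integral>\<^sup>+ p. ennreal ((norm (fst p - (fst p + snd p)))\<^sup>2) \<partial>(\<mu> \<Otimes>\<^sub>M \<rho>)) = (\<integral>\<^sup>+ x. \<integral>\<^sup>+ y. ennreal ((norm y)\<^sup>2) \<partial>\<rho> \<partial>\<mu>)"
    by (subst R.nn_integral_fst[symmetric]) auto
  also have "\<dots> \<le> ennreal (A\<^sup>2)" using c by (simp add: M.emeasure_space_1)
  finally have "W2 (distr (\<mu> \<Otimes>\<^sub>M \<rho>) borel fst) (distr (\<mu> \<Otimes>\<^sub>M \<rho>) borel (\<lambda>p. fst p + snd p)) \<le> ennreal A"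
    using \<open>0 \<le> A\<close> prob_space_axioms by (intro W2_distr_le) auto
  then show ?thesis unfolding f convolution_def by (simp add: split_beta')
qed

text \<open>Only the half of the mass in which the two measures differ has to be moved.\<close>

lemma W2_midpoint_le:
  fixes \<rho>0 \<rho>1 \<rho>h :: "'a::euclidean_space measure"
  assumes W: "W2 \<rho>0 \<rho>1 \<le> ennreal A" and "0 \<le> A" and [simp]: "sets \<rho>h = sets borel"
    and mid: "\<And>S. S \<in> sets borel \<Longrightarrow> 2 * emeasure \<rho>h S = emeasure \<rho>0 S + emeasure \<rho>1 S"
  shows "W2 \<rho>h \<rho>1 \<le> ennreal (A / sqrt 2)"
proof (rule W2_le_limit)
  fix B assume B: "A / sqrt 2 < B"
  then have "A < B * sqrt 2" by (simp add: field_simps)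
  then obtain \<gamma> where \<gamma>: "\<gamma> \<in> couplings \<rho>0 \<rho>1" and c: "transport_cost \<gamma> \<le> ennreal ((B * sqrt 2)\<^sup>2)"
    using coupling_of_W2_le[OF W] \<open>0 \<le> A\<close> by metis
  interpret G: prob_space \<gamma> using couplingsD(1)[OF \<gamma>] .
  let ?K = "measure_pmf (bernoulli_pmf (1/2)) \<Otimes>\<^sub>M \<gamma>"
  interpret P: pair_prob_space "measure_pmf (bernoulli_pmf (1/2))" \<gamma> ..
  note [measurable_cong] = couplingsD(2)[OF \<gamma>]
  have [measurable]: "fst \<in> borel_measurable \<gamma>" "snd \<in> borel_measurable \<gamma>"
    by measurable
  have int: "(\<integral>\<^sup>+ z. h z \<partial>?K) = (1/2) * (\<integral>\<^sup>+ p. h (True, p) \<partial>\<gamma>) + (1/2) * (\<integral>\<^sup>+ p. h (False, p) \<partial>\<gamma>)"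
    if [measurable]: "h \<in> borel_measurable ?K" for h
    by (subst G.nn_integral_fst[symmetric])
      (auto simp: nn_integral_bernoulli_pmf ennreal_minus mult.commute divide_ennreal_def)
  \<comment> \<open>A fair coin \<open>c\<close> takes the first point from the
    \<open>\<rho>0\<close>-end or from the \<open>\<rho>1\<close>-end of the pair, while the second
    point is always the \<open>\<rho>1\<close>-end. For \<open>c = False\<close> nothing moves,
    which halves the squared cost.\<close>
  define f where "f = (\<lambda>(c, p::'a \<times> 'a). if c then fst p else snd p)"
  define g where "g = (\<lambda>(c::bool, p::'a \<times> 'a). snd p)"
  have [measurable]: "f \<in> borel_measurable ?K" "g \<in> borel_measurable ?K"
    unfolding f_def g_def split_beta' by measurable
  have f: "distr ?K borel f = \<rho>h"
  proof (rule measure_eqI)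
    fix S assume "S \<in> sets (distr ?K borel f)"
    then have [measurable]: "S \<in> sets borel" by simp
    have "emeasure (distr ?K borel f) S = (\<integral>\<^sup>+ z. indicator S (f z) \<partial>?K)"
      by (simp flip: nn_integral_indicator add: nn_integral_distr)
    also have "\<dots> = (1/2) * (\<integral>\<^sup>+ p. indicator S (fst p) \<partial>\<gamma>) + (1/2) * (\<integral>\<^sup>+ p. indicator S (snd p) \<partial>\<gamma>)"
      by (subst int) (auto simp: f_def)
    also have "\<dots> = (1/2) * (emeasure \<rho>0 S + emeasure \<rho>1 S)"
      unfolding couplingsD(3)[OF \<gamma>] couplingsD(4)[OF \<gamma>] distrib_left
      by (simp flip: nn_integral_indicator add: nn_integral_distr)
    also have "\<dots> = ((1/2) * 2) * emeasure \<rho>h S"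
      by (simp add: mid[symmetric] mult.assoc)
    also have "\<dots> = emeasure \<rho>h S"
      by (simp add: ennreal_divide_times)
    finally show "emeasure (distr ?K borel f) S = emeasure \<rho>h S" .
  qed simp
  have g: "distr ?K borel g = \<rho>1"
  proof (rule measure_eqI)
    fix S assume "S \<in> sets (distr ?K borel g)"
    then have [measurable]: "S \<in> sets borel" by simp
    have "emeasure (distr ?K borel g) S = (\<integral>\<^sup>+ z. indicator S (g z) \<partial>?K)"
      by (simp flip: nn_integral_indicator add: nn_integral_distr)
    also have "\<dots> = (1/2) * (\<integral>\<^sup>+ p. indicator S (snd p) \<partial>\<gamma>) + (1/2) * (\<integral>\<^sup>+ p. indicator S (snd p) \<partial>\<gamma>)"
      by (subst int) (auto simp: g_def)
    also have "\<dots> = ((1/2) * 2) * emeasure \<rho>1 S"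
      unfolding couplingsD(4)[OF \<gamma>]
      by (simp flip: nn_integral_indicator mult_2 add: nn_integral_distr mult_ac)
    also have "\<dots> = emeasure \<rho>1 S"
      by (simp add: ennreal_divide_times)
    finally show "emeasure (distr ?K borel g) S = emeasure \<rho>1 S" .
  qed (simp add: couplingsD(4)[OF \<gamma>])
  have "(\<integral>\<^sup>+ z. ennreal ((norm (f z - g z))\<^sup>2) \<partial>?K) = (1/2) * transport_cost \<gamma>"
    by (subst int) (auto simp: f_def g_def transport_cost_def split_beta')
  also have "\<dots> \<le> (1/2) * ennreal ((B * sqrt 2)\<^sup>2)"
    using c by (intro mult_left_mono) auto
  also have "\<dots> = ennreal (1/2) * ennreal (2 * B\<^sup>2)"
    using divide_ennreal[of 1 2] by (simp add: power_mult_distrib mult.commute)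
  also have "\<dots> = ennreal (B\<^sup>2)" by (subst ennreal_mult[symmetric]) auto
  finally have "W2 (distr ?K borel f) (distr ?K borel g) \<le> ennreal B"
    using P.prob_space_axioms \<open>0 \<le> A\<close> B
    by (intro W2_distr_le) (auto intro!: order.strict_implies_order[OF le_less_trans[OF _ B]])
  then show "W2 \<rho>h \<rho>1 \<le> ennreal B" unfolding f g .
qed

text \<open>The distance bounds itself with the factor \<open>1 / sqrt 2 < 1\<close>; finiteness is
  what allows this term to be absorbed on the left.\<close>

lemma W2_bootstrap:
  fixes \<rho>0 \<rho>1 \<rho>h :: "'a::euclidean_space measure"
  assumes W: "W2 \<rho>0 \<rho>1 \<noteq> \<top>" and Wh: "W2 \<rho>0 \<rho>h \<le> ennreal B" and "0 \<le> B" and "sets \<rho>h = sets borel"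
    and mid: "\<And>S. S \<in> sets borel \<Longrightarrow> 2 * emeasure \<rho>h S = emeasure \<rho>0 S + emeasure \<rho>1 S"
  shows "W2 \<rho>0 \<rho>1 \<le> ennreal ((2 + sqrt 2) * B)"
proof -
  obtain w where w: "W2 \<rho>0 \<rho>1 = ennreal w" "0 \<le> w"
    using W by (cases "W2 \<rho>0 \<rho>1") auto
  have "W2 \<rho>h \<rho>1 \<le> ennreal (w / sqrt 2)"
    using w assms by (intro W2_midpoint_le[of \<rho>0]) auto
  then have "ennreal w \<le> ennreal (B + w / sqrt 2)"
    using W2_triangle_le[OF Wh, of \<rho>1 "w / sqrt 2"] w \<open>0 \<le> B\<close> by (simp del: ennreal_plus)
  then have "w \<le> B + w / sqrt 2" using w \<open>0 \<le> B\<close> by (simp add: ennreal_le_iff del: ennreal_plus)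
  \<comment> \<open>\<open>2 + sqrt 2\<close> is the reciprocal of
    \<open>1 - 1 / sqrt 2\<close>.\<close>
  then have "(2 + sqrt 2) * w \<le> (2 + sqrt 2) * (B + w / sqrt 2)"
    by (intro mult_left_mono) auto
  also have "\<dots> = (2 + sqrt 2) * B + (1 + sqrt 2) * w"
    by (simp add: field_simps)
  finally show ?thesis using w by (auto intro!: ennreal_leI simp: algebra_simps)
qed

section \<open>Monotone transport on the line\<close>

lemma ex_antiderivative_real:
  fixes k :: "real \<Rightarrow> real"
  assumes "continuous_on UNIV k"
  obtains K where "\<And>z. (K has_real_derivative k z) (at z)"
proof -
  have "\<exists>K. \<forall>x. -\<infinity> < ereal x \<longrightarrow> ereal x < \<infinity> \<longrightarrow> (K has_vector_derivative k x) (at x)"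
    using assms by (intro einterval_antiderivative) (auto simp: continuous_on_eq_continuous_at)
  then show ?thesis using that by (auto simp: has_real_derivative_iff_has_vector_derivative)
qed

text \<open>Along the linear interpolation of \<open>F\<close> and \<open>G\<close> the point \<open>z\<close> carries the level \<open>p\<close> at time
  \<open>t z = (F z - p) / (F z - G z)\<close>. The time needed to move from \<open>l\<close> to \<open>u\<close> is \<open>1\<close>, and the
  reciprocal velocity \<open>t'\<close> is at least \<open>c / (F - G)\<close>; then Cauchy--Schwarz in the AM--GM form.\<close>

lemma displacement_sq_le:
  fixes F G F' G' c :: "real \<Rightarrow> real"
  assumes "l \<le> u" and Fl: "F l = p" and Gu: "G u = p"
    and dF: "\<And>z. (F has_real_derivative F' z) (at z)" and dG: "\<And>z. (G has_real_derivative G' z) (at z)"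
    and F': "\<And>z. c z \<le> F' z" and G': "\<And>z. c z \<le> G' z" and c: "\<And>z. 0 < c z" "continuous_on UNIV c"
  shows "ennreal ((u - l)\<^sup>2) \<le> (\<integral>\<^sup>+ z. ennreal ((F z - G z) / c z) * indicator {l..u} z \<partial>lborel)"
proof (cases "l = u")
  case False
  then have "l < u" using \<open>l \<le> u\<close> by simp
  have F'pos: "0 < F' z" and G'pos: "0 < G' z" for z
    using F'[of z] G'[of z] c(1)[of z] by linarith+
  have Fm: "F x < F y" if "x < y" for x y
    using DERIV_pos_imp_increasing[OF that, of F] dF F'pos by blast
  have Gm: "G x < G y" if "x < y" for x y
    using DERIV_pos_imp_increasing[OF that, of G] dG G'pos by blast
  have Fp: "p \<le> F z" if "l \<le> z" for z
    using that Fm[of l z] Fl by (cases "l = z") auto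
  have Gp: "G z \<le> p" if "z \<le> u" for z
    using that Gm[of z u] Gu by (cases "z = u") auto
  have Dpos: "0 < F z - G z" if "l \<le> z" "z \<le> u" for z
  proof (cases "l = z")
    case True
    then show ?thesis using Gm[of z u] \<open>l < u\<close> Fl Gu by simp
  next
    case False
    then show ?thesis using Fm[of l z] that Fl Gp[of z] by simp
  qed
  have contF: "continuous_on UNIV F" and contG: "continuous_on UNIV G"
    by (auto intro!: continuous_at_imp_continuous_on DERIV_isCont[OF dF] DERIV_isCont[OF dG])
  define k where "k z = (F z - G z) / c z" for z
  have contk: "continuous_on UNIV k"
    unfolding k_def using c by (intro continuous_intros contF contG) (auto simp: less_imp_neq[symmetric])
  obtain K where dK: "\<And>z. (K has_real_derivative k z) (at z)"
    using ex_antiderivative_real[OF contk] by blast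
  define t where "t z = (F z - p) / (F z - G z)" for z
  define w where "w = u - l"
  have "0 < w" using \<open>l < u\<close> by (simp add: w_def)
  define t' where "t' z = (F' z * (p - G z) + (F z - p) * G' z) / (F z - G z)\<^sup>2" for z
  have dt: "(t has_real_derivative t' z) (at z)" if "l \<le> z" "z \<le> u" for z
    using dF dG Dpos[OF that] unfolding t'_def t_def
    by (auto intro!: derivative_eq_intros simp: power2_eq_square algebra_simps)
  have t'_ge: "1 / k z \<le> t' z" if "l \<le> z" "z \<le> u" for z
  proof -
    have D: "0 < F z - G z" using Dpos that by auto
    have "c z * (F z - G z) = c z * (p - G z) + (F z - p) * c z" by (simp add: algebra_simps)
    also have "\<dots> \<le> F' z * (p - G z) + (F z - p) * G' z"
      using that F' G' Fp Gp by (intro add_mono mult_right_mono mult_left_mono) auto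
    finally have "c z * (F z - G z) / (F z - G z)\<^sup>2 \<le> t' z"
      unfolding t'_def by (intro divide_right_mono) auto
    then show ?thesis using D by (simp add: k_def power2_eq_square)
  qed
  \<comment> \<open>An integrated AM--GM inequality that needs no integral of \<open>t'\<close>: the
    derivative of \<open>w * t z + K z / w - 2 * z\<close> is at least
    \<open>(w - k z)\<^sup>2 / (w * k z)\<close>. As \<open>t\<close> runs from \<open>0\<close> to
    \<open>1\<close>, comparing the endpoints gives
    \<open>2 * w \<le> w + (K u - K l) / w\<close>.\<close>
  have "w * t l + K l / w - 2 * l \<le> w * t u + K u / w - 2 * u"
  proof (rule DERIV_nonneg_imp_nondecreasing[OF \<open>l \<le> u\<close>])
    fix z assume z: "l \<le> z" "z \<le> u"
    have kpos: "0 < k z" using Dpos[OF z] c(1) by (simp add: k_def)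
    have "0 \<le> (w - k z)\<^sup>2 / (w * k z)" using kpos \<open>0 < w\<close> by simp
    also have "\<dots> = w * (1 / k z) + k z / w - 2"
      using kpos \<open>0 < w\<close> by (simp add: field_simps power2_eq_square)
    also have "\<dots> \<le> w * t' z + k z / w - 2"
      using t'_ge[OF z] \<open>0 < w\<close> by (intro diff_mono add_mono mult_left_mono) auto
    finally have "0 \<le> w * t' z + k z / w - 2" .
    moreover have "((\<lambda>z. w * t z + K z / w - 2 * z) has_real_derivative w * t' z + k z / w - 2) (at z)"
      using dt[OF z] dK \<open>0 < w\<close> by (auto intro!: derivative_eq_intros)
    ultimately show "\<exists>y. ((\<lambda>z. w * t z + K z / w - 2 * z) has_real_derivative y) (at z) \<and> 0 \<le> y"
      by blast
  qed
  moreover have "t l = 0" "t u = 1"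
    using Dpos[of u] \<open>l \<le> u\<close> by (auto simp: t_def Fl Gu)
  ultimately have "w * w \<le> w * ((K u - K l) / w)"
    using \<open>0 < w\<close> by (intro mult_left_mono) (auto simp: w_def diff_divide_distrib)
  then have "w\<^sup>2 \<le> K u - K l"
    using \<open>0 < w\<close> by (simp add: power2_eq_square)
  then have "ennreal (w\<^sup>2) \<le> ennreal (K u - K l)" by (rule ennreal_leI)
  also have "\<dots> = (\<integral>\<^sup>+ z. ennreal (k z) * indicator {l..u} z \<partial>lborel)"
    using contk Dpos c(1) dK \<open>l \<le> u\<close>
    by (intro nn_integral_FTC_Icc[symmetric]) (auto simp: k_def less_imp_le intro!: borel_measurable_continuous_onI)
  finally show ?thesis by (simp add: w_def k_def)
qed simp

section \<open>Distribution functions of positive continuous densities\<close>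

locale pos_density =
  fixes \<rho> :: "real \<Rightarrow> real"
  assumes cont: "continuous_on UNIV \<rho>" and pos: "\<And>z. 0 < \<rho> z"
    and total: "(\<integral>\<^sup>+ z. ennreal (\<rho> z) \<partial>lborel) = 1"
begin

abbreviation "law \<equiv> density lborel (\<lambda>z. ennreal (\<rho> z))"
abbreviation "F \<equiv> cdf law"

lemma meas[measurable]: "\<rho> \<in> borel_measurable borel"
  using cont by (rule borel_measurable_continuous_onI)

sublocale real_distribution law
proof -
  have "prob_space law" by (rule prob_spaceI) (simp add: emeasure_density total)
  then show "real_distribution law"
    by (simp add: real_distribution_def real_distribution_axioms_def)
qed

lemma F_deriv: "(F has_real_derivative \<rho> z) (at z)"
proof -
  obtain K where dK: "\<And>z. (K has_real_derivative \<rho> z) (at z)"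
    using ex_antiderivative_real[OF cont] by blast
  define a where "a = z - 1"
  have eq: "F w = F a + (K w - K a)" if "a < w" for w
  proof -
    have "K a \<le> K w"
      using DERIV_pos_imp_increasing[OF that, of K] dK pos by force
    have "emeasure law {a<..w} = (\<integral>\<^sup>+ x. ennreal (\<rho> x) * indicator {a<..w} x \<partial>lborel)"
      by (simp add: emeasure_density)
    also have "\<dots> = (\<integral>\<^sup>+ x. ennreal (\<rho> x) * indicator {a..w} x \<partial>lborel)"
      by (intro nn_integral_cong_AE eventually_mono[OF AE_lborel_singleton[of a]]) (auto split: split_indicator)
    also have "\<dots> = ennreal (K w - K a)"
      using that dK pos by (intro nn_integral_FTC_Icc) (auto simp: less_imp_le)
    finally show ?thesis
      using cdf_diff_eq[OF that] \<open>K a \<le> K w\<close> by (simp add: emeasure_eq_measure)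
  qed
  have "((\<lambda>w. F a + (K w - K a)) has_real_derivative \<rho> z) (at z)"
    using dK by (auto intro!: derivative_eq_intros)
  then show ?thesis
  proof (rule has_field_derivative_transform_within_open[where S="{a<..}"])
    show "z \<in> {a<..}" by (simp add: a_def)
  qed (auto simp: eq)
qed

lemma F_strict: "x < y \<Longrightarrow> F x < F y"
  using DERIV_pos_imp_increasing[of x y F] F_deriv pos by blast

lemma F_le_iff: "F x \<le> F y \<longleftrightarrow> x \<le> y"
  using F_strict by (metis cdf_nondecreasing linorder_not_less)

lemma F_bounds: "0 < F x" "F x < 1"
  using F_strict[of "x - 1" x] cdf_nonneg[of "x - 1"] F_strict[of x "x + 1"] cdf_bounded_prob[of "x + 1"]
  by auto

lemma F_cont: "continuous_on A F"
  by (auto intro!: continuous_at_imp_continuous_on DERIV_isCont[OF F_deriv])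

lemma ex_F_eq:
  assumes "0 < p" "p < 1"
  obtains z where "F z = p"
proof -
  have "eventually (\<lambda>x. F x < p) at_bot"
    using cdf_lim_at_bot \<open>0 < p\<close> by (rule order_tendstoD)
  then obtain a where a: "F a < p" by (auto simp: eventually_at_bot_linorder)
  have "eventually (\<lambda>x. p < F x) at_top"
    using cdf_lim_at_top_prob \<open>p < 1\<close> by (rule order_tendstoD)
  then obtain b where b: "p < F b" by (auto simp: eventually_at_top_linorder)
  have "a \<le> b" using a b F_le_iff[of b a] by linarith
  then show ?thesis using IVT'[of F a p b] a b F_cont that by force
qed

text \<open>The probability integral transform: \<open>F\<close> is uniformly distributed under
  \<open>law\<close>. Positivity of the density makes every sublevel set of \<open>F\<close> a
  half-line, so no generalised inverse appears.\<close>

lemma emeasure_F_less: "0 \<le> p \<Longrightarrow> p \<le> 1 \<Longrightarrow> emeasure law {x. F x \<le> p} = ennreal p"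
proof -
  assume p: "0 \<le> p" "p \<le> 1"
  consider "p = 0" | "p = 1" | "0 < p" "p < 1" using p by linarith
  then show ?thesis
  proof cases
    case 1
    then have "{x. F x \<le> p} = {}" using F_bounds(1) by (auto simp: not_le)
    then show ?thesis using 1 by simp
  next
    case 2
    then have "{x. F x \<le> p} = UNIV" using F_bounds(2) by (auto intro: less_imp_le)
    then show ?thesis using 2 emeasure_space_1 by simp
  next
    case 3
    then obtain z where z: "F z = p" using ex_F_eq by blast
    then have "{x. F x \<le> p} = {..z}" using F_le_iff by auto
    then show ?thesis using z by (simp add: emeasure_eq_measure cdf_def)
  qed
qed

lemma emeasure_F_between:
  assumes "p \<le> q" "0 < p" "q < 1"
  shows "emeasure law {x. p \<le> F x \<and> F x \<le> q} \<le> ennreal (q - p)"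
proof -
  obtain a where a: "F a = p" using ex_F_eq[of p] assms by auto
  obtain b where b: "F b = q" using ex_F_eq[of q] assms by auto
  have "a \<le> b" using F_le_iff assms a b by metis
  have null: "emeasure law {a} = 0"
  proof -
    have "emeasure law {a} = (\<integral>\<^sup>+ x. ennreal (\<rho> x) * indicator {a} x \<partial>lborel)"
      by (simp add: emeasure_density)
    also have "\<dots> = (\<integral>\<^sup>+ x. 0 \<partial>(lborel::real measure))"
      by (intro nn_integral_cong_AE eventually_mono[OF AE_lborel_singleton[of a]]) (auto split: split_indicator)
    finally show ?thesis by simp
  qed
  have "{x. p \<le> F x \<and> F x \<le> q} = {a} \<union> {a<..b}"
    using F_le_iff a b \<open>a \<le> b\<close> by auto
  then have "emeasure law {x. p \<le> F x \<and> F x \<le> q} \<le> emeasure law {a} + emeasure law {a<..b}"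
    using emeasure_subadditive[of "{a}" law "{a<..b}"] by simp
  also have "\<dots> = ennreal (q - p)"
    using cdf_diff_eq[of a b] \<open>a \<le> b\<close> null a b by (cases "a = b") (auto simp: emeasure_eq_measure)
  finally show ?thesis .
qed

end

text \<open>Since \<open>m \<le> 1\<close> and \<open>m \<le> g\<close>, the function
  \<open>m * \<phi>\<close> lies below both densities, and \<open>displacement_sq_le\<close> bounds
  \<open>(T x - x)\<^sup>2\<close> by the integral of
  \<open>\<bar>F1 - F0\<bar> / (m * \<phi>)\<close> over the points between \<open>x\<close> and
  \<open>T x\<close>. Fubini then asks for the mass of those \<open>x\<close> whose path passes a
  given \<open>z\<close>. It is at most \<open>\<bar>F1 z - F0 z\<bar>\<close>, and this supplies
  the second factor of the square.\<close>

lemma monotone_transport_cost: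
  assumes pd: "pos_density \<phi>" and pd1: "pos_density (\<lambda>z. g z * \<phi> z)"
    and g: "\<And>z. m \<le> g z" and m: "0 < m" "m \<le> 1"
    and T: "\<And>x. cdf (density lborel (\<lambda>z. ennreal (g z * \<phi> z))) (T x) = cdf (density lborel (\<lambda>z. ennreal (\<phi> z))) x"
    and [measurable]: "T \<in> borel_measurable borel"
  shows "(\<integral>\<^sup>+ x. ennreal ((T x - x)\<^sup>2) \<partial>density lborel (\<lambda>z. ennreal (\<phi> z)))
    \<le> (\<integral>\<^sup>+ z. ennreal ((cdf (density lborel (\<lambda>z. ennreal (g z * \<phi> z))) z
          - cdf (density lborel (\<lambda>z. ennreal (\<phi> z))) z)\<^sup>2 / (m * \<phi> z)) \<partial>lborel)"
proof -
  interpret P0: pos_density \<phi> by fact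
  interpret P1: pos_density "\<lambda>z. g z * \<phi> z" by fact
  interpret pair_sigma_finite P0.law lborel ..
  let ?c = "\<lambda>z. m * \<phi> z"
  let ?J = "\<lambda>z. P1.F z - P0.F z"
  define B where "B = {(x, z). x \<le> z \<and> z \<le> T x \<or> T x \<le> z \<and> z \<le> x}"
  have c: "0 < ?c z" "?c z \<le> \<phi> z" "?c z \<le> g z * \<phi> z" for z
    using m P0.pos[of z] g[of z] by (auto intro!: mult_right_mono mult_left_le_one_le)
  have contc: "continuous_on UNIV ?c" by (intro continuous_intros P0.cont)
  have [measurable]: "P0.F \<in> borel_measurable borel" "P1.F \<in> borel_measurable borel"
    by (auto intro!: borel_measurable_continuous_onI P0.F_cont P1.F_cont)
  have [measurable]: "B \<in> sets (borel \<Otimes>\<^sub>M borel)"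
  proof -
    have "B = {p \<in> space (borel \<Otimes>\<^sub>M borel). fst p \<le> snd p \<and> snd p \<le> T (fst p) \<or> T (fst p) \<le> snd p \<and> snd p \<le> fst p}"
      by (auto simp: B_def space_pair_measure)
    then show ?thesis by simp
  qed
  have disp: "ennreal ((T x - x)\<^sup>2) \<le> (\<integral>\<^sup>+ z. ennreal (\<bar>?J z\<bar> / ?c z) * indicator B (x, z) \<partial>lborel)" for x
  proof (cases "x \<le> T x")
    case True
    then have "ennreal ((T x - x)\<^sup>2) \<le> (\<integral>\<^sup>+ z. ennreal ((P0.F z - P1.F z) / ?c z) * indicator {x..T x} z \<partial>lborel)"
      using c contc P0.F_deriv P1.F_deriv T by (intro displacement_sq_le[where F'=\<phi> and G'="\<lambda>z. g z * \<phi> z"]) auto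
    also have "\<dots> \<le> (\<integral>\<^sup>+ z. ennreal (\<bar>?J z\<bar> / ?c z) * indicator B (x, z) \<partial>lborel)"
      using c(1) by (intro nn_integral_mono mult_mono ennreal_leI divide_right_mono)
        (auto simp: B_def less_imp_le split: split_indicator)
    finally show ?thesis .
  next
    case False
    then have "ennreal ((x - T x)\<^sup>2) \<le> (\<integral>\<^sup>+ z. ennreal ((P1.F z - P0.F z) / ?c z) * indicator {T x..x} z \<partial>lborel)"
      using c contc P0.F_deriv P1.F_deriv T by (intro displacement_sq_le[where F'="\<lambda>z. g z * \<phi> z" and G'=\<phi>]) auto
    also have "\<dots> \<le> (\<integral>\<^sup>+ z. ennreal (\<bar>?J z\<bar> / ?c z) * indicator B (x, z) \<partial>lborel)"
      using c(1) by (intro nn_integral_mono mult_mono ennreal_leI divide_right_mono)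
        (auto simp: B_def less_imp_le split: split_indicator)
    finally show ?thesis by (simp add: power2_commute)
  qed
  \<comment> \<open>Because \<open>F1 (T x) = F0 x\<close>, the point \<open>z\<close> lies between
    \<open>x\<close> and \<open>T x\<close> only if \<open>F0 x\<close> lies between
    \<open>F0 z\<close> and \<open>F1 z\<close>.\<close>
  have B: "emeasure P0.law {x. (x, z) \<in> B} \<le> ennreal \<bar>?J z\<bar>" for z
  proof -
    let ?p = "min (P0.F z) (P1.F z)" and ?q = "max (P0.F z) (P1.F z)"
    have sub: "{x. (x, z) \<in> B} \<subseteq> {x. ?p \<le> P0.F x \<and> P0.F x \<le> ?q}"
    proof
      fix x assume "x \<in> {x. (x, z) \<in> B}"
      then consider "x \<le> z" "z \<le> T x" | "T x \<le> z" "z \<le> x" by (auto simp: B_def)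
      then show "x \<in> {x. ?p \<le> P0.F x \<and> P0.F x \<le> ?q}"
        using P0.F_le_iff[of x z] P0.F_le_iff[of z x] P1.F_le_iff[of z "T x"] P1.F_le_iff[of "T x" z] T[of x]
        by cases auto
    qed
    have "emeasure P0.law {x. (x, z) \<in> B} \<le> emeasure P0.law {x. ?p \<le> P0.F x \<and> P0.F x \<le> ?q}"
      by (intro emeasure_mono sub) auto
    also have "\<dots> \<le> ennreal (?q - ?p)"
      using P0.F_bounds[of z] P1.F_bounds[of z] by (intro P0.emeasure_F_between) auto
    also have "?q - ?p = \<bar>?J z\<bar>" by auto
    finally show ?thesis .
  qed
  have "(\<integral>\<^sup>+ x. ennreal ((T x - x)\<^sup>2) \<partial>P0.law)
      \<le> (\<integral>\<^sup>+ x. \<integral>\<^sup>+ z. ennreal (\<bar>?J z\<bar> / ?c z) * indicator B (x, z) \<partial>lborel \<partial>P0.law)"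
    by (intro nn_integral_mono disp)
  also have "\<dots> = (\<integral>\<^sup>+ z. \<integral>\<^sup>+ x. ennreal (\<bar>?J z\<bar> / ?c z) * indicator B (x, z) \<partial>P0.law \<partial>lborel)"
    using Fubini'[of "\<lambda>x z. ennreal (\<bar>?J z\<bar> / ?c z) * indicator B (x, z)"] by simp
  also have "\<dots> = (\<integral>\<^sup>+ z. ennreal (\<bar>?J z\<bar> / ?c z) * emeasure P0.law {x. (x, z) \<in> B} \<partial>lborel)"
  proof (intro nn_integral_cong)
    fix z :: real
    have "(\<integral>\<^sup>+ x. ennreal (\<bar>?J z\<bar> / ?c z) * indicator B (x, z) \<partial>P0.law)
        = (\<integral>\<^sup>+ x. ennreal (\<bar>?J z\<bar> / ?c z) * indicator {x. (x, z) \<in> B} x \<partial>P0.law)"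
      by (intro nn_integral_cong) (auto split: split_indicator)
    also have "\<dots> = ennreal (\<bar>?J z\<bar> / ?c z) * emeasure P0.law {x. (x, z) \<in> B}"
      by (subst nn_integral_cmult_indicator) auto
    finally show "(\<integral>\<^sup>+ x. ennreal (\<bar>?J z\<bar> / ?c z) * indicator B (x, z) \<partial>P0.law)
        = ennreal (\<bar>?J z\<bar> / ?c z) * emeasure P0.law {x. (x, z) \<in> B}" .
  qed
  also have "\<dots> \<le> (\<integral>\<^sup>+ z. ennreal (\<bar>?J z\<bar> / ?c z) * ennreal \<bar>?J z\<bar> \<partial>lborel)"
    by (intro nn_integral_mono mult_left_mono B) auto
  also have "\<dots> = (\<integral>\<^sup>+ z. ennreal (?J z ^ 2 / ?c z) \<partial>lborel)"
    using c(1) by (intro nn_integral_cong) (simp add: power2_eq_square less_imp_le flip: ennreal_mult)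
  finally show ?thesis .
qed

text \<open>The parameter \<open>s\<close> will be the coordinates already placed by the Knothe map.
  The point is joint measurability in \<open>s\<close> and \<open>x\<close>:
  \<open>T s x \<le> c\<close> is equivalent to \<open>F0 x \<le> F1 s c\<close>, and
  \<open>F1 s c\<close> is an integral depending measurably on \<open>s\<close>.\<close>

lemma conditional_transport:
  fixes f :: "'c \<Rightarrow> real \<Rightarrow> real"
  assumes pd: "pos_density \<phi>"
    and fm[measurable]: "case_prod f \<in> borel_measurable (S \<Otimes>\<^sub>M borel)"
    and fc: "\<And>s. s \<in> space S \<Longrightarrow> continuous_on UNIV (f s)"
    and fge: "\<And>s z. s \<in> space S \<Longrightarrow> m s \<le> f s z" and m: "\<And>s. 0 < m s" "\<And>s. s \<in> space S \<Longrightarrow> m s \<le> 1"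
    and ftot: "\<And>s. s \<in> space S \<Longrightarrow> (\<integral>\<^sup>+ z. ennreal (f s z * \<phi> z) \<partial>lborel) = 1"
  obtains T :: "'c \<Rightarrow> real \<Rightarrow> real" where "case_prod T \<in> borel_measurable (S \<Otimes>\<^sub>M borel)"
    "\<And>s. s \<in> space S \<Longrightarrow> distr (density lborel (\<lambda>z. ennreal (\<phi> z))) borel (T s) = density lborel (\<lambda>z. ennreal (f s z * \<phi> z))"
    "\<And>s. s \<in> space S \<Longrightarrow> (\<integral>\<^sup>+ x. ennreal ((T s x - x)\<^sup>2) \<partial>density lborel (\<lambda>z. ennreal (\<phi> z)))
    \<le> (\<integral>\<^sup>+ z. ennreal ((cdf (density lborel (\<lambda>z. ennreal (f s z * \<phi> z))) z
          - cdf (density lborel (\<lambda>z. ennreal (\<phi> z))) z)\<^sup>2 / (m s * \<phi> z)) \<partial>lborel)"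
proof -
  interpret P0: pos_density \<phi> by fact
  have pd1: "pos_density (\<lambda>z. f s z * \<phi> z)" if "s \<in> space S" for s
    using fc[OF that] ftot[OF that] P0.pos P0.cont less_le_trans[OF m(1) fge[OF that]]
    by unfold_locales (auto intro!: continuous_intros)
  let ?F1 = "\<lambda>s. cdf (density lborel (\<lambda>z. ennreal (f s z * \<phi> z)))"
  have ex: "\<exists>z. ?F1 s z = P0.F x" if "s \<in> space S" for s x
  proof -
    interpret P1: pos_density "\<lambda>z. f s z * \<phi> z" using pd1[OF that] .
    show ?thesis using P1.ex_F_eq[of "P0.F x"] P0.F_bounds[of x] by blast
  qed
  define T where "T s x = (if s \<in> space S then SOME z. ?F1 s z = P0.F x else 0)" for s x
  have T: "?F1 s (T s x) = P0.F x" if "s \<in> space S" for s x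
    using that someI_ex[OF ex[OF that]] by (simp add: T_def)
  have T_le: "T s x \<le> c \<longleftrightarrow> P0.F x \<le> ?F1 s c" if "s \<in> space S" for s x c
  proof -
    interpret P1: pos_density "\<lambda>z. f s z * \<phi> z" using pd1[OF that] .
    show ?thesis using P1.F_le_iff[of "T s x" c] T[OF that] by simp
  qed
  have [measurable]: "P0.F \<in> borel_measurable borel"
    by (auto intro!: borel_measurable_continuous_onI P0.F_cont)
  have Tm: "case_prod T \<in> borel_measurable (S \<Otimes>\<^sub>M borel)"
  proof (rule borel_measurableI_le)
    fix c :: real
    have [measurable]: "(\<lambda>s. enn2real (\<integral>\<^sup>+ z. ennreal (f s z * \<phi> z) * indicator {..c} z \<partial>lborel)) \<in> borel_measurable S"
      by measurable
    have F1: "?F1 s c = enn2real (\<integral>\<^sup>+ z. ennreal (f s z * \<phi> z) * indicator {..c} z \<partial>lborel)" if "s \<in> space S" for s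
    proof -
      interpret P1: pos_density "\<lambda>z. f s z * \<phi> z" using pd1[OF that] .
      show ?thesis by (simp add: cdf_def measure_def emeasure_density)
    qed
    have "{x \<in> space (S \<Otimes>\<^sub>M borel). (case x of (s, x) \<Rightarrow> T s x) \<le> c}
        = {x \<in> space (S \<Otimes>\<^sub>M borel). P0.F (snd x) \<le> enn2real (\<integral>\<^sup>+ z. ennreal (f (fst x) z * \<phi> z) * indicator {..c} z \<partial>lborel)}"
      using T_le F1 by (auto simp: space_pair_measure)
    also have "\<dots> \<in> sets (S \<Otimes>\<^sub>M borel)" by measurable
    finally show "{x \<in> space (S \<Otimes>\<^sub>M borel). (case x of (s, x) \<Rightarrow> T s x) \<le> c} \<in> sets (S \<Otimes>\<^sub>M borel)" .
  qed
  have Ts: "T s \<in> borel_measurable borel" if "s \<in> space S" for s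
    using measurable_compose[OF measurable_Pair1'[OF that] Tm] by simp
  show ?thesis
  proof (rule that[OF Tm])
    fix s assume s: "s \<in> space S"
    interpret P1: pos_density "\<lambda>z. f s z * \<phi> z" using pd1[OF s] .
    note [measurable] = Ts[OF s]
    show "distr P0.law borel (T s) = P1.law"
    proof (rule cdf_unique)
      show "real_distribution (distr P0.law borel (T s))"
        by (rule P0.real_distribution_distr) simp
      show "cdf (distr P0.law borel (T s)) = P1.F"
      proof
        fix c
        have "emeasure (distr P0.law borel (T s)) {..c} = emeasure P0.law {x. P0.F x \<le> P1.F c}"
          by (subst emeasure_distr) (auto simp: vimage_def T_le[OF s])
        also have "\<dots> = ennreal (P1.F c)"
          using P1.F_bounds[of c] by (intro P0.emeasure_F_less) auto
        finally show "cdf (distr P0.law borel (T s)) c = P1.F c"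
          by (simp add: cdf_def measure_def)
      qed
    qed (rule P1.real_distribution_axioms)
    show "(\<integral>\<^sup>+ x. ennreal ((T s x - x)\<^sup>2) \<partial>P0.law)
      \<le> (\<integral>\<^sup>+ z. ennreal ((P1.F z - P0.F z)\<^sup>2 / (m s * \<phi> z)) \<partial>lborel)"
      using s T fge m by (intro monotone_transport_cost pd pd1) auto
  qed
qed

lemma pos_density_normal: "0 < v \<Longrightarrow> pos_density (normal_density 0 (sqrt v))"
proof
  assume "0 < v"
  show "continuous_on UNIV (normal_density 0 (sqrt v))"
    unfolding normal_density_def using \<open>0 < v\<close> by (intro continuous_intros) auto
  show "0 < normal_density 0 (sqrt v) z" for z
    using \<open>0 < v\<close> by (simp add: normal_density_pos)
  show "(\<integral>\<^sup>+ z. ennreal (normal_density 0 (sqrt v) z) \<partial>lborel) = 1"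
    using \<open>0 < v\<close> by (subst nn_integral_eq_integral) auto
qed

section \<open>A weighted Hardy inequality\<close>

locale normal_base =
  fixes v :: real
  assumes v: "0 < v"
begin

abbreviation "\<phi> \<equiv> normal_density 0 (sqrt v)"

sublocale pos_density \<phi>
  using v by (rule pos_density_normal)

lemma phi_eq: "\<phi> x = exp (- (x\<^sup>2 / (2 * v))) / sqrt (2 * pi * v)"
  using v by (simp add: normal_density_def)

lemma phi_deriv: "((\<lambda>x. - v * \<phi> x) has_real_derivative x * \<phi> x) (at x)"
proof -
  have "((\<lambda>x. - v * (exp (- (x\<^sup>2 / (2 * v))) / c)) has_real_derivative x * (exp (- (x\<^sup>2 / (2 * v))) / c)) (at x)"
    if "c \<noteq> 0" for c
    using v that by (auto intro!: derivative_eq_intros)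
  then show ?thesis unfolding phi_eq using v by simp
qed

lemma phi_at_top: "(\<phi> \<longlongrightarrow> 0) at_top"
proof -
  have "filterlim (\<lambda>x::real. (1 / (2 * v)) * x ^ 2) at_top at_top"
    using v by (intro filterlim_tendsto_pos_mult_at_top[OF tendsto_const] filterlim_pow_at_top filterlim_ident) auto
  then have "filterlim (\<lambda>x::real. - ((1 / (2 * v)) * x ^ 2)) at_bot at_top"
    by (simp add: filterlim_uminus_at_bot)
  then have "((\<lambda>x::real. exp (- ((1 / (2 * v)) * x ^ 2))) \<longlongrightarrow> 0) at_top"
    by (rule filterlim_compose[OF exp_at_bot])
  then have "((\<lambda>x::real. exp (- ((1 / (2 * v)) * x ^ 2)) / sqrt (2 * pi * v)) \<longlongrightarrow> 0 / sqrt (2 * pi * v)) at_top"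
    using v by (intro tendsto_divide tendsto_const) auto
  then show ?thesis unfolding phi_eq by simp
qed

lemma integrable_law_iff: "integrable law h \<longleftrightarrow> integrable lborel (\<lambda>x. \<phi> x * h x)"
  if "h \<in> borel_measurable borel" for h :: "real \<Rightarrow> real"
  using that pos by (subst integrable_real_density) (auto simp: less_imp_le)

lemma integrable_id: "integrable law (\<lambda>x. x)"
  using v integrable_normal_moment_nz_1[of "sqrt v" 0] by (subst integrable_law_iff) auto

lemma integral_id: "(\<integral>x. x \<partial>law) = 0"
  using v integral_normal_moment_nz_1[of "sqrt v" 0] pos
  by (subst integral_real_density) (auto simp: less_imp_le)

lemma singleton_null: "AE x in law. x \<noteq> a"
  by (subst AE_density) (auto intro: eventually_mono[OF AE_lborel_singleton[of a]])

lemma integrable_indicator_law[simp, intro]: "A \<in> sets borel \<Longrightarrow> integrable law (indicat_real A)"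
  by (intro integrable_const_bound[of _ 1]) (auto split: split_indicator)

lemma integrable_indicator_mult:
  fixes h :: "real \<Rightarrow> real"
  assumes "integrable law h" "A \<in> sets borel"
  shows "integrable law (\<lambda>x. h x * indicator A x)"
  using integrable_mult_indicator[of A law h] assms by (simp add: mult.commute)

text \<open>The point \<open>x\<close> belongs to both half-lines, which is harmless because the law
  has no atoms.\<close>

lemma split_integral:
  fixes h :: "real \<Rightarrow> real"
  assumes "integrable law h"
  shows "(\<integral>z. h z * indicator {x..} z \<partial>law) = (\<integral>z. h z \<partial>law) - (\<integral>z. h z * indicator {..x} z \<partial>law)"
proof -
  have "(\<integral>z. h z \<partial>law) = (\<integral>z. h z * indicator {..x} z + h z * indicator {x..} z \<partial>law)"
    using borel_measurable_integrable[OF assms]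
    by (intro integral_cong_AE eventually_mono[OF singleton_null[of x]])
      (auto split: split_indicator)
  also have "\<dots> = (\<integral>z. h z * indicator {..x} z \<partial>law) + (\<integral>z. h z * indicator {x..} z \<partial>law)"
    using assms by (intro Bochner_Integration.integral_add integrable_indicator_mult) auto
  finally show ?thesis by simp
qed

text \<open>An antiderivative of \<open>w * \<phi> w\<close> is \<open>- v * \<phi> w\<close>. This
  is the statement that the Stein kernel is constant, and the origin of the factor \<open>v\<close>
  in \<open>hk_total\<close>.\<close>

lemma upper_moment: "(\<integral>w. w * indicator {x..} w \<partial>law) = v * \<phi> x"
proof -
  have "(LBINT w=ereal x..\<infinity>. w * \<phi> w) = 0 - (- v * \<phi> x)"
  proof (rule interval_integral_FTC_integrable[where F="\<lambda>x. - v * \<phi> x"])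
    show "((\<lambda>x. - v * \<phi> x) has_vector_derivative w * \<phi> w) (at w)" for w
      using phi_deriv by (simp add: has_real_derivative_iff_has_vector_derivative)
    show "isCont (\<lambda>w. w * \<phi> w) w" for w
      using cont by (auto intro!: continuous_intros simp: continuous_on_eq_continuous_at)
    show "set_integrable lborel (einterval (ereal x) \<infinity>) (\<lambda>w. w * \<phi> w)"
      using integrable_id unfolding set_integrable_def
      by (intro integrable_mult_indicator) (auto simp: integrable_law_iff mult.commute)
    have "isCont (\<lambda>x. - v * \<phi> x) x" using phi_deriv DERIV_isCont by blast
    then have "((\<lambda>x. - v * \<phi> x) \<longlongrightarrow> - v * \<phi> x) (at_right x)"
      by (auto simp: isCont_def intro: tendsto_mono[OF at_le])
    then show "(((\<lambda>x. - v * \<phi> x) \<circ> real_of_ereal) \<longlongrightarrow> - v * \<phi> x) (at_right (ereal x))"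
      by (simp add: ereal_tendsto_simps)
    have "((\<lambda>x. - v * \<phi> x) \<longlongrightarrow> - v * 0) at_top"
      by (intro tendsto_intros phi_at_top)
    then show "(((\<lambda>x. - v * \<phi> x) \<circ> real_of_ereal) \<longlongrightarrow> 0) (at_left \<infinity>)"
      by (simp add: ereal_tendsto_simps)
  qed auto
  moreover have "(LBINT w=ereal x..\<infinity>. w * \<phi> w) = (\<integral>w. \<phi> w * (w * indicator {x..} w) \<partial>lborel)"
    by (subst interval_lebesgue_integral_le_eq, simp, unfold set_lebesgue_integral_def)
      (intro integral_cong_AE eventually_mono[OF AE_lborel_singleton[of x]],
        auto split: split_indicator simp: einterval_def)
  moreover have "(\<integral>w. w * indicator {x..} w \<partial>law) = (\<integral>w. \<phi> w * (w * indicator {x..} w) \<partial>lborel)"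
    using pos by (subst integral_real_density) (auto simp: less_imp_le)
  ultimately show ?thesis by simp
qed

text \<open>The kernel of Hoeffding's covariance formula. Its marginal is \<open>v * \<phi>\<close>, since the Stein
  kernel of the normal law is the constant \<open>v\<close>.\<close>

definition hk :: "real \<Rightarrow> real \<Rightarrow> ennreal" where
  "hk x y = (\<integral>\<^sup>+ z. \<integral>\<^sup>+ w. indicator {z. z \<le> x \<and> z \<le> y} z * indicator {w. x \<le> w \<and> y \<le> w} w \<partial>law \<partial>law)"

lemma hk_meas[measurable]: "case_prod hk \<in> borel_measurable (borel \<Otimes>\<^sub>M borel)"
proof -
  have eq: "hk x y = (\<integral>\<^sup>+ z. \<integral>\<^sup>+ w. (if z \<le> x \<and> z \<le> y \<and> x \<le> w \<and> y \<le> w then 1 else 0) \<partial>law \<partial>law)" for x y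
    unfolding hk_def by (intro nn_integral_cong) auto
  show ?thesis unfolding eq by measurable
qed

lemma hk_sym: "hk x y = hk y x"
  unfolding hk_def by (simp add: conj_commute)

text \<open>For independent \<open>Z\<close>, \<open>W\<close> with the given law,
  \<open>hk x y\<close> is the probability of \<open>Z \<le> min x y\<close> times that of
  \<open>W \<ge> max x y\<close>. Keeping it as a double integral lets Fubini act directly: once
  \<open>z \<le> x \<le> w\<close>, the condition left on \<open>y\<close> is
  \<open>z \<le> y \<le> w\<close>.\<close>

lemma hk_integral:
  assumes [measurable]: "h \<in> borel_measurable borel"
  shows "(\<integral>\<^sup>+ y. hk x y * h y \<partial>lborel)
    = (\<integral>\<^sup>+ z. \<integral>\<^sup>+ w. indicator {..x} z * indicator {x..} w * (\<integral>\<^sup>+ y. h y * indicator {z..w} y \<partial>lborel) \<partial>law \<partial>law)"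
proof -
  interpret P: pair_sigma_finite law lborel ..
  let ?g = "\<lambda>z w y. (if z \<le> x \<and> z \<le> y \<and> x \<le> w \<and> y \<le> w then h y else 0)"
  have "(\<integral>\<^sup>+ y. hk x y * h y \<partial>lborel) = (\<integral>\<^sup>+ y. \<integral>\<^sup>+ z. \<integral>\<^sup>+ w. ?g z w y \<partial>law \<partial>law \<partial>lborel)"
    unfolding hk_def
    by (intro nn_integral_cong, subst nn_integral_multc[symmetric], simp)
      (intro nn_integral_cong, subst nn_integral_multc[symmetric], auto intro!: nn_integral_cong)
  also have "\<dots> = (\<integral>\<^sup>+ z. \<integral>\<^sup>+ y. \<integral>\<^sup>+ w. ?g z w y \<partial>law \<partial>lborel \<partial>law)"
    by (rule P.Fubini') simp
  also have "\<dots> = (\<integral>\<^sup>+ z. \<integral>\<^sup>+ w. \<integral>\<^sup>+ y. ?g z w y \<partial>lborel \<partial>law \<partial>law)"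
    by (intro nn_integral_cong P.Fubini') simp
  also have "\<dots> = (\<integral>\<^sup>+ z. \<integral>\<^sup>+ w. indicator {..x} z * indicator {x..} w * (\<integral>\<^sup>+ y. h y * indicator {z..w} y \<partial>lborel) \<partial>law \<partial>law)"
    by (intro nn_integral_cong, subst nn_integral_cmult[symmetric])
      (auto intro!: nn_integral_cong split: split_indicator)
  finally show ?thesis .
qed

text \<open>The left side is the expectation of \<open>W - Z\<close> on the event
  \<open>Z \<le> x \<le> W\<close>. The part of \<open>W\<close> above \<open>x\<close> has first
  moment \<open>v * \<phi> x\<close>, the part of \<open>Z\<close> below \<open>x\<close> its
  negative as the mean is zero, and the two complementary probabilities \<open>P\<close> and
  \<open>Q\<close> add up to \<open>1\<close>.\<close>

lemma hk_total: "(\<integral>\<^sup>+ y. hk x y \<partial>lborel) = ennreal (v * \<phi> x)"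
proof -
  define P where "P = (\<integral>z. indicator {..x} z \<partial>law :: real)"
  define Q where "Q = (\<integral>z. indicator {x..} z \<partial>law :: real)"
  have PQ: "P + Q = 1" using split_integral[of "\<lambda>_. 1" x] prob_space by (simp add: P_def Q_def)
  have up: "(\<integral>w. (w - z) * indicator {x..} w \<partial>law) = v * \<phi> x - z * Q" for z
  proof -
    have "(\<integral>w. (w - z) * indicator {x..} w \<partial>law) = (\<integral>w. w * indicator {x..} w - z * indicator {x..} w \<partial>law)"
      by (simp add: left_diff_distrib)
    also have "\<dots> = v * \<phi> x - z * Q"
      using integrable_id by (subst Bochner_Integration.integral_diff)
        (auto intro!: integrable_indicator_mult simp: upper_moment Q_def)
    finally show ?thesis .
  qed
  have inner: "(\<integral>\<^sup>+ w. ennreal (w - z) * indicator {x..} w \<partial>law) = ennreal (v * \<phi> x - z * Q)"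
    and nonneg: "0 \<le> v * \<phi> x - z * Q" if "z \<le> x" for z
  proof -
    show "(\<integral>\<^sup>+ w. ennreal (w - z) * indicator {x..} w \<partial>law) = ennreal (v * \<phi> x - z * Q)"
      unfolding up[symmetric] using integrable_id that
      by (subst nn_integral_eq_integral[symmetric])
        (auto intro!: integrable_indicator_mult nn_integral_cong split: split_indicator)
    show "0 \<le> v * \<phi> x - z * Q"
      unfolding up[symmetric] using that by (intro integral_nonneg_AE) (auto split: split_indicator)
  qed
  have "(\<integral>\<^sup>+ y. hk x y \<partial>lborel) = (\<integral>\<^sup>+ y. hk x y * 1 \<partial>lborel)" by simp
  also have "\<dots> = (\<integral>\<^sup>+ z. \<integral>\<^sup>+ w. indicator {..x} z * indicator {x..} w * ennreal (w - z) \<partial>law \<partial>law)"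
    by (subst hk_integral, simp, intro nn_integral_cong) (auto split: split_indicator)
  also have "\<dots> = (\<integral>\<^sup>+ z. indicator {..x} z * (\<integral>\<^sup>+ w. ennreal (w - z) * indicator {x..} w \<partial>law) \<partial>law)"
    by (intro nn_integral_cong, subst nn_integral_cmult[symmetric]) (auto intro!: nn_integral_cong simp: mult_ac)
  also have "\<dots> = (\<integral>\<^sup>+ z. ennreal ((v * \<phi> x - z * Q) * indicator {..x} z) \<partial>law)"
    by (intro nn_integral_cong) (auto simp: inner split: split_indicator)
  also have "\<dots> = ennreal (\<integral>z. (v * \<phi> x - z * Q) * indicator {..x} z \<partial>law)"
    using integrable_id nonneg by (intro nn_integral_eq_integral integrable_indicator_mult)
      (auto split: split_indicator)
  also have "(\<integral>z. (v * \<phi> x - z * Q) * indicator {..x} z \<partial>law)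
      = (\<integral>z. v * \<phi> x * indicator {..x} z - Q * (z * indicator {..x} z) \<partial>law)"
    by (simp add: algebra_simps)
  also have "\<dots> = v * \<phi> x * P - Q * (\<integral>z. z * indicator {..x} z \<partial>law)"
    using integrable_id by (subst Bochner_Integration.integral_diff)
        (auto intro!: integrable_mult_right integrable_indicator_mult simp: P_def)
  also have "(\<integral>z. z * indicator {..x} z \<partial>law) = - v * \<phi> x"
    using split_integral[OF integrable_id, of x] upper_moment integral_id by simp
  also have "v * \<phi> x * P - Q * (- v * \<phi> x) = v * \<phi> x"
    using arg_cong[OF PQ, of "\<lambda>t. t * (v * \<phi> x)"] by (simp add: algebra_simps)
  finally show ?thesis .
qed

lemma weighted_hardy:
  fixes h h' :: "real \<Rightarrow> real"
  assumes h: "integrable law h" and [measurable]: "h' \<in> borel_measurable borel"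
    and lip: "\<And>z w. z \<le> w \<Longrightarrow> ennreal \<bar>h w - h z\<bar> \<le> (\<integral>\<^sup>+ y. ennreal \<bar>h' y\<bar> * indicator {z..w} y \<partial>lborel)"
  shows "(\<integral>\<^sup>+ x. ennreal (((\<integral>z. h z * indicator {..x} z \<partial>law) - (\<integral>z. h z \<partial>law) * F x)\<^sup>2 / \<phi> x) \<partial>lborel)
    \<le> ennreal (v\<^sup>2) * (\<integral>\<^sup>+ y. ennreal ((h' y)\<^sup>2) \<partial>law)"
proof -
  have [measurable]: "h \<in> borel_measurable borel"
    using borel_measurable_integrable[OF h] by simp
  define J where "J x = (\<integral>z. h z * indicator {..x} z \<partial>law) - (\<integral>z. h z \<partial>law) * F x" for x
  have J1: "ennreal \<bar>J x\<bar> \<le> (\<integral>\<^sup>+ y. hk x y * ennreal \<bar>h' y\<bar> \<partial>lborel)" for x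
  proof -
    define P where "P = (\<integral>z. indicator {..x} z \<partial>law :: real)"
    define Q where "Q = (\<integral>z. indicator {x..} z \<partial>law :: real)"
    have PQ: "P + Q = 1" using split_integral[of "\<lambda>_. 1" x] prob_space by (simp add: P_def Q_def)
    have PF: "P = F x" by (simp add: P_def cdf_def)
    define A where "A = (\<integral>z. h z * indicator {..x} z \<partial>law)"
    define \<mu> where "\<mu> = (\<integral>z. h z \<partial>law)"
    have in1: "(\<integral>w. indicator {..x} z * (indicator {x..} w * (h z - h w)) \<partial>law)
       = h z * indicator {..x} z * Q - indicator {..x} z * (\<mu> - A)" for z
    proof -
      have "(\<integral>w. indicator {..x} z * (indicator {x..} w * (h z - h w)) \<partial>law)
        = (\<integral>w. (indicator {..x} z * h z) * indicator {x..} w - indicator {..x} z * (h w * indicator {x..} w) \<partial>law)"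
        by (simp add: algebra_simps)
      also have "\<dots> = (indicator {..x} z * h z) * Q - indicator {..x} z * (\<mu> - A)"
        using h by (subst Bochner_Integration.integral_diff)
          (auto intro!: integrable_mult_right integrable_indicator_mult simp: Q_def split_integral A_def \<mu>_def)
      finally show ?thesis by (simp add: mult_ac)
    qed
    have "(\<integral>z. \<integral>w. indicator {..x} z * (indicator {x..} w * (h z - h w)) \<partial>law \<partial>law) = A * Q - P * (\<mu> - A)"
      unfolding in1 using h
      by (subst Bochner_Integration.integral_diff)
        (auto intro!: integrable_mult_left integrable_indicator_mult simp: P_def A_def)
    also have "\<dots> = A * (P + Q) - P * \<mu>" by (simp add: algebra_simps)
    also have "\<dots> = J x" unfolding PQ J_def A_def[symmetric] \<mu>_def[symmetric] PF[symmetric] by (simp add: mult.commute)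
    finally have Jx: "J x = (\<integral>z. \<integral>w. indicator {..x} z * (indicator {x..} w * (h z - h w)) \<partial>law \<partial>law)" ..
    have "ennreal \<bar>J x\<bar> \<le> (\<integral>\<^sup>+ z. ennreal \<bar>\<integral>w. indicator {..x} z * (indicator {x..} w * (h z - h w)) \<partial>law\<bar> \<partial>law)"
      unfolding Jx real_norm_def[symmetric]
    proof (rule integral_norm_bound_ennreal)
      show "integrable law (\<lambda>z. \<integral>w. indicator {..x} z * (indicator {x..} w * (h z - h w)) \<partial>law)"
        unfolding in1 using h by (auto intro!: integrable_mult_left integrable_indicator_mult)
    qed
    also have "\<dots> \<le> (\<integral>\<^sup>+ z. \<integral>\<^sup>+ w. ennreal \<bar>indicator {..x} z * (indicator {x..} w * (h z - h w))\<bar> \<partial>law \<partial>law)"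
    proof (intro nn_integral_mono)
      fix z
      have "integrable law (\<lambda>w. indicator {..x} z * (indicator {x..} w * (h z - h w)) :: real)"
        using integrable_indicator_mult[of "\<lambda>w. h z - h w" "{x..}"] h by (auto simp: mult.commute)
      then show "ennreal \<bar>\<integral>w. indicator {..x} z * (indicator {x..} w * (h z - h w)) \<partial>law\<bar>
        \<le> (\<integral>\<^sup>+ w. ennreal \<bar>indicator {..x} z * (indicator {x..} w * (h z - h w))\<bar> \<partial>law)"
        unfolding real_norm_def[symmetric] by (rule integral_norm_bound_ennreal)
    qed
    also have "\<dots> \<le> (\<integral>\<^sup>+ z. \<integral>\<^sup>+ w. indicator {..x} z * indicator {x..} w * (\<integral>\<^sup>+ y. ennreal \<bar>h' y\<bar> * indicator {z..w} y \<partial>lborel) \<partial>law \<partial>law)"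
      using lip by (intro nn_integral_mono) (auto split: split_indicator simp: abs_minus_commute)
    also have "\<dots> = (\<integral>\<^sup>+ y. hk x y * ennreal \<bar>h' y\<bar> \<partial>lborel)"
      by (subst hk_integral) auto
    finally show ?thesis .
  qed
  have J2: "ennreal ((J x)\<^sup>2 / \<phi> x) \<le> ennreal v * (\<integral>\<^sup>+ y. hk x y * ennreal ((h' y)\<^sup>2) \<partial>lborel)" for x
  proof -
    have "(ennreal \<bar>J x\<bar>)\<^sup>2 \<le> (\<integral>\<^sup>+ y. hk x y * ennreal \<bar>h' y\<bar> \<partial>lborel)\<^sup>2"
      by (intro power_mono J1) auto
    also have "\<dots> = (\<integral>\<^sup>+ y. 1 * ennreal \<bar>h' y\<bar> \<partial>density lborel (hk x))\<^sup>2"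
      by (subst nn_integral_density) auto
    also have "\<dots> \<le> (\<integral>\<^sup>+ y. 1\<^sup>2 \<partial>density lborel (hk x)) * (\<integral>\<^sup>+ y. (ennreal \<bar>h' y\<bar>)\<^sup>2 \<partial>density lborel (hk x))"
      by (rule Cauchy_Schwarz_nn_integral) auto
    also have "\<dots> = ennreal (v * \<phi> x) * (\<integral>\<^sup>+ y. hk x y * (ennreal \<bar>h' y\<bar>)\<^sup>2 \<partial>lborel)"
      by (simp add: nn_integral_density emeasure_density hk_total)
    finally have "ennreal ((J x)\<^sup>2) \<le> ennreal (v * \<phi> x) * (\<integral>\<^sup>+ y. hk x y * ennreal ((h' y)\<^sup>2) \<partial>lborel)"
      by (simp add: ennreal_power)
    then have "ennreal ((J x)\<^sup>2) * ennreal (1 / \<phi> x) \<le> ennreal (v * \<phi> x) * (\<integral>\<^sup>+ y. hk x y * ennreal ((h' y)\<^sup>2) \<partial>lborel) * ennreal (1 / \<phi> x)"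
      by (rule mult_right_mono) auto
    also have "\<dots> = (ennreal (v * \<phi> x) * ennreal (1 / \<phi> x)) * (\<integral>\<^sup>+ y. hk x y * ennreal ((h' y)\<^sup>2) \<partial>lborel)"
      by (simp add: mult_ac)
    also have "ennreal (v * \<phi> x) * ennreal (1 / \<phi> x) = ennreal v"
      using v pos[of x] by (subst ennreal_mult[symmetric]) auto
    also have "ennreal ((J x)\<^sup>2) * ennreal (1 / \<phi> x) = ennreal ((J x)\<^sup>2 / \<phi> x)"
      using pos[of x] by (subst ennreal_mult[symmetric]) auto
    finally show ?thesis .
  qed
  have "(\<integral>\<^sup>+ x. ennreal ((J x)\<^sup>2 / \<phi> x) \<partial>lborel) \<le> (\<integral>\<^sup>+ x. ennreal v * (\<integral>\<^sup>+ y. hk x y * ennreal ((h' y)\<^sup>2) \<partial>lborel) \<partial>lborel)"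
    by (intro nn_integral_mono J2)
  also have "\<dots> = ennreal v * (\<integral>\<^sup>+ x. \<integral>\<^sup>+ y. hk x y * ennreal ((h' y)\<^sup>2) \<partial>lborel \<partial>lborel)"
    by (rule nn_integral_cmult) measurable
  also have "\<dots> = ennreal v * (\<integral>\<^sup>+ y. \<integral>\<^sup>+ x. hk y x * ennreal ((h' y)\<^sup>2) \<partial>lborel \<partial>lborel)"
    by (subst lborel_pair.Fubini') (auto simp: hk_sym)
  also have "\<dots> = ennreal v * (\<integral>\<^sup>+ y. ennreal (v * \<phi> y) * ennreal ((h' y)\<^sup>2) \<partial>lborel)"
    by (simp add: nn_integral_multc hk_total)
  also have "\<dots> = ennreal v * (\<integral>\<^sup>+ y. ennreal v * (ennreal (\<phi> y) * ennreal ((h' y)\<^sup>2)) \<partial>lborel)"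
    using v pos by (simp add: ennreal_mult' less_imp_le mult.assoc)
  also have "\<dots> = ennreal v * (ennreal v * (\<integral>\<^sup>+ y. ennreal ((h' y)\<^sup>2) \<partial>law))"
    by (simp add: nn_integral_cmult nn_integral_density)
  also have "\<dots> = ennreal (v\<^sup>2) * (\<integral>\<^sup>+ y. ennreal ((h' y)\<^sup>2) \<partial>law)"
    using v by (simp add: power2_eq_square ennreal_mult' mult.assoc)
  finally show ?thesis by (simp add: J_def)
qed

end

section \<open>The Knothe map\<close>

locale normal_product =
  fixes v :: "'i::finite \<Rightarrow> real"
  assumes v_pos: "\<And>i. 0 < v i"
begin

abbreviation "nd i \<equiv> normal_density 0 (sqrt (v i))"
abbreviation "\<gamma> i \<equiv> density lborel (\<lambda>z. ennreal (nd i z))"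
abbreviation "\<Pi>n \<equiv> PiM (UNIV::'i set) \<gamma>"

lemma nb: "normal_base (v i)"
  by unfold_locales (rule v_pos)

lemma prob_\<gamma>: "prob_space (\<gamma> i)"
  using prob_space_normal_density[of "sqrt (v i)" 0] v_pos[of i] by simp

sublocale product_prob_space \<gamma> UNIV
  unfolding product_prob_space_def product_prob_space_axioms_def product_sigma_finite_def
  using prob_\<gamma> by (auto intro: prob_space_imp_sigma_finite)

sublocale finite_product_sigma_finite \<gamma> UNIV
  by unfold_locales auto

lemma space_\<Pi>n[simp]: "space \<Pi>n = UNIV"
  by (auto simp: space_PiM)

lemma upd_meas[measurable (raw)]:
  assumes [measurable]: "f \<in> measurable M \<Pi>n" "g \<in> borel_measurable M"
  shows "(\<lambda>w. (f w)(i := g w)) \<in> measurable M \<Pi>n"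
proof (rule measurable_PiM_single')
  fix j :: 'i
  have "(\<lambda>w. f w j) \<in> measurable M (\<gamma> j)" by measurable
  then show "(\<lambda>w. ((f w)(i := g w)) j) \<in> measurable M (\<gamma> j)"
    by (cases "i = j") auto
qed auto

text \<open>Redrawing one coordinate preserves the product measure. In this form one coordinate can
  be integrated out while every function keeps the full index set as its domain.\<close>

lemma resample:
  assumes [measurable]: "F \<in> borel_measurable \<Pi>n"
  shows "(\<integral>\<^sup>+ x. F x \<partial>\<Pi>n) = (\<integral>\<^sup>+ x. \<integral>\<^sup>+ z. F (x(i := z)) \<partial>\<gamma> i \<partial>\<Pi>n)"
proof -
  have U: "UNIV = insert i (UNIV - {i})" by auto
  have *: "(\<integral>\<^sup>+ x. H x \<partial>\<Pi>n) = (\<integral>\<^sup>+ x. \<integral>\<^sup>+ z. H (x(i := z)) \<partial>\<gamma> i \<partial>PiM (UNIV - {i}) \<gamma>)"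
    if "H \<in> borel_measurable \<Pi>n" for H
    using product_nn_integral_insert[of "UNIV - {i}" i H] that unfolding U[symmetric] by simp
  have "(\<integral>\<^sup>+ x. \<integral>\<^sup>+ z. F (x(i := z)) \<partial>\<gamma> i \<partial>\<Pi>n)
      = (\<integral>\<^sup>+ x. \<integral>\<^sup>+ y. \<integral>\<^sup>+ z. F (x(i := y, i := z)) \<partial>\<gamma> i \<partial>\<gamma> i \<partial>PiM (UNIV - {i}) \<gamma>)"
    by (rule *) measurable
  also have "\<dots> = (\<integral>\<^sup>+ x. \<integral>\<^sup>+ z. F (x(i := z)) \<partial>\<gamma> i \<partial>PiM (UNIV - {i}) \<gamma>)"
    using prob_space.emeasure_space_1[OF prob_\<gamma>[of i]] by simp
  also have "\<dots> = (\<integral>\<^sup>+ x. F x \<partial>\<Pi>n)"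
    by (rule *[symmetric]) simp
  finally show ?thesis ..
qed

text \<open>Here \<open>f I\<close> is the density of the marginal on \<open>I\<close> and \<open>g i I\<close> its partial derivative in the
  coordinate \<open>i\<close>. Each coordinate is moved only once, so the squared displacements add up.\<close>

lemma knothe_transport:
  fixes f :: "'i set \<Rightarrow> ('i \<Rightarrow> real) \<Rightarrow> real" and g :: "'i \<Rightarrow> 'i set \<Rightarrow> ('i \<Rightarrow> real) \<Rightarrow> real"
  assumes fm[measurable]: "\<And>I. f I \<in> borel_measurable \<Pi>n" and gm[measurable]: "\<And>i I. g i I \<in> borel_measurable \<Pi>n"
    and m: "0 < m" and fge: "\<And>I x. m \<le> f I x" and f_empty: "\<And>x. f {} x = 1"
    and f_indep: "\<And>i I x z. i \<notin> I \<Longrightarrow> f I (x(i := z)) = f I x"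
    and f_cont: "\<And>i I x. i \<notin> I \<Longrightarrow> continuous_on UNIV (\<lambda>z. f (insert i I) (x(i := z)))"
    and f_int: "\<And>i I x. i \<notin> I \<Longrightarrow> integrable (\<gamma> i) (\<lambda>z. f (insert i I) (x(i := z)))"
    and f_marg: "\<And>i I x. i \<notin> I \<Longrightarrow> (\<integral>z. f (insert i I) (x(i := z)) \<partial>\<gamma> i) = f I x"
    and f_deriv: "\<And>i I x z w. i \<notin> I \<Longrightarrow> z \<le> w \<Longrightarrow> ennreal \<bar>f (insert i I) (x(i := w)) - f (insert i I) (x(i := z))\<bar>
        \<le> (\<integral>\<^sup>+ y. ennreal \<bar>g i I (x(i := y))\<bar> * indicator {z..w} y \<partial>lborel)"
    and c: "\<And>i I. i \<notin> I \<Longrightarrow> (\<integral>\<^sup>+ x. ennreal ((g i I x)\<^sup>2) \<partial>\<Pi>n) \<le> ennreal (c i)"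
  obtains T where "T \<in> measurable \<Pi>n \<Pi>n" "distr \<Pi>n \<Pi>n T = density \<Pi>n (\<lambda>x. ennreal (f UNIV x))"
    "\<And>i. (\<integral>\<^sup>+ x. ennreal ((T x i - x i)\<^sup>2) \<partial>\<Pi>n) \<le> ennreal ((v i)\<^sup>2 / m) * ennreal (c i)"
proof -
  have fpos: "0 < f I x" for I x using m fge[of I x] by linarith
  \<comment> \<open>Induction over the set \<open>I\<close> of coordinates already moved. The map
    produces the right marginal on \<open>I\<close> and fixes all other coordinates, which therefore
    remain independent normal variables.\<close>
  have "\<exists>T. T \<in> measurable \<Pi>n \<Pi>n \<and> (\<forall>x i. i \<notin> I \<longrightarrow> T x i = x i)
     \<and> distr \<Pi>n \<Pi>n T = density \<Pi>n (\<lambda>x. ennreal (f I x))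
     \<and> (\<forall>i\<in>I. (\<integral>\<^sup>+ x. ennreal ((T x i - x i)\<^sup>2) \<partial>\<Pi>n) \<le> ennreal ((v i)\<^sup>2 / m) * ennreal (c i))" for I
    using finite[of I]
  proof (induction I rule: finite_induct)
    case empty
    have "distr \<Pi>n \<Pi>n (\<lambda>x. x) = density \<Pi>n (\<lambda>x. ennreal (f {} x))"
      by (simp add: f_empty density_1 distr_id2)
    then show ?case by (intro exI[of _ "\<lambda>x. x"]) auto
  next
    case (insert i I)
    then obtain T where T[measurable]: "T \<in> measurable \<Pi>n \<Pi>n" and Tfix: "\<And>x i. i \<notin> I \<Longrightarrow> T x i = x i"
      and Td: "distr \<Pi>n \<Pi>n T = density \<Pi>n (\<lambda>x. ennreal (f I x))"
      and Tc: "\<And>i. i \<in> I \<Longrightarrow> (\<integral>\<^sup>+ x. ennreal ((T x i - x i)\<^sup>2) \<partial>\<Pi>n) \<le> ennreal ((v i)\<^sup>2 / m) * ennreal (c i)"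
      by blast
    interpret nb: normal_base "v i" by (rule nb)
    \<comment> \<open>The conditional density of coordinate \<open>i\<close> given the coordinates
      in \<open>I\<close>, relative to \<open>\<gamma> i\<close>; its lower bound is
      \<open>m / f I x\<close>.\<close>
    define h where "h x z = f (insert i I) (x(i := z)) / f I x" for x z
    have hm[measurable]: "case_prod h \<in> borel_measurable (\<Pi>n \<Otimes>\<^sub>M borel)"
      unfolding h_def split_beta' by measurable
    have hm2[measurable]: "h x \<in> borel_measurable borel" for x
      using measurable_compose[OF measurable_Pair1'[of x \<Pi>n borel] hm] by simp
    have h_upd: "h (x(i := y)) z = h x z" for x y z
      using insert(2) by (simp add: h_def f_indep)
    have h_int: "integrable (\<gamma> i) (h x)" and h_tot: "(\<integral>z. h x z \<partial>\<gamma> i) = 1" for x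
      using f_int[OF insert(2), of x] f_marg[OF insert(2), of x] fpos[of I x]
      by (auto simp: h_def[abs_def])
    have h_pos: "0 < h x z" for x z using fpos by (simp add: h_def)
    have h_nn: "(\<integral>\<^sup>+ z. ennreal (h x z) \<partial>\<gamma> i) = 1" for x
      using h_int h_tot h_pos by (subst nn_integral_eq_integral) (auto simp: less_imp_le)
    have h_law: "density (\<gamma> i) (\<lambda>z. ennreal (h x z)) = density lborel (\<lambda>z. ennreal (h x z * nd i z))" for x
      using h_pos nb.pos by (subst density_density_eq) (auto simp: ennreal_mult mult.commute less_imp_le)
    obtain \<tau>0 where \<tau>0m: "case_prod \<tau>0 \<in> borel_measurable (\<Pi>n \<Otimes>\<^sub>M borel)"
      and \<tau>0d: "\<And>x. distr (\<gamma> i) borel (\<tau>0 x) = density lborel (\<lambda>z. ennreal (h x z * nd i z))"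
      and \<tau>0c: "\<And>x. (\<integral>\<^sup>+ z. ennreal ((\<tau>0 x z - z)\<^sup>2) \<partial>\<gamma> i)
        \<le> (\<integral>\<^sup>+ z. ennreal ((cdf (density lborel (\<lambda>z. ennreal (h x z * nd i z))) z
              - cdf (\<gamma> i) z)\<^sup>2 / ((m / f I x) * nd i z)) \<partial>lborel)"
    proof (rule conditional_transport[of "nd i" h \<Pi>n "\<lambda>x. m / f I x"])
      show "pos_density (nd i)" by (rule nb.pos_density_axioms)
      show "continuous_on UNIV (h x)" for x
        unfolding h_def using f_cont[OF insert(2)] fpos[of I x] by (intro continuous_intros) auto
      show "m / f I x \<le> h x z" for x z
        unfolding h_def using fge fpos[of I x] by (intro divide_right_mono) (auto simp: less_imp_le)
      show "(\<integral>\<^sup>+ z. ennreal (h x z * nd i z) \<partial>lborel) = 1" for x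
        using h_nn[of x] h_pos nb.pos by (subst (asm) nn_integral_density) (auto simp: ennreal_mult mult.commute less_imp_le)
    qed (use m fpos fge in auto)
    \<comment> \<open>\<open>\<tau>0\<close> comes from an existence statement and might depend on
      the old value of coordinate \<open>i\<close>, although its target law does not. Resetting that
      coordinate to \<open>0\<close> removes the dependence, as \<open>resample\<close>
      requires.\<close>
    define \<tau> where "\<tau> x z = \<tau>0 (x(i := 0)) z" for x z
    have \<tau>m[measurable]: "case_prod \<tau> \<in> borel_measurable (\<Pi>n \<Otimes>\<^sub>M borel)"
      unfolding \<tau>_def split_beta'
      by (rule measurable_compose[OF _ \<tau>0m, of "\<lambda>p. ((fst p)(i := 0), snd p)", simplified]) measurable
    have \<tau>m2[measurable]: "\<tau> x \<in> borel_measurable borel" for x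
      using measurable_compose[OF measurable_Pair1'[of x \<Pi>n borel] \<tau>m] by simp
    have \<tau>_upd: "\<tau> (x(i := y)) z = \<tau> x z" for x y z by (simp add: \<tau>_def)
    have h0: "h (x(i := 0)) = h x" for x using h_upd by auto
    have \<tau>d: "distr (\<gamma> i) borel (\<tau> x) = density (\<gamma> i) (\<lambda>z. ennreal (h x z))" for x
      using \<tau>0d[of "x(i := 0)"] unfolding h_law h0 by (simp add: \<tau>_def[abs_def])
    \<comment> \<open>The weight \<open>f I x\<close> is the density with which the previous map
      reaches \<open>x\<close>. The lower bound \<open>m / f I x\<close> contributes
      \<open>f I x / m\<close> and the derivative of \<open>h\<close> contributes
      \<open>1 / (f I x)\<^sup>2\<close>, so all powers of \<open>f I x\<close> cancel.\<close>
    have \<tau>c: "ennreal (f I x) * (\<integral>\<^sup>+ z. ennreal ((\<tau> x z - z)\<^sup>2) \<partial>\<gamma> i)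
        \<le> ennreal ((v i)\<^sup>2 / m) * (\<integral>\<^sup>+ z. ennreal ((g i I (x(i := z)))\<^sup>2) \<partial>\<gamma> i)" for x
    proof -
      have cdf1: "cdf (density lborel (\<lambda>z. ennreal (h x z * nd i z))) z
          = (\<integral>w. h x w * indicator {..z} w \<partial>\<gamma> i)" for z
      proof -
        have "emeasure (density (\<gamma> i) (\<lambda>z. ennreal (h x z))) {..z} = (\<integral>\<^sup>+ w. ennreal (h x w * indicator {..z} w) \<partial>\<gamma> i)"
          by (subst emeasure_density) (auto intro!: nn_integral_cong split: split_indicator)
        also have "\<dots> = ennreal (\<integral>w. h x w * indicator {..z} w \<partial>\<gamma> i)"
          using h_pos by (intro nn_integral_eq_integral nb.integrable_indicator_mult h_int) (auto simp: less_imp_le)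
        finally have "emeasure (density (\<gamma> i) (\<lambda>z. ennreal (h x z))) {..z} = ennreal (\<integral>w. h x w * indicator {..z} w \<partial>\<gamma> i)" .
        moreover have "0 \<le> (\<integral>w. h x w * indicator {..z} w \<partial>\<gamma> i)"
          using h_pos by (intro integral_nonneg_AE) (auto simp: less_imp_le)
        ultimately show ?thesis unfolding h_law by (simp add: cdf_def measure_def)
      qed
      have sc: "ennreal \<bar>a / f I x\<bar> = ennreal (1 / f I x) * ennreal \<bar>a\<bar>" for a
        using fpos[of I x] by (subst ennreal_mult[symmetric]) (auto simp: less_imp_le)
      let ?J = "\<lambda>z. ((\<integral>w. h x w * indicator {..z} w \<partial>\<gamma> i) - (\<integral>w. h x w \<partial>\<gamma> i) * nb.F z)\<^sup>2 / nd i z"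
      have "(\<integral>\<^sup>+ z. ennreal ((\<tau> x z - z)\<^sup>2) \<partial>\<gamma> i) \<le> (\<integral>\<^sup>+ z. ennreal (f I x / m) * ennreal (?J z) \<partial>lborel)"
        using \<tau>0c[of "x(i := 0)"] m fpos[of I x] nb.pos insert(2)
        unfolding h0 cdf1 h_tot \<tau>_def[symmetric]
        by (simp add: f_indep less_imp_le mult_ac flip: ennreal_mult)
      also have "\<dots> = ennreal (f I x / m) * (\<integral>\<^sup>+ z. ennreal (?J z) \<partial>lborel)"
      proof (rule nn_integral_cmult)
        have [measurable]: "nb.F \<in> borel_measurable borel"
          by (auto intro!: borel_measurable_continuous_onI nb.F_cont)
        have eq: "h x w * indicator {..z} w = (if w \<le> z then h x w else 0)" for w z :: real
          by auto
        have [measurable]: "(\<lambda>z. \<integral>w. h x w * indicator {..z} w \<partial>\<gamma> i) \<in> borel_measurable lborel"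
          unfolding eq
          by (rule sigma_finite_measure.borel_measurable_lebesgue_integral[OF prob_space_imp_sigma_finite[OF prob_\<gamma>]]) measurable
        show "(\<lambda>z. ennreal (?J z)) \<in> borel_measurable lborel"
          by measurable
      qed
      also have "\<dots> \<le> ennreal (f I x / m) * (ennreal ((v i)\<^sup>2) * (\<integral>\<^sup>+ z. ennreal ((g i I (x(i := z)) / f I x)\<^sup>2) \<partial>\<gamma> i))"
      proof (intro mult_left_mono nb.weighted_hardy h_int)
        show "(\<lambda>z. g i I (x(i := z)) / f I x) \<in> borel_measurable borel" by measurable
        fix z w :: real assume "z \<le> w"
        have "ennreal \<bar>h x w - h x z\<bar> = ennreal (1 / f I x) * ennreal \<bar>f (insert i I) (x(i := w)) - f (insert i I) (x(i := z))\<bar>"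
          unfolding h_def diff_divide_distrib[symmetric] sc ..
        also have "\<dots> \<le> ennreal (1 / f I x) * (\<integral>\<^sup>+ y. ennreal \<bar>g i I (x(i := y))\<bar> * indicator {z..w} y \<partial>lborel)"
          by (intro mult_left_mono f_deriv insert(2) \<open>z \<le> w\<close>) auto
        also have "\<dots> = (\<integral>\<^sup>+ y. ennreal (1 / f I x) * (ennreal \<bar>g i I (x(i := y))\<bar> * indicator {z..w} y) \<partial>lborel)"
          by (rule nn_integral_cmult[symmetric]) measurable
        also have "\<dots> = (\<integral>\<^sup>+ y. ennreal \<bar>g i I (x(i := y)) / f I x\<bar> * indicator {z..w} y \<partial>lborel)"
          unfolding sc mult.assoc ..
        finally show "ennreal \<bar>h x w - h x z\<bar> \<le> (\<integral>\<^sup>+ y. ennreal \<bar>g i I (x(i := y)) / f I x\<bar> * indicator {z..w} y \<partial>lborel)" .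
      qed auto
      also have "\<dots> = ennreal (f I x / m) * (ennreal ((v i)\<^sup>2) * (ennreal (1 / (f I x)\<^sup>2) * (\<integral>\<^sup>+ z. ennreal ((g i I (x(i := z)))\<^sup>2) \<partial>\<gamma> i)))"
        by (subst nn_integral_cmult[symmetric]) (auto simp: power_divide simp flip: ennreal_mult)
      finally have "ennreal (f I x) * (\<integral>\<^sup>+ z. ennreal ((\<tau> x z - z)\<^sup>2) \<partial>\<gamma> i)
         \<le> ennreal (f I x) * (ennreal (f I x / m) * (ennreal ((v i)\<^sup>2) * (ennreal (1 / (f I x)\<^sup>2) * (\<integral>\<^sup>+ z. ennreal ((g i I (x(i := z)))\<^sup>2) \<partial>\<gamma> i))))"
        by (rule mult_left_mono) simp
      also have "\<dots> = ennreal (f I x * (f I x / m * ((v i)\<^sup>2 * (1 / (f I x)\<^sup>2)))) * (\<integral>\<^sup>+ z. ennreal ((g i I (x(i := z)))\<^sup>2) \<partial>\<gamma> i)"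
        using fpos[of I x] m by (simp add: mult.assoc[symmetric] del: times_divide_eq_right times_divide_eq_left flip: ennreal_mult)
      also have "f I x * (f I x / m * ((v i)\<^sup>2 * (1 / (f I x)\<^sup>2))) = (v i)\<^sup>2 / m"
        using fpos[of I x] by (simp add: power2_eq_square)
      finally show ?thesis .
    qed
    define T' where "T' x = (T x)(i := \<tau> (T x) (x i))" for x
    have T'm[measurable]: "T' \<in> measurable \<Pi>n \<Pi>n" unfolding T'_def by measurable
    have T'_eq: "T' x = (T x)(i := \<tau> (T x) (T x i))" for x
      using Tfix[OF insert(2)] by (simp add: T'_def)
    have push: "(\<integral>\<^sup>+ x. F (T x) \<partial>\<Pi>n) = (\<integral>\<^sup>+ x. ennreal (f I x) * F x \<partial>\<Pi>n)" if [measurable]: "F \<in> borel_measurable \<Pi>n" for F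
    proof -
      have "(\<integral>\<^sup>+ x. F (T x) \<partial>\<Pi>n) = (\<integral>\<^sup>+ x. F x \<partial>distr \<Pi>n \<Pi>n T)"
        by (simp add: nn_integral_distr)
      then show ?thesis unfolding Td by (simp add: nn_integral_density)
    qed
    have "distr \<Pi>n \<Pi>n T' = density \<Pi>n (\<lambda>x. ennreal (f (insert i I) x))"
    proof (rule measure_eqI)
      fix E assume "E \<in> sets (distr \<Pi>n \<Pi>n T')"
      then have E[measurable]: "E \<in> sets \<Pi>n" by simp
      have "emeasure (distr \<Pi>n \<Pi>n T') E = (\<integral>\<^sup>+ x. indicator E ((T x)(i := \<tau> (T x) (T x i))) \<partial>\<Pi>n)"
        unfolding T'_eq[symmetric] by (simp flip: nn_integral_indicator add: nn_integral_distr)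
      also have "\<dots> = (\<integral>\<^sup>+ x. ennreal (f I x) * indicator E (x(i := \<tau> x (x i))) \<partial>\<Pi>n)"
        by (rule push) measurable
      also have "\<dots> = (\<integral>\<^sup>+ x. \<integral>\<^sup>+ z. ennreal (f I x) * indicator E (x(i := \<tau> x z)) \<partial>\<gamma> i \<partial>\<Pi>n)"
        by (subst resample[where i=i]) (auto simp: \<tau>_upd f_indep insert(2))
      also have "\<dots> = (\<integral>\<^sup>+ x. \<integral>\<^sup>+ z. ennreal (f (insert i I) (x(i := z))) * indicator E (x(i := z)) \<partial>\<gamma> i \<partial>\<Pi>n)"
      proof (rule nn_integral_cong)
        fix x
        have "(\<integral>\<^sup>+ z. indicator E (x(i := \<tau> x z)) \<partial>\<gamma> i) = (\<integral>\<^sup>+ z. indicator E (x(i := z)) \<partial>distr (\<gamma> i) borel (\<tau> x))"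
          by (subst nn_integral_distr) auto
        also have "\<dots> = (\<integral>\<^sup>+ z. ennreal (h x z) * indicator E (x(i := z)) \<partial>\<gamma> i)"
          unfolding \<tau>d by (subst nn_integral_density) auto
        finally have 1: "(\<integral>\<^sup>+ z. indicator E (x(i := \<tau> x z)) \<partial>\<gamma> i) = (\<integral>\<^sup>+ z. ennreal (h x z) * indicator E (x(i := z)) \<partial>\<gamma> i)" .
        have "(\<integral>\<^sup>+ z. ennreal (f I x) * indicator E (x(i := \<tau> x z)) \<partial>\<gamma> i)
            = ennreal (f I x) * (\<integral>\<^sup>+ z. indicator E (x(i := \<tau> x z)) \<partial>\<gamma> i)"
          by (rule nn_integral_cmult) measurable
        also have "\<dots> = (\<integral>\<^sup>+ z. ennreal (f I x) * (ennreal (h x z) * indicator E (x(i := z))) \<partial>\<gamma> i)"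
          unfolding 1 by (rule nn_integral_cmult[symmetric]) measurable
        also have "\<dots> = (\<integral>\<^sup>+ z. ennreal (f (insert i I) (x(i := z))) * indicator E (x(i := z)) \<partial>\<gamma> i)"
          using fpos[of I x, THEN less_imp_neq] fpos by (intro nn_integral_cong)
            (auto simp: h_def less_imp_le simp flip: mult.assoc ennreal_mult)
        finally show "(\<integral>\<^sup>+ z. ennreal (f I x) * indicator E (x(i := \<tau> x z)) \<partial>\<gamma> i)
          = (\<integral>\<^sup>+ z. ennreal (f (insert i I) (x(i := z))) * indicator E (x(i := z)) \<partial>\<gamma> i)" .
      qed
      also have "\<dots> = (\<integral>\<^sup>+ x. ennreal (f (insert i I) x) * indicator E x \<partial>\<Pi>n)"
        by (rule resample[symmetric]) measurable
      also have "\<dots> = emeasure (density \<Pi>n (\<lambda>x. ennreal (f (insert i I) x))) E"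
        by (simp add: emeasure_density)
      finally show "emeasure (distr \<Pi>n \<Pi>n T') E = emeasure (density \<Pi>n (\<lambda>x. ennreal (f (insert i I) x))) E" .
    qed simp
    moreover have "(\<integral>\<^sup>+ x. ennreal ((T' x i - x i)\<^sup>2) \<partial>\<Pi>n) \<le> ennreal ((v i)\<^sup>2 / m) * ennreal (c i)"
    proof -
      have "(\<integral>\<^sup>+ x. ennreal ((T' x i - x i)\<^sup>2) \<partial>\<Pi>n) = (\<integral>\<^sup>+ x. ennreal ((\<tau> (T x) (T x i) - T x i)\<^sup>2) \<partial>\<Pi>n)"
        using Tfix[OF insert(2)] by (simp add: T'_def)
      also have "\<dots> = (\<integral>\<^sup>+ x. ennreal (f I x) * ennreal ((\<tau> x (x i) - x i)\<^sup>2) \<partial>\<Pi>n)"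
        by (rule push) measurable
      also have "\<dots> = (\<integral>\<^sup>+ x. \<integral>\<^sup>+ z. ennreal (f I x) * ennreal ((\<tau> x z - z)\<^sup>2) \<partial>\<gamma> i \<partial>\<Pi>n)"
        by (subst resample[where i=i]) (auto simp: \<tau>_upd f_indep insert(2))
      also have "\<dots> = (\<integral>\<^sup>+ x. ennreal (f I x) * (\<integral>\<^sup>+ z. ennreal ((\<tau> x z - z)\<^sup>2) \<partial>\<gamma> i) \<partial>\<Pi>n)"
        by (intro nn_integral_cong nn_integral_cmult) measurable
      also have "\<dots> \<le> (\<integral>\<^sup>+ x. ennreal ((v i)\<^sup>2 / m) * (\<integral>\<^sup>+ z. ennreal ((g i I (x(i := z)))\<^sup>2) \<partial>\<gamma> i) \<partial>\<Pi>n)"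
        by (intro nn_integral_mono \<tau>c)
      also have "\<dots> = ennreal ((v i)\<^sup>2 / m) * (\<integral>\<^sup>+ x. \<integral>\<^sup>+ z. ennreal ((g i I (x(i := z)))\<^sup>2) \<partial>\<gamma> i \<partial>\<Pi>n)"
        by (rule nn_integral_cmult) measurable
      also have "\<dots> = ennreal ((v i)\<^sup>2 / m) * (\<integral>\<^sup>+ x. ennreal ((g i I x)\<^sup>2) \<partial>\<Pi>n)"
        by (subst resample[where i=i, symmetric]) auto
      also have "\<dots> \<le> ennreal ((v i)\<^sup>2 / m) * ennreal (c i)"
        by (intro mult_left_mono c insert(2)) auto
      finally show ?thesis .
    qed
    moreover have "(\<integral>\<^sup>+ x. ennreal ((T' x j - x j)\<^sup>2) \<partial>\<Pi>n) \<le> ennreal ((v j)\<^sup>2 / m) * ennreal (c j)" if "j \<in> I" for j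
      using Tc[OF that] that insert(2) by (cases "j = i") (auto simp: T'_def)
    moreover have "T' x j = x j" if "j \<notin> insert i I" for x j
      using that Tfix by (simp add: T'_def)
    ultimately show ?case
      using T'm by (intro exI[of _ T']) blast
  qed
  from this[of UNIV] show ?thesis using that by auto
qed

end

section \<open>The energy of the half mixture\<close>

lemma normal_density_sqrt:
  "0 < a \<Longrightarrow> normal_density \<eta> (sqrt a) x = 1 / sqrt (2 * pi * a) * exp (- ((x - \<eta>)\<^sup>2 / (2 * a)))"
  by (simp add: normal_density_def)

lemma normal_density_ratio:
  assumes "0 < a" "0 < v"
  shows "normal_density \<eta> (sqrt a) x / normal_density 0 (sqrt v) x
      = sqrt (v / a) * exp (x\<^sup>2 / (2 * v) - (x - \<eta>)\<^sup>2 / (2 * a))"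
proof -
  have "exp (x\<^sup>2 / (2 * v) - (x - \<eta>)\<^sup>2 / (2 * a)) = exp (- (x - \<eta>)\<^sup>2 / (2 * a)) / exp (- (x - 0)\<^sup>2 / (2 * v))"
    by (simp add: exp_diff[symmetric])
  moreover have "1 / sqrt (2 * pi * a) * E1 / (1 / sqrt (2 * pi * v) * E2) = sqrt (v / a) * (E1 / E2)"
    if "E2 \<noteq> 0" for E1 E2
    using assms that by (simp add: real_sqrt_mult real_sqrt_divide field_simps)
  ultimately show ?thesis using assms by (simp add: normal_density_def)
qed

lemma normal_density_shift_deriv:
  assumes "0 < a" "0 < v"
  shows "((\<lambda>x. normal_density \<eta> (sqrt a) x / normal_density 0 (sqrt v) x) has_real_derivative
    normal_density \<eta> (sqrt a) x / normal_density 0 (sqrt v) x * (x / v - (x - \<eta>) / a)) (at x)"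
proof -
  show ?thesis unfolding normal_density_ratio[OF assms] using assms
    by (auto intro!: derivative_eq_intros simp: field_simps)
qed

text \<open>Completing the square in \<open>x\<close>, with \<open>a = v - s\<close> and
  \<open>w = v + s\<close>. For \<open>s > 0\<close> the factor in front is the Mehler kernel of
  correlation \<open>s / v\<close> in the variables \<open>\<eta> / sqrt s\<close>; the remaining
  factor is a normal density in \<open>x\<close>.\<close>

lemma normal_density_mehler:
  fixes v s \<eta> \<eta>' x :: real
  assumes "0 \<le> s" "s < v"
  shows "normal_density \<eta> (sqrt (v - s)) x * normal_density \<eta>' (sqrt (v - s)) x / normal_density 0 (sqrt v) x
    = v / sqrt (v\<^sup>2 - s\<^sup>2) * exp ((v * \<eta> * \<eta>' - s * (\<eta>\<^sup>2 + \<eta>'\<^sup>2) / 2) / (v\<^sup>2 - s\<^sup>2))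
      * normal_density (v * (\<eta> + \<eta>') / (v + s)) (sqrt ((v - s) * v / (v + s))) x"
proof -
  define a where "a = v - s"
  define w where "w = v + s"
  have pos: "0 < a" "0 < v" "0 < w" using assms by (auto simp: a_def w_def)
  have aw: "v\<^sup>2 - s\<^sup>2 = a * w" by (simp add: a_def w_def power2_eq_square algebra_simps)
  have s: "s = w - v" and a: "a = 2 * v - w" by (auto simp: a_def w_def)
  have ex: "- (x - \<eta>)\<^sup>2 / (2 * a) - (x - \<eta>')\<^sup>2 / (2 * a) + x\<^sup>2 / (2 * v)
     = (v * \<eta> * \<eta>' - s * (\<eta>\<^sup>2 + \<eta>'\<^sup>2) / 2) / (a * w) - (x - v * (\<eta> + \<eta>') / w)\<^sup>2 / (2 * (a * v / w))"
  proof -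
    \<comment> \<open>Multiplying by \<open>2 * a * w * v\<close> clears the denominators, and
      \<open>s = w - v\<close>, \<open>a = 2 * v - w\<close> then turn the claim into a polynomial
      identity.\<close>
    have "2 * a * w * v * (- (x - \<eta>)\<^sup>2 / (2 * a) - (x - \<eta>')\<^sup>2 / (2 * a) + x\<^sup>2 / (2 * v))
       = - w * v * (x - \<eta>)\<^sup>2 - w * v * (x - \<eta>')\<^sup>2 + a * w * x\<^sup>2"
      using pos by (simp add: field_simps)
    also have "\<dots> = v * (2 * v * \<eta> * \<eta>' - s * (\<eta>\<^sup>2 + \<eta>'\<^sup>2)) - (w * x - v * (\<eta> + \<eta>'))\<^sup>2"
      unfolding s a by (simp add: power2_eq_square algebra_simps)
    also have "\<dots> = 2 * a * w * v * ((v * \<eta> * \<eta>' - s * (\<eta>\<^sup>2 + \<eta>'\<^sup>2) / 2) / (a * w) - (x - v * (\<eta> + \<eta>') / w)\<^sup>2 / (2 * (a * v / w)))"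
    proof -
      have *: "2 * a * w * v * (P / (a * w) - Z / (2 * a * v * w)) = 2 * v * P - Z" for P Z
        using pos by (simp add: field_simps)
      have "x - v * (\<eta> + \<eta>') / w = (w * x - v * (\<eta> + \<eta>')) / w" using pos by (simp add: field_simps)
      then have "(x - v * (\<eta> + \<eta>') / w)\<^sup>2 / (2 * (a * v / w)) = (w * x - v * (\<eta> + \<eta>'))\<^sup>2 / (2 * a * v * w)"
        using pos by (simp add: power_divide power2_eq_square)
      then have "2 * a * w * v * ((v * \<eta> * \<eta>' - s * (\<eta>\<^sup>2 + \<eta>'\<^sup>2) / 2) / (a * w) - (x - v * (\<eta> + \<eta>') / w)\<^sup>2 / (2 * (a * v / w)))
          = 2 * v * (v * \<eta> * \<eta>' - s * (\<eta>\<^sup>2 + \<eta>'\<^sup>2) / 2) - (w * x - v * (\<eta> + \<eta>'))\<^sup>2"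
        using pos * by simp
      moreover have "v * (2 * v * \<eta> * \<eta>' - s * (\<eta>\<^sup>2 + \<eta>'\<^sup>2)) = 2 * v * (v * \<eta> * \<eta>' - s * (\<eta>\<^sup>2 + \<eta>'\<^sup>2) / 2)"
        by (simp add: algebra_simps)
      ultimately show ?thesis by (simp only:)
    qed
    finally show ?thesis using pos by simp
  qed
  have sq: "sqrt (2 * pi * v) / (sqrt (2 * pi * a) * sqrt (2 * pi * a)) = v / sqrt (a * w) / sqrt (2 * pi * (a * v / w))"
    using pos by (simp add: real_sqrt_mult real_sqrt_divide field_simps)
  have "normal_density \<eta> (sqrt a) x * normal_density \<eta>' (sqrt a) x / normal_density 0 (sqrt v) x
    = sqrt (2 * pi * v) / (sqrt (2 * pi * a) * sqrt (2 * pi * a))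
      * exp (- (x - \<eta>)\<^sup>2 / (2 * a) - (x - \<eta>')\<^sup>2 / (2 * a) + x\<^sup>2 / (2 * v))"
  proof -
    have ee: "exp (- (x - \<eta>)\<^sup>2 / (2 * a) - (x - \<eta>')\<^sup>2 / (2 * a) + x\<^sup>2 / (2 * v))
        = exp (- ((x - \<eta>)\<^sup>2 / (2 * a))) * exp (- ((x - \<eta>')\<^sup>2 / (2 * a))) / exp (- ((x - 0)\<^sup>2 / (2 * v)))"
      unfolding exp_diff[symmetric] exp_add[symmetric] by simp
    have gen: "1 / p * E1 * (1 / p * E2) / (1 / q * E3) = q / (p * p) * (E1 * E2 / E3)" for p q E1 E2 E3 :: real
      by simp
    show ?thesis unfolding normal_density_sqrt[OF pos(1)] normal_density_sqrt[OF pos(2)] ee by (rule gen)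
  qed
  also have "\<dots> = v / sqrt (a * w) / sqrt (2 * pi * (a * v / w))
     * exp ((v * \<eta> * \<eta>' - s * (\<eta>\<^sup>2 + \<eta>'\<^sup>2) / 2) / (a * w) - (x - v * (\<eta> + \<eta>') / w)\<^sup>2 / (2 * (a * v / w)))"
    unfolding sq ex ..
  also have "\<dots> = v / sqrt (a * w) * exp ((v * \<eta> * \<eta>' - s * (\<eta>\<^sup>2 + \<eta>'\<^sup>2) / 2) / (a * w))
      * normal_density (v * (\<eta> + \<eta>') / w) (sqrt (a * v / w)) x"
  proof -
    have gen: "c / S * (E1 * E2) = c * E1 * (1 / S * E2)" for c S E1 E2 :: real
      by simp
    have "0 < a * v / w" using pos by simp
    show ?thesis unfolding normal_density_sqrt[OF \<open>0 < a * v / w\<close>] diff_conv_add_uminus exp_add by (rule gen)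
  qed
  finally show ?thesis unfolding aw by (simp add: a_def w_def)
qed

text \<open>Jensen's inequality for the square. If \<open>h\<close> is not integrable, its Bochner
  integral is \<open>0\<close> and the left side vanishes, so no integrability has to be checked by
  the user of the lemma.\<close>

lemma sq_nn_integral_le:
  assumes "prob_space M" and "h \<in> borel_measurable M"
  shows "ennreal ((\<integral>x. h x \<partial>M)\<^sup>2) \<le> (\<integral>\<^sup>+ x. ennreal ((h x)\<^sup>2) \<partial>M)"
proof (cases "integrable M h")
  case True
  interpret prob_space M by fact
  note [measurable] = assms(2)
  have "ennreal ((\<integral>x. h x \<partial>M)\<^sup>2) = (ennreal \<bar>\<integral>x. h x \<partial>M\<bar>)\<^sup>2"
    by (simp add: ennreal_power)
  also have "\<dots> \<le> (\<integral>\<^sup>+ x. 1 * ennreal \<bar>h x\<bar> \<partial>M)\<^sup>2"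
    using integral_norm_bound_ennreal[OF True] by (intro power_mono) auto
  also have "\<dots> \<le> (\<integral>\<^sup>+ x. 1\<^sup>2 \<partial>M) * (\<integral>\<^sup>+ x. (ennreal \<bar>h x\<bar>)\<^sup>2 \<partial>M)"
    by (rule Cauchy_Schwarz_nn_integral) auto
  also have "\<dots> = (\<integral>\<^sup>+ x. ennreal ((h x)\<^sup>2) \<partial>M)"
    by (simp add: emeasure_space_1 ennreal_power)
  finally show ?thesis .
qed (simp add: not_integrable_integral_eq)

text \<open>\<open>Y\<close> is compared with a normal vector with covariance \<open>diag s\<close>, in the presence of an
  independent normal vector with covariance \<open>diag (v - s)\<close>. All densities are relative to
  \<open>N(0, diag v)\<close>: \<open>W I x \<omega>\<close> is the one on the coordinates \<open>I\<close> of \<open>Y \<omega> + N(0, diag (v - s))\<close>,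
  \<open>f I\<close> the one of the half mixture, and \<open>D i I / 2\<close> is its derivative in the coordinate \<open>i\<close>.
  Mehler's formula gives \<open>K2\<close> as the integral of \<open>k k'\<close> and \<open>K2 \<psi>\<close> as that of \<open>k l k' l'\<close>.\<close>

locale normal_shift = normal_product v + Q: prob_space Q
  for v :: "'i::finite \<Rightarrow> real" and Q :: "'w measure" +
  fixes s :: "'i \<Rightarrow> real" and Y :: "'i \<Rightarrow> 'w \<Rightarrow> real" and C :: real
  assumes Y_meas[measurable]: "\<And>i. Y i \<in> borel_measurable Q"
    and Y_bound: "\<And>i \<omega>. \<bar>Y i \<omega>\<bar> \<le> C"
    and s_nonneg: "\<And>i. 0 \<le> s i" and s_less: "\<And>i. s i < v i"
begin

definition k :: "'i \<Rightarrow> real \<Rightarrow> real \<Rightarrow> real" where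
  "k i x \<eta> = normal_density \<eta> (sqrt (v i - s i)) x / nd i x"

definition l :: "'i \<Rightarrow> real \<Rightarrow> real \<Rightarrow> real" where
  "l i x \<eta> = x / v i - (x - \<eta>) / (v i - s i)"

definition W :: "'i set \<Rightarrow> ('i \<Rightarrow> real) \<Rightarrow> 'w \<Rightarrow> real" where
  "W I x \<omega> = (\<Prod>j\<in>I. k j (x j) (Y j \<omega>))"

definition f :: "'i set \<Rightarrow> ('i \<Rightarrow> real) \<Rightarrow> real" where
  "f I x = 1/2 + 1/2 * (\<integral>\<omega>. W I x \<omega> \<partial>Q)"

definition D :: "'i \<Rightarrow> 'i set \<Rightarrow> ('i \<Rightarrow> real) \<Rightarrow> real" where
  "D i I x = (\<integral>\<omega>. W I x \<omega> * l i (x i) (Y i \<omega>) \<partial>Q)"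

definition K2 :: "'i \<Rightarrow> real \<Rightarrow> real \<Rightarrow> real" where
  "K2 i \<eta> \<eta>' = v i / sqrt ((v i)\<^sup>2 - (s i)\<^sup>2) *
     exp ((v i * \<eta> * \<eta>' - s i * (\<eta>\<^sup>2 + \<eta>'\<^sup>2) / 2) / ((v i)\<^sup>2 - (s i)\<^sup>2))"

definition \<psi> :: "'i \<Rightarrow> real \<Rightarrow> real \<Rightarrow> real" where
  "\<psi> i \<eta> \<eta>' = (v i * \<eta> - s i * \<eta>') * (v i * \<eta>' - s i * \<eta>) / ((v i)\<^sup>2 - (s i)\<^sup>2)\<^sup>2
     + (s i)\<^sup>2 / (v i * ((v i)\<^sup>2 - (s i)\<^sup>2))"

lemma a_pos: "0 < v i - s i" using s_less[of i] by simp

section \<open>Density ratios: positivity, measurability and local bounds\<close>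

lemma k_pos: "0 < k i x \<eta>"
  using a_pos v_pos by (simp add: k_def normal_density_pos)

lemma k_nonneg[simp]: "0 \<le> k i x \<eta>" and abs_k[simp]: "\<bar>k i x \<eta>\<bar> = k i x \<eta>"
  using k_pos[of i x \<eta>] by auto

lemma k_deriv: "((\<lambda>x. k i x \<eta>) has_real_derivative k i x \<eta> * l i x \<eta>) (at x)"
  unfolding k_def l_def by (rule normal_density_shift_deriv[OF a_pos v_pos])

lemma kl_meas[measurable]:
  "case_prod (k i) \<in> borel_measurable (borel \<Otimes>\<^sub>M borel)" "case_prod (l i) \<in> borel_measurable (borel \<Otimes>\<^sub>M borel)"
  unfolding k_def l_def normal_density_def split_beta' by measurable

lemma W_meas[measurable (raw)]:
  assumes [measurable]: "X \<in> measurable M \<Pi>n" "U \<in> measurable M Q"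
  shows "(\<lambda>p. W I (X p) (U p)) \<in> borel_measurable M"
proof -
  have "(\<lambda>p. X p j) \<in> measurable M (\<gamma> j)" for j by measurable
  then have [measurable]: "(\<lambda>p. X p j) \<in> borel_measurable M" for j by simp
  have [measurable]: "(\<lambda>p. Y j (U p)) \<in> borel_measurable M" for j
    by (rule measurable_compose[OF assms(2) Y_meas])
  have "(\<lambda>p. case_prod (k j) (X p j, Y j (U p))) \<in> borel_measurable M" for j
    by (rule measurable_compose[OF _ kl_meas(1)]) measurable
  then show ?thesis unfolding W_def by (intro borel_measurable_prod) auto
qed

lemma W_nonneg: "0 \<le> W I x \<omega>"
  unfolding W_def by (intro prod_nonneg) (auto intro: less_imp_le k_pos)

text \<open>The bound on \<open>k i x \<eta>\<close> that results from dropping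
  \<open>(x - \<eta>)\<^sup>2\<close> in the exponent. It is uniform in \<open>\<eta>\<close> and
  increasing in the modulus of \<open>x\<close>, and so serves as a dominating function on bounded
  sets.\<close>

definition kb :: "'i \<Rightarrow> real \<Rightarrow> real" where
  "kb i x = sqrt (v i / (v i - s i)) * exp (x\<^sup>2 / (2 * v i))"

lemma kb_nonneg[simp]: "0 \<le> kb i x"
  using a_pos[of i] v_pos[of i] by (simp add: kb_def)

lemma k_le: "k i x \<eta> \<le> kb i x"
proof -
  have "k i x \<eta> = sqrt (v i / (v i - s i)) * exp (x\<^sup>2 / (2 * v i) - (x - \<eta>)\<^sup>2 / (2 * (v i - s i)))"
    unfolding k_def by (rule normal_density_ratio[OF a_pos v_pos])
  also have "\<dots> \<le> kb i x"
    unfolding kb_def using a_pos[of i] v_pos[of i] by (intro mult_left_mono) auto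
  finally show ?thesis .
qed

lemma kb_mono: "\<bar>x\<bar> \<le> R \<Longrightarrow> kb i x \<le> kb i R"
  unfolding kb_def using a_pos[of i] v_pos[of i] power_mono[of "\<bar>x\<bar>" R 2]
  by (intro mult_left_mono) (auto simp: divide_right_mono)

lemma l_le: "\<bar>l i x (Y i \<omega>)\<bar> \<le> \<bar>x\<bar> / v i + (\<bar>x\<bar> + C) / (v i - s i)"
proof -
  have "\<bar>l i x (Y i \<omega>)\<bar> \<le> \<bar>x / v i\<bar> + \<bar>(x - Y i \<omega>) / (v i - s i)\<bar>"
    unfolding l_def by (rule abs_triangle_ineq4)
  also have "\<dots> = \<bar>x\<bar> / v i + \<bar>x - Y i \<omega>\<bar> / (v i - s i)"
    using a_pos[of i] v_pos[of i] by simp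
  also have "\<dots> \<le> \<bar>x\<bar> / v i + (\<bar>x\<bar> + C) / (v i - s i)"
    using a_pos[of i] Y_bound[of i \<omega>] abs_triangle_ineq4[of x "Y i \<omega>"]
    by (intro add_left_mono divide_right_mono) auto
  finally show ?thesis .
qed

lemma W_le: "W I x \<omega> \<le> (\<Prod>j\<in>I. kb j (x j))"
  unfolding W_def by (intro prod_mono) (auto intro: k_le less_imp_le[OF k_pos])

lemma W_integrable: "integrable Q (W I x)"
  by (rule Q.integrable_const_bound[where B="\<Prod>j\<in>I. kb j (x j)"])
    (auto simp: W_nonneg W_le intro!: W_meas)

lemma W_upd: "i \<notin> I \<Longrightarrow> W I (x(i := z)) \<omega> = W I x \<omega>"
  unfolding W_def by (intro prod.cong) auto

lemma W_insert: "i \<notin> I \<Longrightarrow> W (insert i I) (x(i := z)) \<omega> = W I x \<omega> * k i z (Y i \<omega>)"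
  using W_upd[of i I x z \<omega>] by (simp add: W_def)

lemma k_meas2[measurable (raw)]:
  assumes [measurable]: "X \<in> borel_measurable M" "U \<in> borel_measurable M"
  shows "(\<lambda>p. k i (X p) (U p)) \<in> borel_measurable M" "(\<lambda>p. l i (X p) (U p)) \<in> borel_measurable M"
proof -
  have "(\<lambda>p. case_prod (k i) (X p, U p)) \<in> borel_measurable M" by measurable
  then show "(\<lambda>p. k i (X p) (U p)) \<in> borel_measurable M" by simp
  have "(\<lambda>p. case_prod (l i) (X p, U p)) \<in> borel_measurable M" by measurable
  then show "(\<lambda>p. l i (X p) (U p)) \<in> borel_measurable M" by simp
qed

lemma k_nd: "k i z \<eta> * nd i z = normal_density \<eta> (sqrt (v i - s i)) z"
  using v_pos[of i] normal_density_pos[of "sqrt (v i)" 0 z] by (simp add: k_def)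

lemma k_nn_integral: "(\<integral>\<^sup>+ z. ennreal (k i z \<eta>) \<partial>\<gamma> i) = 1"
proof -
  have "(\<integral>\<^sup>+ z. ennreal (k i z \<eta>) \<partial>\<gamma> i) = (\<integral>\<^sup>+ z. ennreal (normal_density \<eta> (sqrt (v i - s i)) z) \<partial>lborel)"
    by (subst nn_integral_density) (auto simp: k_nd[symmetric] mult.commute simp flip: ennreal_mult)
  also have "\<dots> = 1"
    using a_pos[of i] by (subst nn_integral_eq_integral) auto
  finally show ?thesis .
qed

lemma k_integrable: "integrable (\<gamma> i) (\<lambda>z. k i z \<eta>)" and k_integral: "(\<integral>z. k i z \<eta> \<partial>\<gamma> i) = 1"
proof -
  show "integrable (\<gamma> i) (\<lambda>z. k i z \<eta>)"
    using k_nn_integral[of i \<eta>] by (intro integrableI_nonneg) auto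
  show "(\<integral>z. k i z \<eta> \<partial>\<gamma> i) = 1"
    using k_nn_integral[of i \<eta>] by (subst integral_eq_nn_integral) auto
qed

text \<open>Each \<open>k i\<close> integrates to \<open>1\<close> against
  \<open>\<gamma> i\<close>. The function \<open>h\<close> stands for the factors of the other
  coordinates, possibly with a factor \<open>l\<close>.\<close>

lemma marginal:
  fixes h :: "'w \<Rightarrow> real"
  assumes [measurable]: "h \<in> borel_measurable Q" and h: "\<And>\<omega>. \<bar>h \<omega>\<bar> \<le> B"
  shows "integrable (\<gamma> i) (\<lambda>z. \<integral>\<omega>. h \<omega> * k i z (Y i \<omega>) \<partial>Q)"
    and "(\<integral>z. (\<integral>\<omega>. h \<omega> * k i z (Y i \<omega>) \<partial>Q) \<partial>\<gamma> i) = (\<integral>\<omega>. h \<omega> \<partial>Q)"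
proof -
  interpret \<gamma>: prob_space "\<gamma> i" by (rule prob_\<gamma>)
  interpret pair_sigma_finite "\<gamma> i" Q ..
  have int: "integrable (\<gamma> i \<Otimes>\<^sub>M Q) (\<lambda>(z, \<omega>). h \<omega> * k i z (Y i \<omega>))"
  proof (rule integrableI_bounded)
    have "(\<integral>\<^sup>+ p. ennreal (norm (case p of (z, \<omega>) \<Rightarrow> h \<omega> * k i z (Y i \<omega>))) \<partial>(\<gamma> i \<Otimes>\<^sub>M Q))
        = (\<integral>\<^sup>+ \<omega>. \<integral>\<^sup>+ z. ennreal \<bar>h \<omega>\<bar> * ennreal (k i z (Y i \<omega>)) \<partial>\<gamma> i \<partial>Q)"
      by (subst nn_integral_snd[symmetric]) (auto simp: abs_mult ennreal_mult)
    also have "\<dots> = (\<integral>\<^sup>+ \<omega>. ennreal \<bar>h \<omega>\<bar> \<partial>Q)"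
      by (subst nn_integral_cmult) (auto simp: k_nn_integral)
    also have "\<dots> \<le> (\<integral>\<^sup>+ \<omega>. ennreal B \<partial>Q)"
      by (intro nn_integral_mono ennreal_leI h)
    also have "\<dots> < \<infinity>" by (simp add: Q.emeasure_space_1)
    finally show "(\<integral>\<^sup>+ p. ennreal (norm (case p of (z, \<omega>) \<Rightarrow> h \<omega> * k i z (Y i \<omega>))) \<partial>(\<gamma> i \<Otimes>\<^sub>M Q)) < \<infinity>" .
  qed measurable
  show "integrable (\<gamma> i) (\<lambda>z. \<integral>\<omega>. h \<omega> * k i z (Y i \<omega>) \<partial>Q)"
    using integrable_fst'[OF int] by simp
  have "(\<integral>z. (\<integral>\<omega>. h \<omega> * k i z (Y i \<omega>) \<partial>Q) \<partial>\<gamma> i) = (\<integral>\<omega>. (\<integral>z. h \<omega> * k i z (Y i \<omega>) \<partial>\<gamma> i) \<partial>Q)"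
    using Fubini_integral[OF int] by simp
  also have "\<dots> = (\<integral>\<omega>. h \<omega> \<partial>Q)" by (simp add: k_integral)
  finally show "(\<integral>z. (\<integral>\<omega>. h \<omega> * k i z (Y i \<omega>) \<partial>Q) \<partial>\<gamma> i) = (\<integral>\<omega>. h \<omega> \<partial>Q)" .
qed

lemma continuous_mixture:
  fixes h :: "'w \<Rightarrow> real"
  assumes [measurable]: "h \<in> borel_measurable Q" and h: "\<And>\<omega>. \<bar>h \<omega>\<bar> \<le> B"
  shows "continuous_on UNIV (\<lambda>z. \<integral>\<omega>. h \<omega> * k i z (Y i \<omega>) \<partial>Q)"
  unfolding continuous_on_sequentially
proof (intro allI impI ballI, elim conjE)
  fix x :: "nat \<Rightarrow> real" and z assume x: "x \<longlonglongrightarrow> z" "\<forall>n. x n \<in> UNIV"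
  have "Bseq x" using x(1) by (intro convergent_imp_Bseq convergentI)
  then obtain R where R: "\<And>n. norm (x n) \<le> R" by (auto simp: Bseq_def)
  have "0 \<le> B" using h[of undefined] by linarith
  show "((\<lambda>z. \<integral>\<omega>. h \<omega> * k i z (Y i \<omega>) \<partial>Q) \<circ> x) \<longlonglongrightarrow> (\<integral>\<omega>. h \<omega> * k i z (Y i \<omega>) \<partial>Q)"
    unfolding comp_def
  proof (rule integral_dominated_convergence[where w="\<lambda>_. B * kb i R"])
    show "AE \<omega> in Q. (\<lambda>n. h \<omega> * k i (x n) (Y i \<omega>)) \<longlonglongrightarrow> h \<omega> * k i z (Y i \<omega>)"
      using x(1) by (intro AE_I2 tendsto_mult tendsto_const isCont_tendsto_compose[OF DERIV_isCont[OF k_deriv]])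
    show "AE \<omega> in Q. norm (h \<omega> * k i (x n) (Y i \<omega>)) \<le> B * kb i R" for n
      unfolding norm_mult using R[of n] \<open>0 \<le> B\<close>
      by (intro AE_I2 mult_mono) (auto simp: h intro: order_trans[OF k_le kb_mono])
  qed auto
qed

text \<open>The fundamental theorem of calculus for each \<open>\<omega>\<close>, followed by
  Fubini. Differentiation under the integral sign is avoided, since \<open>weighted_hardy\<close>
  asks only for a bound on increments.\<close>

lemma mixture_increment:
  fixes h :: "'w \<Rightarrow> real"
  assumes [measurable]: "h \<in> borel_measurable Q" and h: "\<And>\<omega>. \<bar>h \<omega>\<bar> \<le> B" and "z \<le> w"
  shows "ennreal \<bar>(\<integral>\<omega>. h \<omega> * k i w (Y i \<omega>) \<partial>Q) - (\<integral>\<omega>. h \<omega> * k i z (Y i \<omega>) \<partial>Q)\<bar>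
    \<le> (\<integral>\<^sup>+ y. ennreal \<bar>\<integral>\<omega>. h \<omega> * k i y (Y i \<omega>) * l i y (Y i \<omega>) \<partial>Q\<bar> * indicator {z..w} y \<partial>lborel)"
proof -
  interpret pair_sigma_finite lborel Q ..
  have B0: "0 \<le> B" using h[of undefined] by linarith
  define R where "R = max \<bar>z\<bar> \<bar>w\<bar>"
  define B2 where "B2 = B * kb i R * (R / v i + (R + C) / (v i - s i))"
  have bound: "\<bar>h \<omega> * k i y (Y i \<omega>) * l i y (Y i \<omega>)\<bar> \<le> B2" if "y \<in> {z..w}" for y \<omega>
  proof -
    have y: "\<bar>y\<bar> \<le> R" using that by (auto simp: R_def)
    have "\<bar>l i y (Y i \<omega>)\<bar> \<le> R / v i + (R + C) / (v i - s i)"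
      using y a_pos[of i] v_pos[of i] by (intro order_trans[OF l_le] add_mono divide_right_mono) auto
    then show ?thesis unfolding B2_def abs_mult
      using y B0 h by (intro mult_mono) (auto simp: intro: order_trans[OF k_le kb_mono])
  qed
  have int: "integrable (lborel \<Otimes>\<^sub>M Q) (\<lambda>(y, \<omega>). (h \<omega> * k i y (Y i \<omega>) * l i y (Y i \<omega>)) * indicator {z..w} y)"
  proof (rule integrableI_bounded)
    have "(\<integral>\<^sup>+ p. ennreal (norm (case p of (y, \<omega>) \<Rightarrow> (h \<omega> * k i y (Y i \<omega>) * l i y (Y i \<omega>)) * indicator {z..w} y)) \<partial>(lborel \<Otimes>\<^sub>M Q))
        \<le> (\<integral>\<^sup>+ p. ennreal B2 * indicator {z..w} (fst p) \<partial>(lborel \<Otimes>\<^sub>M Q))"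
      using bound by (intro nn_integral_mono) (auto split: split_indicator intro!: ennreal_leI)
    also have "\<dots> = (\<integral>\<^sup>+ y. \<integral>\<^sup>+ \<omega>. ennreal B2 * indicator {z..w} y \<partial>Q \<partial>lborel)"
      by (subst Q.nn_integral_fst[symmetric]) auto
    also have "\<dots> = ennreal B2 * emeasure lborel {z..w}"
      by (simp add: Q.emeasure_space_1 nn_integral_cmult)
    also have "\<dots> < \<infinity>" using \<open>z \<le> w\<close> by (simp add: ennreal_mult_less_top)
    finally show "(\<integral>\<^sup>+ p. ennreal (norm (case p of (y, \<omega>) \<Rightarrow> (h \<omega> * k i y (Y i \<omega>) * l i y (Y i \<omega>)) * indicator {z..w} y)) \<partial>(lborel \<Otimes>\<^sub>M Q)) < \<infinity>" .
  qed measurable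
  have ftc: "(\<integral>y. (h \<omega> * k i y (Y i \<omega>) * l i y (Y i \<omega>)) * indicator {z..w} y \<partial>lborel) = h \<omega> * k i w (Y i \<omega>) - h \<omega> * k i z (Y i \<omega>)" for \<omega>
  proof (rule integral_FTC_Icc_real[OF \<open>z \<le> w\<close>])
    show "((\<lambda>y. h \<omega> * k i y (Y i \<omega>)) has_real_derivative h \<omega> * k i y (Y i \<omega>) * l i y (Y i \<omega>)) (at y)" for y
      using DERIV_cmult[OF k_deriv] by (simp add: mult.assoc)
    show "isCont (\<lambda>y. h \<omega> * k i y (Y i \<omega>) * l i y (Y i \<omega>)) y" for y
      unfolding l_def using a_pos[of i] v_pos[of i] by (intro continuous_intros DERIV_isCont[OF k_deriv]) auto
  qed
  have ik: "integrable Q (\<lambda>\<omega>. h \<omega> * k i y (Y i \<omega>))" for y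
    by (rule Q.integrable_const_bound[where B="B * kb i y"])
      (auto simp: abs_mult h intro!: mult_mono k_le B0)
  have "(\<integral>\<omega>. h \<omega> * k i w (Y i \<omega>) \<partial>Q) - (\<integral>\<omega>. h \<omega> * k i z (Y i \<omega>) \<partial>Q)
      = (\<integral>\<omega>. (\<integral>y. (h \<omega> * k i y (Y i \<omega>) * l i y (Y i \<omega>)) * indicator {z..w} y \<partial>lborel) \<partial>Q)"
    unfolding ftc using ik by simp
  also have "\<dots> = (\<integral>y. (\<integral>\<omega>. (h \<omega> * k i y (Y i \<omega>) * l i y (Y i \<omega>)) * indicator {z..w} y \<partial>Q) \<partial>lborel)"
    using Fubini_integral[OF int] by simp
  finally have "ennreal \<bar>(\<integral>\<omega>. h \<omega> * k i w (Y i \<omega>) \<partial>Q) - (\<integral>\<omega>. h \<omega> * k i z (Y i \<omega>) \<partial>Q)\<bar>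
      = ennreal (norm (\<integral>y. (\<integral>\<omega>. (h \<omega> * k i y (Y i \<omega>) * l i y (Y i \<omega>)) * indicator {z..w} y \<partial>Q) \<partial>lborel))"
    by simp
  also have "\<dots> \<le> (\<integral>\<^sup>+ y. ennreal (norm (\<integral>\<omega>. (h \<omega> * k i y (Y i \<omega>) * l i y (Y i \<omega>)) * indicator {z..w} y \<partial>Q)) \<partial>lborel)"
    using integrable_fst'[OF int] by (intro integral_norm_bound_ennreal) simp
  also have "\<dots> = (\<integral>\<^sup>+ y. ennreal \<bar>\<integral>\<omega>. h \<omega> * k i y (Y i \<omega>) * l i y (Y i \<omega>) \<partial>Q\<bar> * indicator {z..w} y \<partial>lborel)"
    by (intro nn_integral_cong) (auto split: split_indicator)
  finally show ?thesis .
qed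

end

text \<open>The logarithmic derivative \<open>l\<close> is affine in \<open>x\<close>. Here it is
  expanded about the mean \<open>v * (\<eta> + \<eta>') / w\<close> of the normal density in
  Mehler's formula; the slope is the same for \<open>\<eta>\<close> and
  \<open>\<eta>'\<close>.\<close>

lemma l_decomp:
  fixes a v w s x \<eta> \<eta>' :: real
  assumes "0 < a" "0 < v" "0 < w" "w = v + s"
  shows "(v * \<eta> - s * x) / (a * v) = (v * \<eta> - s * \<eta>') / (a * w) - s / (a * v) * (x - v * (\<eta> + \<eta>') / w)"
proof -
  have "(v * \<eta> - s * \<eta>') / (a * w) - s / (a * v) * (x - v * (\<eta> + \<eta>') / w)
      = (v * (v * \<eta> - s * \<eta>') - s * (w * x - v * (\<eta> + \<eta>'))) / (a * v * w)"
    using assms(1-3) by (simp add: field_simps)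
  also have "v * (v * \<eta> - s * \<eta>') - s * (w * x - v * (\<eta> + \<eta>')) = (v * \<eta> - s * x) * w"
    unfolding assms(4) by (simp add: algebra_simps)
  finally show ?thesis using assms(1-3) by simp
qed

lemma integral_quadratic_normal:
  fixes \<mu> \<sigma> A B A' B' :: real
  assumes "0 < \<sigma>"
  shows "has_bochner_integral lborel (\<lambda>x. normal_density \<mu> \<sigma> x * ((A - B * (x - \<mu>)) * (A' - B' * (x - \<mu>)))) (A * A' + B * B' * \<sigma>\<^sup>2)"
proof -
  have 0: "has_bochner_integral lborel (\<lambda>x. normal_density \<mu> \<sigma> x) 1"
    using assms by (simp add: has_bochner_integral_iff)
  have 1: "has_bochner_integral lborel (\<lambda>x. normal_density \<mu> \<sigma> x * (x - \<mu>)) 0"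
    using normal_moment_odd[OF assms, of \<mu> 0] by simp
  have 2: "has_bochner_integral lborel (\<lambda>x. normal_density \<mu> \<sigma> x * (x - \<mu>)\<^sup>2) (\<sigma>\<^sup>2)"
  proof -
    have "fact (2 * 1) / ((2 / \<sigma>\<^sup>2) ^ 1 * fact 1) = \<sigma>\<^sup>2" by simp
    with normal_moment_even[OF assms, of \<mu> 1] show ?thesis by (simp only: mult_1_right)
  qed
  have "has_bochner_integral lborel (\<lambda>x. (A * A') * normal_density \<mu> \<sigma> x + ((- (A * B' + A' * B)) * (normal_density \<mu> \<sigma> x * (x - \<mu>))
     + (B * B') * (normal_density \<mu> \<sigma> x * (x - \<mu>)\<^sup>2))) ((A * A') * 1 + ((- (A * B' + A' * B)) * 0 + (B * B') * \<sigma>\<^sup>2))"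
    by (intro has_bochner_integral_add has_bochner_integral_mult_right 0 1 2)
  moreover have "(A * A') * g + ((- (A * B' + A' * B)) * (g * d) + (B * B') * (g * d\<^sup>2)) = g * ((A - B * d) * (A' - B' * d))" for g d
    by (simp add: power2_eq_square algebra_simps)
  ultimately show ?thesis by simp
qed

section \<open>Square integrals of the partial derivatives\<close>

context normal_shift
begin

lemma f_alt: "f (insert i I) (x(i := z)) = 1/2 + 1/2 * (\<integral>\<omega>. W I x \<omega> * k i z (Y i \<omega>) \<partial>Q)" if "i \<notin> I"
  using that by (simp add: f_def W_insert)

lemma D_meas[measurable]: "D i I \<in> borel_measurable \<Pi>n"
proof -
  have [measurable]: "(\<lambda>p. fst p i) \<in> borel_measurable (\<Pi>n \<Otimes>\<^sub>M Q)" for i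
    using measurable_compose[OF measurable_fst measurable_component_singleton[of i UNIV \<gamma>]] by simp
  have [measurable]: "(\<lambda>p. Y i (snd p)) \<in> borel_measurable (\<Pi>n \<Otimes>\<^sub>M Q)"
    by (rule measurable_compose[OF measurable_snd Y_meas])
  show ?thesis unfolding D_def by measurable
qed

lemma f_meas[measurable]: "f I \<in> borel_measurable \<Pi>n"
  unfolding f_def by measurable

lemma W_bounded: "\<bar>W I x \<omega>\<bar> \<le> (\<Prod>j\<in>I. kb j (x j))"
  using W_le W_nonneg by simp

lemma f_empty: "f {} x = 1"
  by (simp add: f_def W_def Q.prob_space)

lemma f_ge: "1/2 \<le> f I x"
  by (simp add: f_def W_nonneg)

text \<open>This is the sum over \<open>i\<close> of \<open>(v i)\<^sup>2\<close> times the square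
  integral of \<open>D i UNIV\<close>, as \<open>energy_sum\<close> and \<open>D_energy\<close>
  show. The integral over \<open>x\<close> is already carried out, so that only \<open>Y\<close> and
  an independent copy of it remain.\<close>

definition energy :: real where
  "energy = (\<integral>p. (\<Prod>j\<in>UNIV. K2 j (Y j (fst p)) (Y j (snd p))) *
      (\<Sum>i\<in>UNIV. (v i)\<^sup>2 * \<psi> i (Y i (fst p)) (Y i (snd p))) \<partial>(Q \<Otimes>\<^sub>M Q))"

text \<open>The derivative of a marginal density is a conditional expectation.\<close>

lemma D_insert_mono:
  assumes "i \<in> I" "j \<notin> I"
  shows "(\<integral>\<^sup>+ x. ennreal ((D i I x)\<^sup>2) \<partial>\<Pi>n) \<le> (\<integral>\<^sup>+ x. ennreal ((D i (insert j I) x)\<^sup>2) \<partial>\<Pi>n)"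
proof -
  have "i \<noteq> j" using assms by auto
  have *: "D i I x = (\<integral>z. D i (insert j I) (x(j := z)) \<partial>\<gamma> j)" for x
  proof -
    have "\<bar>W I x \<omega> * l i (x i) (Y i \<omega>)\<bar> \<le> (\<Prod>j\<in>I. kb j (x j)) * (\<bar>x i\<bar> / v i + (\<bar>x i\<bar> + C) / (v i - s i))" for \<omega>
      unfolding abs_mult by (intro mult_mono W_bounded l_le prod_nonneg) auto
    from marginal(2)[where i=j, OF _ this] show ?thesis
      using \<open>i \<noteq> j\<close> assms by (simp add: D_def W_insert mult_ac)
  qed
  have "(\<integral>\<^sup>+ x. ennreal ((D i I x)\<^sup>2) \<partial>\<Pi>n)
      \<le> (\<integral>\<^sup>+ x. \<integral>\<^sup>+ z. ennreal ((D i (insert j I) (x(j := z)))\<^sup>2) \<partial>\<gamma> j \<partial>\<Pi>n)"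
    unfolding * by (intro nn_integral_mono sq_nn_integral_le prob_\<gamma>) simp
  also have "\<dots> = (\<integral>\<^sup>+ x. ennreal ((D i (insert j I) x)\<^sup>2) \<partial>\<Pi>n)"
    by (rule resample[symmetric]) simp
  finally show ?thesis .
qed

lemma D_mono:
  assumes "i \<in> I"
  shows "(\<integral>\<^sup>+ x. ennreal ((D i I x)\<^sup>2) \<partial>\<Pi>n) \<le> (\<integral>\<^sup>+ x. ennreal ((D i UNIV x)\<^sup>2) \<partial>\<Pi>n)"
proof -
  have "(\<integral>\<^sup>+ x. ennreal ((D i I x)\<^sup>2) \<partial>\<Pi>n) \<le> (\<integral>\<^sup>+ x. ennreal ((D i (I \<union> J) x)\<^sup>2) \<partial>\<Pi>n)" for J
    using finite[of J]
  proof (induction J rule: finite_induct)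
    case (insert j J)
    show ?case
    proof (cases "j \<in> I")
      case True
      then have "I \<union> insert j J = I \<union> J" by auto
      then show ?thesis using insert by simp
    next
      case False
      then show ?thesis using D_insert_mono[of i "I \<union> J" j] assms insert by simp
    qed
  qed simp
  from this[of UNIV] show ?thesis by simp
qed

lemma v2s2: "0 < (v i)\<^sup>2 - (s i)\<^sup>2" "(v i)\<^sup>2 - (s i)\<^sup>2 = (v i - s i) * (v i + s i)"
proof -
  show "(v i)\<^sup>2 - (s i)\<^sup>2 = (v i - s i) * (v i + s i)" by (simp add: power2_eq_square algebra_simps)
  then show "0 < (v i)\<^sup>2 - (s i)\<^sup>2" using a_pos[of i] v_pos[of i] s_nonneg[of i] by simp
qed

lemma kk_eq: "k i x \<eta> * k i x \<eta>' * nd i x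
   = K2 i \<eta> \<eta>' * normal_density (v i * (\<eta> + \<eta>') / (v i + s i)) (sqrt ((v i - s i) * v i / (v i + s i))) x"
proof -
  have "k i x \<eta> * k i x \<eta>' * nd i x
      = normal_density \<eta> (sqrt (v i - s i)) x * normal_density \<eta>' (sqrt (v i - s i)) x / nd i x"
    using v_pos[of i] normal_density_pos[of "sqrt (v i)" 0 x] by (simp add: k_def)
  also have "\<dots> = K2 i \<eta> \<eta>' * normal_density (v i * (\<eta> + \<eta>') / (v i + s i)) (sqrt ((v i - s i) * v i / (v i + s i))) x"
    unfolding K2_def by (rule normal_density_mehler[OF s_nonneg s_less])
  finally show ?thesis .
qed

text \<open>By \<open>kk_eq\<close> the product \<open>k k'\<close> is \<open>K2\<close> times a
  normal density. Around its mean, \<open>l\<close> and \<open>l'\<close> are affine with values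
  \<open>A\<close>, \<open>A'\<close> and the common slope \<open>- B\<close>, so their product has
  expectation \<open>A * A'\<close> plus \<open>B\<^sup>2\<close> times the variance.\<close>

lemma kk_ll:
  shows "has_bochner_integral (\<gamma> i) (\<lambda>x. k i x \<eta> * k i x \<eta>') (K2 i \<eta> \<eta>')"
    and "has_bochner_integral (\<gamma> i) (\<lambda>x. k i x \<eta> * l i x \<eta> * (k i x \<eta>' * l i x \<eta>')) (K2 i \<eta> \<eta>' * \<psi> i \<eta> \<eta>')"
proof -
  let ?\<mu> = "v i * (\<eta> + \<eta>') / (v i + s i)" and ?\<sigma> = "sqrt ((v i - s i) * v i / (v i + s i))"
  have pos: "0 < v i - s i" "0 < v i" "0 < v i + s i" using a_pos[of i] v_pos[of i] s_nonneg[of i] by auto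
  have \<sigma>: "0 < ?\<sigma>" using pos by simp
  have l_eq: "l i x \<eta> = (v i * \<eta> - s i * x) / ((v i - s i) * v i)" for x \<eta>
  proof -
    have "x / v - (x - \<eta>) / a = (v * \<eta> - (v - a) * x) / (a * v)" if "0 < a" "0 < v" for a v :: real
      using that by (simp add: field_simps)
    from this[OF pos(1,2)] show ?thesis by (simp add: l_def)
  qed
  have dens: "has_bochner_integral (\<gamma> i) (\<lambda>x. g x) c" if "has_bochner_integral lborel (\<lambda>x. g x * nd i x) c"
    and [measurable]: "g \<in> borel_measurable borel" for g :: "real \<Rightarrow> real" and c
    using that(1) by (intro has_bochner_integral_density[of g lborel "nd i"]) (auto simp: mult.commute)
  have "has_bochner_integral lborel (\<lambda>x. K2 i \<eta> \<eta>' * normal_density ?\<mu> ?\<sigma> x) (K2 i \<eta> \<eta>' * 1)"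
    using \<sigma> by (intro has_bochner_integral_mult_right) (simp add: has_bochner_integral_iff)
  then show "has_bochner_integral (\<gamma> i) (\<lambda>x. k i x \<eta> * k i x \<eta>') (K2 i \<eta> \<eta>')"
    by (intro dens) (auto simp: kk_eq)
  define A where "A = (v i * \<eta> - s i * \<eta>') / ((v i)\<^sup>2 - (s i)\<^sup>2)"
  define A' where "A' = (v i * \<eta>' - s i * \<eta>) / ((v i)\<^sup>2 - (s i)\<^sup>2)"
  define B where "B = s i / ((v i - s i) * v i)"
  have L1: "l i x \<eta> = A - B * (x - ?\<mu>)" for x
    unfolding l_eq A_def B_def v2s2(2) by (rule l_decomp[OF pos refl])
  have L2: "l i x \<eta>' = A' - B * (x - ?\<mu>)" for x
    unfolding l_eq A'_def B_def v2s2(2) add.commute[of \<eta> \<eta>'] by (rule l_decomp[OF pos refl])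
  have \<psi>_eq: "A * A' + B * B * ?\<sigma>\<^sup>2 = \<psi> i \<eta> \<eta>'"
  proof -
    have "B * B * ?\<sigma>\<^sup>2 = (s i)\<^sup>2 / (v i * ((v i)\<^sup>2 - (s i)\<^sup>2))"
    proof -
      have "s / (a * v) * (s / (a * v)) * (a * v / w) = s\<^sup>2 / (v * (a * w))" if "0 < a" "0 < v" "0 < w" for a v w s :: real
        using that by (simp add: field_simps power2_eq_square)
      from this[OF pos, of "s i"] show ?thesis unfolding B_def v2s2(2) using pos by (simp only: real_sqrt_pow2 less_imp_le divide_nonneg_nonneg mult_nonneg_nonneg)
    qed
    then show ?thesis unfolding \<psi>_def A_def A'_def power2_eq_square times_divide_times_eq by simp
  qed
  have hb: "has_bochner_integral lborel (\<lambda>x. K2 i \<eta> \<eta>' * (normal_density ?\<mu> ?\<sigma> x * (l i x \<eta> * l i x \<eta>'))) (K2 i \<eta> \<eta>' * \<psi> i \<eta> \<eta>')"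
    unfolding L1 L2 \<psi>_eq[symmetric] by (intro has_bochner_integral_mult_right integral_quadratic_normal \<sigma>)
  have eq: "K2 i \<eta> \<eta>' * (normal_density ?\<mu> ?\<sigma> x * (l i x \<eta> * l i x \<eta>')) = k i x \<eta> * l i x \<eta> * (k i x \<eta>' * l i x \<eta>') * nd i x" for x
  proof -
    have "k i x \<eta> * l i x \<eta> * (k i x \<eta>' * l i x \<eta>') * nd i x = (k i x \<eta> * k i x \<eta>' * nd i x) * (l i x \<eta> * l i x \<eta>')"
      by (simp only: mult_ac)
    then show ?thesis unfolding kk_eq by (simp only: mult.assoc)
  qed
  show "has_bochner_integral (\<gamma> i) (\<lambda>x. k i x \<eta> * l i x \<eta> * (k i x \<eta>' * l i x \<eta>')) (K2 i \<eta> \<eta>' * \<psi> i \<eta> \<eta>')"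
    by (intro dens hb[unfolded eq]) simp
qed

end

context normal_shift
begin

abbreviation "QQ \<equiv> Q \<Otimes>\<^sub>M Q"

lemma QQ_prob: "prob_space QQ"
  using Q.prob_space_axioms by (rule prob_space_pair[OF Q.prob_space_axioms])

lemma Y_fs[measurable]: "(\<lambda>p. Y i (fst p)) \<in> borel_measurable QQ" "(\<lambda>p. Y i (snd p)) \<in> borel_measurable QQ"
  by (rule measurable_compose[OF measurable_fst Y_meas], rule measurable_compose[OF measurable_snd Y_meas])

lemma Wl_bounded: "\<bar>W I x \<omega> * l i (x i) (Y i \<omega>)\<bar> \<le> (\<Prod>j\<in>I. kb j (x j)) * (\<bar>x i\<bar> / v i + (\<bar>x i\<bar> + C) / (v i - s i))"
  unfolding abs_mult by (intro mult_mono W_bounded l_le prod_nonneg) auto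

text \<open>The square of an average over \<open>Q\<close> is an average over two independent
  copies. This makes it possible to integrate over \<open>x\<close> before averaging, by Mehler's
  formula.\<close>

lemma D_sq: "(D i I x)\<^sup>2 = (\<integral>p. (W I x (fst p) * l i (x i) (Y i (fst p))) * (W I x (snd p) * l i (x i) (Y i (snd p))) \<partial>QQ)"
proof -
  interpret QQ: pair_prob_space Q Q ..
  let ?g = "\<lambda>\<omega>. W I x \<omega> * l i (x i) (Y i \<omega>)"
  let ?B = "(\<Prod>j\<in>I. kb j (x j)) * (\<bar>x i\<bar> / v i + (\<bar>x i\<bar> + C) / (v i - s i))"
  have int: "integrable QQ (\<lambda>p. ?g (fst p) * ?g (snd p))"
  proof (rule finite_measure.integrable_const_bound[where B="?B * ?B"])
    have "\<bar>?g \<omega> * ?g \<omega>'\<bar> \<le> ?B * ?B" for \<omega> \<omega>'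
      unfolding abs_mult[of "?g \<omega>"] using Wl_bounded[of I x \<omega> i]
      by (intro mult_mono Wl_bounded) linarith+
    then show "AE p in QQ. norm (?g (fst p) * ?g (snd p)) \<le> ?B * ?B" by simp
    show "finite_measure QQ" using QQ_prob by (rule prob_space.finite_measure)
  qed measurable
  have "(\<integral>p. ?g (fst p) * ?g (snd p) \<partial>QQ) = (\<integral>\<omega>. (\<integral>\<omega>'. ?g \<omega> * ?g \<omega>' \<partial>Q) \<partial>Q)"
    using QQ.integral_fst'[OF int] by simp
  also have "\<dots> = (D i I x)\<^sup>2"
    by (simp add: D_def power2_eq_square)
  finally show ?thesis ..
qed

text \<open>The integral factors over the coordinates, and only the coordinate \<open>i\<close>
  carries the two factors \<open>l\<close>.\<close>

lemma W_sq_integral: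
  "has_bochner_integral \<Pi>n (\<lambda>x. (W UNIV x \<omega> * l i (x i) (Y i \<omega>)) * (W UNIV x \<omega>' * l i (x i) (Y i \<omega>')))
    ((\<Prod>j\<in>UNIV. K2 j (Y j \<omega>) (Y j \<omega>')) * \<psi> i (Y i \<omega>) (Y i \<omega>'))"
proof -
  let ?u = "\<lambda>j z. (if j = i then k j z (Y j \<omega>) * l j z (Y j \<omega>) * (k j z (Y j \<omega>') * l j z (Y j \<omega>')) else k j z (Y j \<omega>) * k j z (Y j \<omega>'))"
  let ?c = "\<lambda>j. (if j = i then K2 j (Y j \<omega>) (Y j \<omega>') * \<psi> j (Y j \<omega>) (Y j \<omega>') else K2 j (Y j \<omega>) (Y j \<omega>'))"
  have u: "has_bochner_integral (\<gamma> j) (?u j) (?c j)" for j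
    using kk_ll[of j "Y j \<omega>" "Y j \<omega>'"] by (cases "j = i") simp_all
  have ui: "integrable (\<gamma> j) (?u j)" and uc: "(\<integral>z. ?u j z \<partial>\<gamma> j) = ?c j" for j
    using u[of j] unfolding has_bochner_integral_iff by auto
  have "has_bochner_integral \<Pi>n (\<lambda>x. \<Prod>j\<in>UNIV. ?u j (x j)) (\<Prod>j\<in>UNIV. ?c j)"
    unfolding has_bochner_integral_iff
    using product_integrable_prod[OF _ ui, of UNIV] product_integral_prod[OF _ ui, of UNIV] uc by simp
  moreover have "(\<Prod>j\<in>UNIV. ?u j (x j)) = (W UNIV x \<omega> * l i (x i) (Y i \<omega>)) * (W UNIV x \<omega>' * l i (x i) (Y i \<omega>'))" for x
  proof -
    have "(\<Prod>j\<in>UNIV. ?u j (x j)) = (\<Prod>j\<in>UNIV. (k j (x j) (Y j \<omega>) * k j (x j) (Y j \<omega>')) * (if j = i then l j (x j) (Y j \<omega>) * l j (x j) (Y j \<omega>') else 1))"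
      by (intro prod.cong) auto
    then show ?thesis by (simp add: W_def prod.distrib mult_ac)
  qed
  moreover have "(\<Prod>j\<in>UNIV. ?c j) = (\<Prod>j\<in>UNIV. K2 j (Y j \<omega>) (Y j \<omega>')) * \<psi> i (Y i \<omega>) (Y i \<omega>')"
  proof -
    have "(\<Prod>j\<in>UNIV. ?c j) = (\<Prod>j\<in>UNIV. K2 j (Y j \<omega>) (Y j \<omega>') * (if j = i then \<psi> j (Y j \<omega>) (Y j \<omega>') else 1))"
      by (intro prod.cong) auto
    then show ?thesis by (simp add: prod.distrib)
  qed
  ultimately show ?thesis by simp
qed

text \<open>Supplies the absolute integrability for Fubini in \<open>D_energy\<close>. There
  products are estimated by \<open>\<bar>a * b\<bar> \<le> a\<^sup>2 + b\<^sup>2\<close>, so both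
  copies may be taken at the same \<open>\<omega>\<close>.\<close>

lemma diag_bounded: "\<exists>B. \<forall>\<omega>. (\<Prod>j\<in>UNIV. K2 j (Y j \<omega>) (Y j \<omega>)) * \<psi> i (Y i \<omega>) (Y i \<omega>) \<le> B"
proof -
  have Y2: "(Y j \<omega>)\<^sup>2 \<le> C\<^sup>2" for j \<omega>
    using power_mono[OF Y_bound[of j \<omega>] abs_ge_zero, of 2] by simp
  define kk where "kk j = v j / sqrt ((v j)\<^sup>2 - (s j)\<^sup>2) * exp ((v j - s j) * C\<^sup>2 / ((v j)\<^sup>2 - (s j)\<^sup>2))" for j
  define pp where "pp = ((v i - s i)\<^sup>2 * C\<^sup>2) / ((v i)\<^sup>2 - (s i)\<^sup>2)\<^sup>2 + (s i)\<^sup>2 / (v i * ((v i)\<^sup>2 - (s i)\<^sup>2))"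
  have K: "K2 j (Y j \<omega>) (Y j \<omega>) \<le> kk j" for j \<omega>
  proof -
    have "(v j * Y j \<omega> * Y j \<omega> - s j * ((Y j \<omega>)\<^sup>2 + (Y j \<omega>)\<^sup>2) / 2) = (v j - s j) * (Y j \<omega>)\<^sup>2"
      by (simp add: power2_eq_square algebra_simps)
    also have "\<dots> \<le> (v j - s j) * C\<^sup>2" using a_pos[of j] Y2 by (intro mult_left_mono) auto
    finally show ?thesis unfolding K2_def kk_def using v2s2(1)[of j] v_pos[of j]
      by (intro mult_left_mono) (auto intro!: divide_right_mono)
  qed
  have P: "\<psi> i (Y i \<omega>) (Y i \<omega>) \<le> pp" for \<omega>
  proof -
    have "(v i * Y i \<omega> - s i * Y i \<omega>) * (v i * Y i \<omega> - s i * Y i \<omega>) = (v i - s i)\<^sup>2 * (Y i \<omega>)\<^sup>2"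
      by (simp add: power2_eq_square algebra_simps)
    also have "\<dots> \<le> (v i - s i)\<^sup>2 * C\<^sup>2" using Y2 by (intro mult_left_mono) auto
    finally show ?thesis unfolding \<psi>_def pp_def by (intro add_right_mono divide_right_mono) auto
  qed
  have K0: "0 \<le> K2 j (Y j \<omega>) (Y j \<omega>)" for j \<omega>
    unfolding K2_def using v2s2(1)[of j] v_pos[of j] by simp
  have P0: "0 \<le> \<psi> i (Y i \<omega>) (Y i \<omega>)" for \<omega>
    unfolding \<psi>_def using v2s2(1)[of i] v_pos[of i] by simp
  have "(\<Prod>j\<in>UNIV. K2 j (Y j \<omega>) (Y j \<omega>)) * \<psi> i (Y i \<omega>) (Y i \<omega>) \<le> (\<Prod>j\<in>UNIV. kk j) * pp" for \<omega>
    using K0 P0 K order_trans[OF K0 K] by (intro mult_mono P prod_mono prod_nonneg) auto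
  then show ?thesis by blast
qed

lemma D_energy:
  fixes i
  defines "e \<equiv> (\<integral>p. (\<Prod>j\<in>UNIV. K2 j (Y j (fst p)) (Y j (snd p))) * \<psi> i (Y i (fst p)) (Y i (snd p)) \<partial>QQ)"
  shows "(\<integral>\<^sup>+ x. ennreal ((D i UNIV x)\<^sup>2) \<partial>\<Pi>n) = ennreal e" and "0 \<le> e"
    and "integrable QQ (\<lambda>p. (\<Prod>j\<in>UNIV. K2 j (Y j (fst p)) (Y j (snd p))) * \<psi> i (Y i (fst p)) (Y i (snd p)))"
proof -
  interpret QQ: prob_space QQ by (rule QQ_prob)
  interpret pair_sigma_finite \<Pi>n QQ ..
  let ?g = "\<lambda>x \<omega>. W UNIV x \<omega> * l i (x i) (Y i \<omega>)"
  let ?c = "\<lambda>\<omega> \<omega>'. (\<Prod>j\<in>UNIV. K2 j (Y j \<omega>) (Y j \<omega>')) * \<psi> i (Y i \<omega>) (Y i \<omega>')"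
  have [measurable]: "(\<lambda>p. fst p i) \<in> borel_measurable (\<Pi>n \<Otimes>\<^sub>M QQ)"
    using measurable_compose[OF measurable_fst measurable_component_singleton[of i UNIV \<gamma>]] by simp
  have [measurable]: "(\<lambda>p. Y i (fst (snd p))) \<in> borel_measurable (\<Pi>n \<Otimes>\<^sub>M QQ)" "(\<lambda>p. Y i (snd (snd p))) \<in> borel_measurable (\<Pi>n \<Otimes>\<^sub>M QQ)"
    by (rule measurable_compose[OF measurable_snd Y_fs(1)], rule measurable_compose[OF measurable_snd Y_fs(2)])
  have gm[measurable]: "(\<lambda>q. ?g (fst q) (fst (snd q)) * ?g (fst q) (snd (snd q))) \<in> borel_measurable (\<Pi>n \<Otimes>\<^sub>M QQ)"
    "(\<lambda>q. ?g (fst q) (fst (snd q))) \<in> borel_measurable (\<Pi>n \<Otimes>\<^sub>M QQ)"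
    "(\<lambda>q. ?g (fst q) (snd (snd q))) \<in> borel_measurable (\<Pi>n \<Otimes>\<^sub>M QQ)"
    by measurable
  have [measurable]: "(\<lambda>x. x i) \<in> borel_measurable \<Pi>n"
    using measurable_component_singleton[of i UNIV \<gamma>] by simp
  have [measurable]: "(\<lambda>x. W UNIV x \<omega>) \<in> borel_measurable \<Pi>n" for \<omega>
  proof (cases "\<omega> \<in> space Q")
    case True
    then show ?thesis by (intro W_meas) auto
  next
    case False
    have "(\<lambda>x. k j (x j) (Y j \<omega>)) \<in> borel_measurable \<Pi>n" for j
      using measurable_component_singleton[of j UNIV \<gamma>] by (intro k_meas2) auto
    then show ?thesis unfolding W_def by (intro borel_measurable_prod)
  qed
  obtain B where B: "\<And>\<omega>. ?c \<omega> \<omega> \<le> B" using diag_bounded by blast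
  have sq: "(\<integral>\<^sup>+ x. ennreal ((?g x \<omega>)\<^sup>2) \<partial>\<Pi>n) \<le> ennreal B" for \<omega>
  proof -
    have "has_bochner_integral \<Pi>n (\<lambda>x. (?g x \<omega>)\<^sup>2) (?c \<omega> \<omega>)"
      using W_sq_integral[of \<omega> i \<omega>] by (simp only: power2_eq_square)
    then have "(\<integral>\<^sup>+ x. ennreal ((?g x \<omega>)\<^sup>2) \<partial>\<Pi>n) = ennreal (?c \<omega> \<omega>)"
      by (subst nn_integral_eq_integral) (auto simp: has_bochner_integral_iff)
    then show ?thesis using B by (simp add: ennreal_leI)
  qed
  have int: "integrable (\<Pi>n \<Otimes>\<^sub>M QQ) (\<lambda>q. ?g (fst q) (fst (snd q)) * ?g (fst q) (snd (snd q)))"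
  proof (rule integrableI_bounded)
    have "(\<integral>\<^sup>+ q. ennreal (norm (?g (fst q) (fst (snd q)) * ?g (fst q) (snd (snd q)))) \<partial>(\<Pi>n \<Otimes>\<^sub>M QQ))
        \<le> (\<integral>\<^sup>+ q. ennreal ((?g (fst q) (fst (snd q)))\<^sup>2) + ennreal ((?g (fst q) (snd (snd q)))\<^sup>2) \<partial>(\<Pi>n \<Otimes>\<^sub>M QQ))"
    proof (intro nn_integral_mono)
      fix q
      have "\<bar>a * b\<bar> \<le> a\<^sup>2 + b\<^sup>2" for a b :: real
      proof -
        have "2 * \<bar>a\<bar> * \<bar>b\<bar> \<le> a\<^sup>2 + b\<^sup>2" using sum_squares_bound[of "\<bar>a\<bar>" "\<bar>b\<bar>"] by simp
        moreover have "0 \<le> \<bar>a\<bar> * \<bar>b\<bar>" by simp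
        ultimately show ?thesis unfolding abs_mult by linarith
      qed
      then show "ennreal (norm (?g (fst q) (fst (snd q)) * ?g (fst q) (snd (snd q))))
        \<le> ennreal ((?g (fst q) (fst (snd q)))\<^sup>2) + ennreal ((?g (fst q) (snd (snd q)))\<^sup>2)"
        unfolding real_norm_def by (subst ennreal_plus[symmetric]) (rule zero_le_power2 | rule ennreal_leI)+
    qed
    also have "\<dots> = (\<integral>\<^sup>+ p. (\<integral>\<^sup>+ x. ennreal ((?g x (fst p))\<^sup>2) \<partial>\<Pi>n) + (\<integral>\<^sup>+ x. ennreal ((?g x (snd p))\<^sup>2) \<partial>\<Pi>n) \<partial>QQ)"
      using gm(2,3) by (subst nn_integral_snd[symmetric]) (auto intro!: nn_integral_cong nn_integral_add)
    also have "\<dots> \<le> (\<integral>\<^sup>+ p. ennreal B + ennreal B \<partial>QQ)"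
      by (intro nn_integral_mono add_mono sq)
    also have "\<dots> < \<infinity>" by (simp add: QQ.emeasure_space_1)
    finally show "(\<integral>\<^sup>+ q. ennreal (norm (?g (fst q) (fst (snd q)) * ?g (fst q) (snd (snd q)))) \<partial>(\<Pi>n \<Otimes>\<^sub>M QQ)) < \<infinity>" .
  qed measurable
  have int': "integrable (\<Pi>n \<Otimes>\<^sub>M QQ) (\<lambda>(x, p). ?g x (fst p) * ?g x (snd p))"
    using int by (simp add: split_beta')
  have inner: "(\<integral>x. ?g x (fst p) * ?g x (snd p) \<partial>\<Pi>n) = ?c (fst p) (snd p)" for p
    using W_sq_integral[of "fst p" i "snd p"] unfolding has_bochner_integral_iff by simp
  show "integrable QQ (\<lambda>p. ?c (fst p) (snd p))"
    using integrable_snd[OF int'] unfolding inner .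
  have "e = (\<integral>x. (D i UNIV x)\<^sup>2 \<partial>\<Pi>n)"
    unfolding e_def D_sq using Fubini_integral[OF int'] unfolding inner .
  moreover have "integrable \<Pi>n (\<lambda>x. (D i UNIV x)\<^sup>2)"
    unfolding D_sq using integrable_fst'[OF int] by simp
  ultimately show "(\<integral>\<^sup>+ x. ennreal ((D i UNIV x)\<^sup>2) \<partial>\<Pi>n) = ennreal e" "0 \<le> e"
    by (auto simp: nn_integral_eq_integral)
qed

lemma energy_sum: "energy = (\<Sum>i\<in>UNIV. (v i)\<^sup>2 *
    (\<integral>p. (\<Prod>j\<in>UNIV. K2 j (Y j (fst p)) (Y j (snd p))) * \<psi> i (Y i (fst p)) (Y i (snd p)) \<partial>QQ))"
proof -
  have "energy = (\<integral>p. (\<Sum>i\<in>UNIV. (v i)\<^sup>2 * ((\<Prod>j\<in>UNIV. K2 j (Y j (fst p)) (Y j (snd p))) * \<psi> i (Y i (fst p)) (Y i (snd p)))) \<partial>QQ)"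
    unfolding energy_def by (simp add: sum_distrib_left mult_ac)
  also have "\<dots> = (\<Sum>i\<in>UNIV. (\<integral>p. (v i)\<^sup>2 * ((\<Prod>j\<in>UNIV. K2 j (Y j (fst p)) (Y j (snd p))) * \<psi> i (Y i (fst p)) (Y i (snd p))) \<partial>QQ))"
    by (intro Bochner_Integration.integral_sum integrable_mult_right D_energy(3))
  finally show ?thesis by simp
qed

lemma transport_to_mixture:
  obtains T where "T \<in> measurable \<Pi>n \<Pi>n" "distr \<Pi>n \<Pi>n T = density \<Pi>n (\<lambda>x. ennreal (f UNIV x))"
    "(\<integral>\<^sup>+ x. ennreal (\<Sum>i\<in>UNIV. (T x i - x i)\<^sup>2) \<partial>\<Pi>n) \<le> ennreal (energy / 2)"
proof -
  let ?e = "\<lambda>i. (\<integral>p. (\<Prod>j\<in>UNIV. K2 j (Y j (fst p)) (Y j (snd p))) * \<psi> i (Y i (fst p)) (Y i (snd p)) \<partial>QQ)"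
  let ?g = "\<lambda>i I x. 1/2 * D i (insert i I) x"
  have h: "W I x \<in> borel_measurable Q" "\<And>\<omega>. \<bar>W I x \<omega>\<bar> \<le> (\<Prod>j\<in>I. kb j (x j))" for I x
    by (auto intro: W_bounded[simplified])
  obtain T where T: "T \<in> measurable \<Pi>n \<Pi>n" "distr \<Pi>n \<Pi>n T = density \<Pi>n (\<lambda>x. ennreal (f UNIV x))"
    and c: "\<And>i. (\<integral>\<^sup>+ x. ennreal ((T x i - x i)\<^sup>2) \<partial>\<Pi>n) \<le> ennreal ((v i)\<^sup>2 / (1/2)) * ennreal (?e i / 4)"
  \<comment> \<open>The \<open>1/2\<close> is the lower bound of the mixture density; the
    \<open>1/4\<close> in the last argument is the square of the \<open>1/2\<close> in front of
    \<open>D\<close>. Together they give \<open>(v i)\<^sup>2 * ?e i / 2\<close> per coordinate. One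
    bound serves all marginals because of \<open>D_mono\<close>.\<close>
  proof (rule knothe_transport[of f ?g "1/2" "\<lambda>i. ?e i / 4"])
    show "f I (x(i := z)) = f I x" if "i \<notin> I" for i I x z
      using that by (simp add: f_def W_upd)
    show "continuous_on UNIV (\<lambda>z. f (insert i I) (x(i := z)))" if "i \<notin> I" for i I x
      unfolding f_alt[OF that] by (intro continuous_intros continuous_mixture[OF h])
    show "integrable (\<gamma> i) (\<lambda>z. f (insert i I) (x(i := z)))" if "i \<notin> I" for i I x
      unfolding f_alt[OF that] using marginal(1)[OF h, of i I x]
      by (intro Bochner_Integration.integrable_add integrable_mult_right finite_measure.integrable_const prob_space.finite_measure prob_\<gamma>)
    show "(\<integral>z. f (insert i I) (x(i := z)) \<partial>\<gamma> i) = f I x" if "i \<notin> I" for i I x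
    proof -
      show ?thesis
        unfolding f_alt[OF that] unfolding f_def using marginal[OF h, of i I x] prob_space.prob_space[OF prob_\<gamma>[of i]]
        by (subst Bochner_Integration.integral_add) auto
    qed
    show "ennreal \<bar>f (insert i I) (x(i := w)) - f (insert i I) (x(i := z))\<bar>
        \<le> (\<integral>\<^sup>+ y. ennreal \<bar>?g i I (x(i := y))\<bar> * indicator {z..w} y \<partial>lborel)" if i: "i \<notin> I" and zw: "z \<le> w" for i I x z w
    proof -
      have D: "D i (insert i I) (x(i := y)) = (\<integral>\<omega>. W I x \<omega> * k i y (Y i \<omega>) * l i y (Y i \<omega>) \<partial>Q)" for y
        unfolding D_def W_insert[OF i] by simp
      have [measurable]: "(\<lambda>y. D i (insert i I) (x(i := y))) \<in> borel_measurable borel" by measurable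
      have "ennreal \<bar>f (insert i I) (x(i := w)) - f (insert i I) (x(i := z))\<bar>
         = ennreal (1/2) * ennreal \<bar>(\<integral>\<omega>. W I x \<omega> * k i w (Y i \<omega>) \<partial>Q) - (\<integral>\<omega>. W I x \<omega> * k i z (Y i \<omega>) \<partial>Q)\<bar>"
      proof -
        have "\<bar>(1/2 + 1/2 * a) - (1/2 + 1/2 * b)\<bar> = 1/2 * \<bar>a - b\<bar>" for a b :: real
        proof -
          have "(1/2 + 1/2 * a) - (1/2 + 1/2 * b) = 1/2 * (a - b)" by (simp add: algebra_simps)
          then show ?thesis by (simp only: abs_mult)
        qed
        then show ?thesis unfolding f_alt[OF i] by (simp only: ennreal_mult abs_ge_zero zero_le_divide_1_iff zero_le_numeral)
      qed
      also have "\<dots> \<le> ennreal (1/2) * (\<integral>\<^sup>+ y. ennreal \<bar>D i (insert i I) (x(i := y))\<bar> * indicator {z..w} y \<partial>lborel)"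
        unfolding D by (intro mult_left_mono mixture_increment[OF h zw]) auto
      also have "\<dots> = (\<integral>\<^sup>+ y. ennreal (1/2) * (ennreal \<bar>D i (insert i I) (x(i := y))\<bar> * indicator {z..w} y) \<partial>lborel)"
        by (rule nn_integral_cmult[symmetric]) measurable
      also have "\<dots> = (\<integral>\<^sup>+ y. ennreal \<bar>?g i I (x(i := y))\<bar> * indicator {z..w} y \<partial>lborel)"
        by (intro nn_integral_cong, unfold abs_mult, subst ennreal_mult) (auto simp: mult.assoc)
      finally show ?thesis .
    qed
    show "(\<integral>\<^sup>+ x. ennreal ((?g i I x)\<^sup>2) \<partial>\<Pi>n) \<le> ennreal (?e i / 4)" for i I
    proof -
      have "(\<integral>\<^sup>+ x. ennreal ((?g i I x)\<^sup>2) \<partial>\<Pi>n) = (\<integral>\<^sup>+ x. ennreal (1/4) * ennreal ((D i (insert i I) x)\<^sup>2) \<partial>\<Pi>n)"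
        by (intro nn_integral_cong) (simp add: power_divide flip: ennreal_mult)
      also have "\<dots> = ennreal (1/4) * (\<integral>\<^sup>+ x. ennreal ((D i (insert i I) x)\<^sup>2) \<partial>\<Pi>n)"
        by (rule nn_integral_cmult) measurable
      also have "\<dots> \<le> ennreal (1/4) * (\<integral>\<^sup>+ x. ennreal ((D i UNIV x)\<^sup>2) \<partial>\<Pi>n)"
        by (intro mult_left_mono D_mono) auto
      also have "\<dots> = ennreal (?e i / 4)"
        unfolding D_energy(1) using D_energy(2)[of i] by (subst ennreal_mult[symmetric]) auto
      finally show ?thesis .
    qed
  qed (auto simp: f_empty f_ge[simplified])
  have [measurable]: "(\<lambda>x. T x i) \<in> borel_measurable \<Pi>n" "(\<lambda>x. x i) \<in> borel_measurable \<Pi>n" for i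
    using measurable_compose[OF T(1) measurable_component_singleton[of i UNIV \<gamma>]] measurable_component_singleton[of i UNIV \<gamma>]
    by auto
  have "(\<integral>\<^sup>+ x. ennreal (\<Sum>i\<in>UNIV. (T x i - x i)\<^sup>2) \<partial>\<Pi>n) = (\<Sum>i\<in>UNIV. (\<integral>\<^sup>+ x. ennreal ((T x i - x i)\<^sup>2) \<partial>\<Pi>n))"
    by (subst nn_integral_sum[symmetric]) (auto simp: sum_ennreal)
  also have "\<dots> \<le> (\<Sum>i\<in>UNIV. ennreal ((v i)\<^sup>2 / (1/2)) * ennreal (?e i / 4))"
    by (intro sum_mono c)
  also have "\<dots> = (\<Sum>i\<in>UNIV. ennreal ((v i)\<^sup>2 * ?e i / 2))"
    using D_energy(2) by (intro sum.cong refl) (auto simp flip: ennreal_mult)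
  also have "\<dots> = ennreal (energy / 2)"
    unfolding energy_sum using D_energy(2) by (subst sum_ennreal) (auto simp: sum_divide_distrib)
  finally show ?thesis using T that by blast
qed

lemma density_W:
  "density \<Pi>n (\<lambda>x. ennreal (W UNIV x \<omega>))
    = PiM UNIV (\<lambda>i. density lborel (\<lambda>z. ennreal (normal_density (Y i \<omega>) (sqrt (v i - s i)) z)))"
proof -
  let ?N = "\<lambda>i. density lborel (\<lambda>z. ennreal (normal_density (Y i \<omega>) (sqrt (v i - s i)) z))"
  have pN: "prob_space (?N i)" for i
    using a_pos[of i] by (intro prob_space_normal_density) simp
  interpret N: product_sigma_finite ?N
    using pN by (auto simp: product_sigma_finite_def intro: prob_space_imp_sigma_finite)
  have [measurable]: "(\<lambda>x. x i) \<in> borel_measurable \<Pi>n" for i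
    using measurable_component_singleton[of i UNIV \<gamma>] by simp
  show ?thesis
  proof (rule N.PiM_eqI)
    show "sets (density \<Pi>n (\<lambda>x. ennreal (W UNIV x \<omega>))) = sets (PiM UNIV ?N)"
      by (auto intro!: sets_PiM_cong)
    fix A :: "'i \<Rightarrow> real set" assume "\<And>i. i \<in> UNIV \<Longrightarrow> A i \<in> sets (?N i)"
    then have A[measurable]: "A i \<in> sets borel" for i by simp
    have [measurable]: "(\<lambda>x. ennreal (W UNIV x \<omega>)) \<in> borel_measurable \<Pi>n"
      unfolding W_def by (intro measurable_compose[OF _ measurable_ennreal] borel_measurable_prod k_meas2) auto
    have "emeasure (density \<Pi>n (\<lambda>x. ennreal (W UNIV x \<omega>))) (Pi\<^sub>E UNIV A)
        = (\<integral>\<^sup>+ x. ennreal (W UNIV x \<omega>) * indicator (Pi\<^sub>E UNIV A) x \<partial>\<Pi>n)"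
      by (rule emeasure_density) (auto intro!: sets_PiM_I_finite)
    also have "\<dots> = (\<integral>\<^sup>+ x. (\<Prod>i\<in>UNIV. ennreal (k i (x i) (Y i \<omega>)) * indicator (A i) (x i)) \<partial>\<Pi>n)"
    proof (intro nn_integral_cong)
      fix x :: "'i \<Rightarrow> real"
      have "indicator (Pi\<^sub>E UNIV A) x = (\<Prod>i\<in>UNIV. indicator (A i) (x i) :: ennreal)"
        by (auto simp: indicator_def PiE_iff prod_zero_iff)
      then show "ennreal (W UNIV x \<omega>) * indicator (Pi\<^sub>E UNIV A) x = (\<Prod>i\<in>UNIV. ennreal (k i (x i) (Y i \<omega>)) * indicator (A i) (x i))"
        by (simp add: W_def prod.distrib prod_ennreal)
    qed
    also have "\<dots> = (\<Prod>i\<in>UNIV. \<integral>\<^sup>+ z. ennreal (k i z (Y i \<omega>)) * indicator (A i) z \<partial>\<gamma> i)"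
      by (rule product_nn_integral_prod) auto
    also have "\<dots> = (\<Prod>i\<in>UNIV. emeasure (?N i) (A i))"
    proof (intro prod.cong refl)
      fix i
      have "(\<integral>\<^sup>+ z. ennreal (k i z (Y i \<omega>)) * indicator (A i) z \<partial>\<gamma> i)
          = (\<integral>\<^sup>+ z. ennreal (nd i z) * (ennreal (k i z (Y i \<omega>)) * indicator (A i) z) \<partial>lborel)"
        by (rule nn_integral_density) auto
      also have "\<dots> = (\<integral>\<^sup>+ z. ennreal (normal_density (Y i \<omega>) (sqrt (v i - s i)) z) * indicator (A i) z \<partial>lborel)"
        unfolding k_nd[symmetric] by (intro nn_integral_cong) (simp add: mult_ac flip: ennreal_mult)
      also have "\<dots> = emeasure (?N i) (A i)"
        by (rule emeasure_density[symmetric]) auto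
      finally show "(\<integral>\<^sup>+ z. ennreal (k i z (Y i \<omega>)) * indicator (A i) z \<partial>\<gamma> i) = emeasure (?N i) (A i)" .
    qed
    finally show "emeasure (density \<Pi>n (\<lambda>x. ennreal (W UNIV x \<omega>))) (Pi\<^sub>E UNIV A) = (\<Prod>i\<in>UNIV. emeasure (?N i) (A i))" .
  qed simp
qed

end

section \<open>Coordinatewise and affine images of normal laws\<close>

lemma distr_PiM_coordinatewise:
  fixes M N :: "'i::finite \<Rightarrow> real measure"
  assumes M: "\<And>i. prob_space (M i)" and N: "\<And>i. prob_space (N i)"
    and sets: "\<And>i. sets (M i) = sets borel" "\<And>i. sets (N i) = sets borel"
    and t[measurable]: "\<And>i. t i \<in> borel_measurable borel"
    and d: "\<And>i. distr (M i) borel (t i) = N i"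
  shows "distr (PiM UNIV M) (PiM UNIV N) (\<lambda>x i. t i (x i)) = PiM UNIV N"
    and "(\<lambda>x i. t i (x i)) \<in> measurable (PiM UNIV M) (PiM UNIV N)"
proof -
  interpret M: product_sigma_finite M
    using M by (auto simp: product_sigma_finite_def intro: prob_space_imp_sigma_finite)
  interpret N: product_sigma_finite N
    using N by (auto simp: product_sigma_finite_def intro: prob_space_imp_sigma_finite)
  note [measurable_cong] = sets
  have sp: "space (M i) = UNIV" "space (N i) = UNIV" for i
    using sets_eq_imp_space_eq[OF sets(1)] sets_eq_imp_space_eq[OF sets(2)] by auto
  show meas: "(\<lambda>x i. t i (x i)) \<in> measurable (PiM UNIV M) (PiM UNIV N)"
    by (rule measurable_PiM_single') (auto simp: space_PiM sp)
  show "distr (PiM UNIV M) (PiM UNIV N) (\<lambda>x i. t i (x i)) = PiM UNIV N"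
  proof (rule N.PiM_eqI)
    fix A :: "'i \<Rightarrow> real set" assume "\<And>i. i \<in> UNIV \<Longrightarrow> A i \<in> sets (N i)"
    then have A[measurable]: "A i \<in> sets borel" for i by (simp add: sets)
    have tA: "t i -` A i \<in> sets (M i)" for i
      using measurable_sets[OF t A, of i] by (simp add: sets)
    have "emeasure (distr (PiM UNIV M) (PiM UNIV N) (\<lambda>x i. t i (x i))) (Pi\<^sub>E UNIV A)
        = emeasure (PiM UNIV M) (Pi\<^sub>E UNIV (\<lambda>i. t i -` A i))"
      using A by (subst emeasure_distr[OF meas]) (auto intro!: arg_cong2[where f=emeasure] sets_PiM_I_finite simp: sets space_PiM sp PiE_iff)
    also have "\<dots> = (\<Prod>i\<in>UNIV. emeasure (M i) (t i -` A i))"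
      by (rule M.emeasure_PiM) (auto intro: tA)
    also have "\<dots> = (\<Prod>i\<in>UNIV. emeasure (N i) (A i))"
      by (subst d[symmetric], subst emeasure_distr) (auto simp: sp)
    finally show "emeasure (distr (PiM UNIV M) (PiM UNIV N) (\<lambda>x i. t i (x i))) (Pi\<^sub>E UNIV A) = (\<Prod>i\<in>UNIV. emeasure (N i) (A i))" .
  qed simp_all
qed

lemma distr_normal_affine:
  assumes "0 < \<sigma>" "c \<noteq> 0"
  shows "distr (density lborel (\<lambda>z. ennreal (normal_density \<mu> \<sigma> z))) borel (\<lambda>z. \<eta> + c * z)
    = density lborel (\<lambda>z. ennreal (normal_density (\<eta> + c * \<mu>) (\<bar>c\<bar> * \<sigma>) z))"
proof -
  interpret prob_space "density lborel (\<lambda>z. ennreal (normal_density \<mu> \<sigma> z))"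
    by (rule prob_space_normal_density) fact
  have "distributed (density lborel (\<lambda>z. ennreal (normal_density \<mu> \<sigma> z))) lborel (\<lambda>z. z) (\<lambda>z. ennreal (normal_density \<mu> \<sigma> z))"
    by (auto simp: distributed_def distr_id2)
  from normal_density_affine[OF this assms, of \<eta>] show ?thesis
    by (auto simp: distributed_def cong: distr_cong)
qed

section \<open>From the half mixture to the full step\<close>

locale orthonormal_coords =
  fixes e :: "'i::finite \<Rightarrow> 'a::euclidean_space"
  assumes orth: "\<And>i j. e i \<bullet> e j = (if i = j then 1 else 0)"
begin

definition vec :: "('i \<Rightarrow> real) \<Rightarrow> 'a" where
  "vec x = (\<Sum>i\<in>UNIV. x i *\<^sub>R e i)"

lemma norm_vec: "(norm (vec x))\<^sup>2 = (\<Sum>i\<in>UNIV. (x i)\<^sup>2)"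
proof -
  have "(norm (vec x))\<^sup>2 = (\<Sum>i\<in>UNIV. \<Sum>j\<in>UNIV. x j * (x i * (if j = i then 1 else 0)))"
    unfolding vec_def power2_norm_eq_inner
    by (simp add: inner_sum_left inner_sum_right orth sum_distrib_left mult_ac if_distrib cong: if_cong)
  also have "\<dots> = (\<Sum>i\<in>UNIV. (x i)\<^sup>2)"
    by (simp add: power2_eq_square if_distrib cong: if_cong)
  finally show ?thesis .
qed

lemma vec_diff: "vec x - vec y = vec (\<lambda>i. x i - y i)"
  by (simp add: vec_def scaleR_diff_left sum_subtractf)

lemma vec_add: "vec (\<lambda>i. x i + y i) = vec x + vec y"
  by (simp add: vec_def scaleR_add_left sum.distrib)

lemma vec_meas:
  assumes "\<And>i. sets (M i) = sets borel"
  shows "vec \<in> borel_measurable (PiM UNIV M)"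
proof -
  have [measurable]: "(\<lambda>x. x i) \<in> borel_measurable (PiM UNIV M)" for i
    using measurable_component_singleton[of i UNIV M] assms measurable_cong_sets[OF refl assms] by blast
  show ?thesis unfolding vec_def by measurable
qed

end

locale shift_coords = normal_shift v Q s Y C + orthonormal_coords e
  for v :: "'i::finite \<Rightarrow> real" and Q :: "'w measure" and s Y C and e :: "'i \<Rightarrow> 'a::euclidean_space"
begin

abbreviation "\<gamma>a i \<equiv> density lborel (\<lambda>z. ennreal (normal_density 0 (sqrt (v i - s i)) z))"
abbreviation "\<Pi>a \<equiv> PiM (UNIV::'i set) \<gamma>a"

definition \<rho>1 :: "'a measure" where
  "\<rho>1 = distr (Q \<Otimes>\<^sub>M \<Pi>a) borel (\<lambda>(\<omega>, u). vec (\<lambda>i. Y i \<omega>) + vec u)"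

lemma prob_\<gamma>a: "prob_space (\<gamma>a i)"
  using a_pos[of i] by (intro prob_space_normal_density) simp

lemma prob_\<Pi>a: "prob_space \<Pi>a"
  by (rule prob_space_PiM) (rule prob_\<gamma>a)

lemma vec_\<Pi>n[measurable]: "vec \<in> borel_measurable \<Pi>n" and vec_\<Pi>a[measurable]: "vec \<in> borel_measurable \<Pi>a"
  by (auto intro: vec_meas)

lemma vec_Y[measurable]: "(\<lambda>\<omega>. vec (\<lambda>i. Y i \<omega>)) \<in> borel_measurable Q"
  unfolding vec_def by measurable

lemma nn_integral_\<rho>1:
  assumes [measurable]: "F \<in> borel_measurable borel"
  shows "(\<integral>\<^sup>+ y. F y \<partial>\<rho>1) = (\<integral>\<^sup>+ \<omega>. \<integral>\<^sup>+ u. F (vec (\<lambda>i. Y i \<omega>) + vec u) \<partial>\<Pi>a \<partial>Q)"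
proof -
  interpret A: prob_space \<Pi>a by (rule prob_\<Pi>a)
  show ?thesis unfolding \<rho>1_def
    by (simp add: nn_integral_distr split_beta' A.nn_integral_fst[symmetric])
qed

lemma W_shift:
  assumes S[measurable]: "S \<in> sets borel" and \<omega>: "\<omega> \<in> space Q"
  shows "(\<integral>\<^sup>+ x. ennreal (W UNIV x \<omega>) * indicator S (vec x) \<partial>\<Pi>n)
      = (\<integral>\<^sup>+ u. indicator S (vec (\<lambda>i. Y i \<omega>) + vec u) \<partial>\<Pi>a)"
proof -
  let ?N = "\<lambda>i. density lborel (\<lambda>z. ennreal (normal_density (Y i \<omega>) (sqrt (v i - s i)) z))"
  let ?t = "\<lambda>i z. Y i \<omega> + z"
  have pN: "prob_space (?N i)" for i
    using a_pos[of i] by (intro prob_space_normal_density) simp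
  have dt: "distr (\<gamma>a i) borel (?t i) = ?N i" for i
    using distr_normal_affine[of "sqrt (v i - s i)" 1 0 "Y i \<omega>"] a_pos[of i] by simp
  have d: "distr \<Pi>a (PiM UNIV ?N) (\<lambda>x i. ?t i (x i)) = PiM UNIV ?N"
    by (rule distr_PiM_coordinatewise(1)[of \<gamma>a ?N ?t, OF prob_\<gamma>a pN _ _ _ dt]; simp)
  have dm[measurable]: "(\<lambda>x i. ?t i (x i)) \<in> measurable \<Pi>a (PiM UNIV ?N)"
    by (rule distr_PiM_coordinatewise(2)[of \<gamma>a ?N ?t, OF prob_\<gamma>a pN _ _ _ dt]; simp)
  have [measurable]: "vec \<in> borel_measurable (PiM UNIV ?N)" by (rule vec_meas) simp
  have [measurable]: "(\<lambda>x. ennreal (W UNIV x \<omega>)) \<in> borel_measurable \<Pi>n"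
    using \<omega> by (intro measurable_compose[OF _ measurable_ennreal] W_meas) auto
  have "(\<integral>\<^sup>+ x. ennreal (W UNIV x \<omega>) * indicator S (vec x) \<partial>\<Pi>n) = (\<integral>\<^sup>+ x. indicator S (vec x) \<partial>PiM UNIV ?N)"
    unfolding density_W[symmetric] by (subst nn_integral_density) auto
  also have "\<dots> = (\<integral>\<^sup>+ u. indicator S (vec (\<lambda>i. ?t i (u i))) \<partial>\<Pi>a)"
    by (subst d[symmetric], subst nn_integral_distr) auto
  finally show ?thesis by (simp add: vec_add)
qed

text \<open>Reweighting by \<open>W\<close> turns \<open>\<Pi>n\<close> into the law of the
  translated noise \<open>Y \<omega> + N(0, v - s)\<close>; averaging over \<open>\<omega>\<close>
  gives \<open>\<rho>1\<close>. The two halves in \<open>f\<close> account for the factor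
  \<open>2\<close>.\<close>

lemma mixture_midpoint:
  assumes S[measurable]: "S \<in> sets borel"
  shows "2 * emeasure (distr (density \<Pi>n (\<lambda>x. ennreal (f UNIV x))) borel vec) S
    = emeasure (distr \<Pi>n borel vec) S + emeasure \<rho>1 S"
proof -
  interpret pair_sigma_finite \<Pi>n Q ..
  have [measurable]: "(\<lambda>x. ennreal (f UNIV x)) \<in> borel_measurable \<Pi>n" by measurable
  have [measurable]: "(\<lambda>(x, \<omega>). ennreal (W UNIV x \<omega>) * indicator S (vec x)) \<in> borel_measurable (\<Pi>n \<Otimes>\<^sub>M Q)"
    unfolding split_beta' by measurable
  have fW: "2 * ennreal (f UNIV x) = 1 + (\<integral>\<^sup>+ \<omega>. ennreal (W UNIV x \<omega>) \<partial>Q)" for x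
  proof -
    have "2 * ennreal (f UNIV x) = ennreal (2 * f UNIV x)"
      using f_ge[of UNIV x] by (subst ennreal_mult) auto
    also have "2 * f UNIV x = 1 + (\<integral>\<omega>. W UNIV x \<omega> \<partial>Q)" by (simp add: f_def)
    also have "ennreal \<dots> = 1 + ennreal (\<integral>\<omega>. W UNIV x \<omega> \<partial>Q)"
      by (subst ennreal_plus) (auto simp: W_nonneg)
    also have "ennreal (\<integral>\<omega>. W UNIV x \<omega> \<partial>Q) = (\<integral>\<^sup>+ \<omega>. ennreal (W UNIV x \<omega>) \<partial>Q)"
      by (rule nn_integral_eq_integral[symmetric]) (auto simp: W_integrable W_nonneg)
    finally show ?thesis .
  qed
  have "2 * emeasure (distr (density \<Pi>n (\<lambda>x. ennreal (f UNIV x))) borel vec) S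
      = 2 * (\<integral>\<^sup>+ x. indicator S (vec x) \<partial>density \<Pi>n (\<lambda>x. ennreal (f UNIV x)))"
    by (simp flip: nn_integral_indicator add: nn_integral_distr)
  also have "\<dots> = (\<integral>\<^sup>+ x. 2 * (ennreal (f UNIV x) * indicator S (vec x)) \<partial>\<Pi>n)"
    by (subst nn_integral_density) (auto simp: nn_integral_cmult)
  also have "\<dots> = (\<integral>\<^sup>+ x. indicator S (vec x) + (\<integral>\<^sup>+ \<omega>. ennreal (W UNIV x \<omega>) * indicator S (vec x) \<partial>Q) \<partial>\<Pi>n)"
    by (intro nn_integral_cong, subst nn_integral_multc)
      (auto simp: mult.assoc[symmetric] fW distrib_right)
  also have "\<dots> = (\<integral>\<^sup>+ x. indicator S (vec x) \<partial>\<Pi>n) + (\<integral>\<^sup>+ x. (\<integral>\<^sup>+ \<omega>. ennreal (W UNIV x \<omega>) * indicator S (vec x) \<partial>Q) \<partial>\<Pi>n)"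
    by (rule nn_integral_add) measurable
  also have "(\<integral>\<^sup>+ x. (\<integral>\<^sup>+ \<omega>. ennreal (W UNIV x \<omega>) * indicator S (vec x) \<partial>Q) \<partial>\<Pi>n)
      = (\<integral>\<^sup>+ \<omega>. (\<integral>\<^sup>+ x. ennreal (W UNIV x \<omega>) * indicator S (vec x) \<partial>\<Pi>n) \<partial>Q)"
    by (rule Fubini'[symmetric]) measurable
  also have "\<dots> = (\<integral>\<^sup>+ \<omega>. \<integral>\<^sup>+ u. indicator S (vec (\<lambda>i. Y i \<omega>) + vec u) \<partial>\<Pi>a \<partial>Q)"
    by (intro nn_integral_cong W_shift S)
  also have "\<dots> = emeasure \<rho>1 S"
    using nn_integral_\<rho>1[of "indicator S"] S by (simp add: \<rho>1_def)
  finally show ?thesis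
    by (simp flip: nn_integral_indicator add: nn_integral_distr)
qed

lemma W2_trivial:
  "W2 (distr \<Pi>n borel vec) \<rho>1 \<le> ennreal (sqrt (\<Sum>i\<in>UNIV. (sqrt (v i) - sqrt (v i - s i))\<^sup>2 + (\<integral>\<omega>. (Y i \<omega>)\<^sup>2 \<partial>Q)))"
proof -
  interpret A: prob_space \<Pi>a by (rule prob_\<Pi>a)
  interpret QP: pair_prob_space Q \<Pi>n ..
  define c where "c i = sqrt ((v i - s i) / v i)" for i
  have cpos: "0 < c i" for i using a_pos[of i] v_pos[of i] by (simp add: c_def)
  have dt: "distr (\<gamma> i) borel (\<lambda>z. 0 + c i * z) = \<gamma>a i" for i
  proof -
    have "c i * sqrt (v i) = sqrt (v i - s i)"
      unfolding c_def using a_pos[of i] v_pos[of i] by (simp add: real_sqrt_divide)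
    then show ?thesis
      using distr_normal_affine[of "sqrt (v i)" "c i" 0 0] v_pos[of i] cpos[of i] by simp
  qed
  have d: "distr \<Pi>n \<Pi>a (\<lambda>x i. 0 + c i * x i) = \<Pi>a"
    and dm: "(\<lambda>x i. 0 + c i * x i) \<in> measurable \<Pi>n \<Pi>a"
    by (rule distr_PiM_coordinatewise[of \<gamma> \<gamma>a "\<lambda>i z. 0 + c i * z", OF prob_\<gamma> prob_\<gamma>a _ _ _ dt]; simp)+
  define h where "h = (\<lambda>x i. c i * x i)"
  have hm[measurable]: "h \<in> measurable \<Pi>n \<Pi>a" using dm by (simp add: h_def)
  have hd: "distr \<Pi>n \<Pi>a h = \<Pi>a" using d by (simp add: h_def)
  have [measurable]: "(\<lambda>p. snd p i) \<in> borel_measurable (Q \<Otimes>\<^sub>M \<Pi>n)" for i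
    using measurable_compose[OF measurable_snd measurable_component_singleton[of i UNIV \<gamma>]] by simp
  have [measurable]: "(\<lambda>p. Y i (fst p)) \<in> borel_measurable (Q \<Otimes>\<^sub>M \<Pi>n)" for i
    by (rule measurable_compose[OF measurable_fst Y_meas])
  have r1: "\<rho>1 = distr (Q \<Otimes>\<^sub>M \<Pi>n) borel (\<lambda>p. vec (\<lambda>i. Y i (fst p)) + vec (h (snd p)))"
  proof (rule measure_eqI)
    fix S assume "S \<in> sets \<rho>1"
    then have S[measurable]: "S \<in> sets borel" by (simp add: \<rho>1_def)
    have "emeasure \<rho>1 S = (\<integral>\<^sup>+ \<omega>. \<integral>\<^sup>+ u. indicator S (vec (\<lambda>i. Y i \<omega>) + vec u) \<partial>\<Pi>a \<partial>Q)"
      using nn_integral_\<rho>1[of "indicator S"] S by (simp add: \<rho>1_def)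
    also have "\<dots> = (\<integral>\<^sup>+ \<omega>. \<integral>\<^sup>+ x. indicator S (vec (\<lambda>i. Y i \<omega>) + vec (h x)) \<partial>\<Pi>n \<partial>Q)"
      by (intro nn_integral_cong, subst (1) hd[symmetric], subst nn_integral_distr) auto
    also have "\<dots> = (\<integral>\<^sup>+ p. indicator S (vec (\<lambda>i. Y i (fst p)) + vec (h (snd p))) \<partial>(Q \<Otimes>\<^sub>M \<Pi>n))"
      by (subst P.nn_integral_fst[symmetric]) auto
    also have "\<dots> = emeasure (distr (Q \<Otimes>\<^sub>M \<Pi>n) borel (\<lambda>p. vec (\<lambda>i. Y i (fst p)) + vec (h (snd p)))) S"
      by (simp flip: nn_integral_indicator add: nn_integral_distr)
    finally show "emeasure \<rho>1 S = emeasure (distr (Q \<Otimes>\<^sub>M \<Pi>n) borel (\<lambda>p. vec (\<lambda>i. Y i (fst p)) + vec (h (snd p)))) S" .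
  qed (simp add: \<rho>1_def)
  have r0: "distr \<Pi>n borel vec = distr (Q \<Otimes>\<^sub>M \<Pi>n) borel (\<lambda>p. vec (snd p))"
  proof (rule measure_eqI)
    fix S assume "S \<in> sets (distr \<Pi>n borel vec)"
    then have S[measurable]: "S \<in> sets borel" by simp
    have "emeasure (distr (Q \<Otimes>\<^sub>M \<Pi>n) borel (\<lambda>p. vec (snd p))) S = (\<integral>\<^sup>+ p. indicator S (vec (snd p)) \<partial>(Q \<Otimes>\<^sub>M \<Pi>n))"
      by (simp flip: nn_integral_indicator add: nn_integral_distr)
    also have "\<dots> = (\<integral>\<^sup>+ \<omega>. \<integral>\<^sup>+ x. indicator S (vec x) \<partial>\<Pi>n \<partial>Q)"
      by (subst P.nn_integral_fst[symmetric]) auto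
    also have "\<dots> = emeasure (distr \<Pi>n borel vec) S"
      by (simp flip: nn_integral_indicator add: nn_integral_distr Q.emeasure_space_1)
    finally show "emeasure (distr \<Pi>n borel vec) S = emeasure (distr (Q \<Otimes>\<^sub>M \<Pi>n) borel (\<lambda>p. vec (snd p))) S" ..
  qed simp
  have Y2: "integrable Q (\<lambda>\<omega>. (Y i \<omega>)\<^sup>2)" for i
    using power_mono[OF Y_bound abs_ge_zero, of _ _ 2] by (intro Q.integrable_const_bound[where B="C\<^sup>2"]) auto
  have inner: "(\<integral>\<^sup>+ x. ennreal ((x i - (Y i \<omega> + c i * x i))\<^sup>2) \<partial>\<Pi>n) = ennreal ((sqrt (v i) - sqrt (v i - s i))\<^sup>2 + (Y i \<omega>)\<^sup>2)" for i \<omega>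
  proof -
    have "(\<integral>\<^sup>+ x. ennreal ((x i - (Y i \<omega> + c i * x i))\<^sup>2) \<partial>\<Pi>n) = (\<integral>\<^sup>+ x. \<integral>\<^sup>+ z. ennreal ((z - (Y i \<omega> + c i * z))\<^sup>2) \<partial>\<gamma> i \<partial>\<Pi>n)"
      using measurable_component_singleton[of i UNIV \<gamma>] by (subst resample[where i=i]) auto
    also have "\<dots> = (\<integral>\<^sup>+ z. ennreal ((z - (Y i \<omega> + c i * z))\<^sup>2) \<partial>\<gamma> i)"
      by (simp add: P.emeasure_space_1[simplified])
    also have "\<dots> = (\<integral>\<^sup>+ z. ennreal (nd i z * ((- Y i \<omega> - (c i - 1) * (z - 0)) * (- Y i \<omega> - (c i - 1) * (z - 0)))) \<partial>lborel)"
    proof -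
      have "(z - (Y i \<omega> + c i * z))\<^sup>2 = (- Y i \<omega> - (c i - 1) * (z - 0)) * (- Y i \<omega> - (c i - 1) * (z - 0))" for z
        by (simp add: power2_eq_square algebra_simps)
      then show ?thesis
        by (subst nn_integral_density) (auto simp: ennreal_mult' simp del: diff_0_right)
    qed
    also have "\<dots> = ennreal ((- Y i \<omega>) * (- Y i \<omega>) + (c i - 1) * (c i - 1) * (sqrt (v i))\<^sup>2)"
      using integral_quadratic_normal[of "sqrt (v i)" 0 "- Y i \<omega>" "c i - 1" "- Y i \<omega>" "c i - 1"] v_pos[of i]
      by (subst nn_integral_eq_integral) (auto simp: has_bochner_integral_iff)
    also have "(- Y i \<omega>) * (- Y i \<omega>) + (c i - 1) * (c i - 1) * (sqrt (v i))\<^sup>2 = (sqrt (v i) - c i * sqrt (v i))\<^sup>2 + (Y i \<omega>)\<^sup>2"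
      by (simp add: power2_eq_square algebra_simps)
    also have "c i * sqrt (v i) = sqrt (v i - s i)"
      unfolding c_def using a_pos[of i] v_pos[of i] by (simp add: real_sqrt_divide)
    finally show ?thesis .
  qed
  let ?B = "\<Sum>i\<in>UNIV. (sqrt (v i) - sqrt (v i - s i))\<^sup>2 + (\<integral>\<omega>. (Y i \<omega>)\<^sup>2 \<partial>Q)"
  have "(\<integral>\<^sup>+ p. ennreal ((norm (vec (snd p) - (vec (\<lambda>i. Y i (fst p)) + vec (h (snd p)))))\<^sup>2) \<partial>(Q \<Otimes>\<^sub>M \<Pi>n))
      = (\<integral>\<^sup>+ p. (\<Sum>i\<in>UNIV. ennreal ((snd p i - (Y i (fst p) + c i * snd p i))\<^sup>2)) \<partial>(Q \<Otimes>\<^sub>M \<Pi>n))"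
    unfolding vec_add[symmetric] vec_diff norm_vec h_def by (simp add: sum_ennreal)
  also have "\<dots> = (\<Sum>i\<in>UNIV. (\<integral>\<^sup>+ p. ennreal ((snd p i - (Y i (fst p) + c i * snd p i))\<^sup>2) \<partial>(Q \<Otimes>\<^sub>M \<Pi>n)))"
    by (rule nn_integral_sum) measurable
  also have "\<dots> = (\<Sum>i\<in>UNIV. \<integral>\<^sup>+ \<omega>. ennreal ((sqrt (v i) - sqrt (v i - s i))\<^sup>2 + (Y i \<omega>)\<^sup>2) \<partial>Q)"
    by (intro sum.cong refl, subst P.nn_integral_fst[symmetric]) (auto simp: inner)
  also have "\<dots> = (\<Sum>i\<in>UNIV. ennreal ((sqrt (v i) - sqrt (v i - s i))\<^sup>2 + (\<integral>\<omega>. (Y i \<omega>)\<^sup>2 \<partial>Q)))"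
    using Y2 by (intro sum.cong refl, subst nn_integral_eq_integral) (auto simp: Q.prob_space)
  also have "\<dots> = ennreal ?B"
    by (rule sum_ennreal) auto
  also have "\<dots> = ennreal ((sqrt ?B)\<^sup>2)"
    by (subst real_sqrt_pow2) (auto intro!: sum_nonneg add_nonneg_nonneg)
  finally show ?thesis
    unfolding r0 r1 by (intro W2_distr_le QP.prob_space_axioms) (auto intro!: sum_nonneg add_nonneg_nonneg)
qed

lemma W2_energy: "W2 (distr \<Pi>n borel vec) \<rho>1 \<le> ennreal ((2 + sqrt 2) * sqrt (energy / 2))"
proof (rule W2_bootstrap)
  have e0: "0 \<le> energy"
    unfolding energy_sum using D_energy(2) by (intro sum_nonneg mult_nonneg_nonneg) auto
  then show "0 \<le> sqrt (energy / 2)" by simp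
  show "W2 (distr \<Pi>n borel vec) \<rho>1 \<noteq> \<top>"
    using W2_trivial by (auto simp: top_unique)
  obtain T where T[measurable]: "T \<in> measurable \<Pi>n \<Pi>n" and Td: "distr \<Pi>n \<Pi>n T = density \<Pi>n (\<lambda>x. ennreal (f UNIV x))"
    and c: "(\<integral>\<^sup>+ x. ennreal (\<Sum>i\<in>UNIV. (T x i - x i)\<^sup>2) \<partial>\<Pi>n) \<le> ennreal (energy / 2)"
    using transport_to_mixture by blast
  have "W2 (distr \<Pi>n borel vec) (distr \<Pi>n borel (\<lambda>x. vec (T x))) \<le> ennreal (sqrt (energy / 2))"
    using c e0 P.prob_space_axioms
    by (intro W2_distr_le) (auto simp: vec_diff norm_vec power2_commute)
  also have "distr \<Pi>n borel (\<lambda>x. vec (T x)) = distr (distr \<Pi>n \<Pi>n T) borel vec"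
    by (simp add: distr_distr comp_def)
  finally show "W2 (distr \<Pi>n borel vec) (distr (density \<Pi>n (\<lambda>x. ennreal (f UNIV x))) borel vec) \<le> ennreal (sqrt (energy / 2))"
    unfolding Td .
qed (auto simp: mixture_midpoint)

end

section \<open>Estimating the energy\<close>

text \<open>The range \<open>9/25\<close> is the one in \<open>t_bound\<close>. In the quadratic
  bound the coefficient \<open>1/2\<close> grows by the cubic remainder, which is at most
  \<open>(3/2) * (9/25) / 6 = 9/100\<close>, and the sum is rounded up to
  \<open>3/5\<close>.\<close>

lemma exp_taylor_bounds:
  fixes t :: real
  assumes "\<bar>t\<bar> \<le> 9/25"
  shows "exp t \<le> 36/25" "0 \<le> exp t - 1 - t" "exp t - 1 - t \<le> 3/5 * t\<^sup>2" "\<bar>exp t - 1\<bar> \<le> 11/25"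
proof -
  have crude: "exp z \<le> 3/2" if "\<bar>z\<bar> \<le> 9/25" for z :: real
  proof -
    have "exp z \<le> exp (9/25)" using that by simp
    also have "\<dots> \<le> 1 + 9/25 + (9/25)\<^sup>2" by (rule exp_bound) auto
    also have "\<dots> \<le> 3/2" by (simp add: power2_eq_square)
    finally show ?thesis .
  qed
  obtain z where z: "\<bar>z\<bar> \<le> \<bar>t\<bar>" and exp_t: "exp t = (\<Sum>m<3. t ^ m / fact m) + exp z / fact 3 * t ^ 3"
    using Maclaurin_exp_le[of t 3] by auto
  have eq: "exp t = 1 + t + t\<^sup>2 / 2 + exp z * t ^ 3 / 6"
    using exp_t by (simp add: eval_nat_numeral fact_numeral)
  have "exp z * t ^ 3 \<le> 3/2 * (t\<^sup>2 * \<bar>t\<bar>)"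
  proof -
    have "exp z * t ^ 3 \<le> exp z * (t\<^sup>2 * \<bar>t\<bar>)"
      by (intro mult_left_mono) (auto simp: power3_eq_cube power2_eq_square intro!: mult_left_mono)
    also have "\<dots> \<le> 3/2 * (t\<^sup>2 * \<bar>t\<bar>)"
      using crude[of z] z assms by (intro mult_right_mono) auto
    finally show ?thesis .
  qed
  also have "\<dots> \<le> 3/2 * (t\<^sup>2 * (9/25))"
    using assms by (intro mult_left_mono) auto
  finally have "exp z * t ^ 3 / 6 \<le> 9/100 * t\<^sup>2" by simp
  then show up: "exp t - 1 - t \<le> 3/5 * t\<^sup>2" using eq zero_le_power2[of t] by linarith
  show lo: "0 \<le> exp t - 1 - t" using exp_ge_add_one_self[of t] by linarith
  have "t\<^sup>2 \<le> (9/25)\<^sup>2" using power_mono[OF assms abs_ge_zero, of 2] by simp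
  then show "exp t \<le> 36/25" using up assms by (simp add: power2_eq_square)
  then show "\<bar>exp t - 1\<bar> \<le> 11/25" using lo assms unfolding abs_le_iff by linarith
qed

text \<open>The products of \<open>U\<close> and \<open>R - V - V'\<close> with \<open>1\<close>, \<open>t\<close> and \<open>exp (- h)\<close> are kept because
  their expectations are known; everything else is of second order.\<close>

lemma energy_pointwise:
  fixes U V V' R t h h' \<kappa> b x :: real
  assumes t: "\<bar>t\<bar> \<le> 9/25" and U: "\<bar>U\<bar> \<le> 7/6 * b" and V: "0 \<le> V" "0 \<le> V'" "V + V' \<le> b / 2"
    and R: "0 \<le> R" "R \<le> 6/25 * b" and h: "0 \<le> h" "0 \<le> h'" "h' \<le> 1/25"
    and \<kappa>: "1 \<le> \<kappa>" "\<kappa> \<le> 103/100" "\<kappa> - 1 \<le> x"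
  shows "(U - V - V' + R) * (\<kappa> * exp (t - h - h'))
    \<le> b * (844/1000 * t\<^sup>2 + 1234/1000 * (x + h + h') + 1/20 * h)
      + (U + U * t + (R - V - V') + (R - V - V') * t + \<kappa> * (U * exp (- h)) + \<kappa> * (U * exp (- h')) - (\<kappa> + 1) * U)"
proof -
  define E where "E = exp t"
  define e2 where "e2 = E - 1 - t"
  define g where "g = exp (- h)"
  define g' where "g' = exp (- h')"
  \<comment> \<open>The deviation from \<open>1\<close> of the kernel without its factor
    \<open>exp t\<close>.\<close>
  define X where "X = \<kappa> * g * g' - 1"
  define W where "W = R - V - V'"
  have b: "0 \<le> b" using V by linarith
  note E = exp_taylor_bounds[OF t, folded E_def, folded e2_def]
  have Epos: "0 < E" by (simp add: E_def)
  have gb: "0 \<le> 1 - exp (- y)" "1 - exp (- y) \<le> y" "0 < exp (- y)" if "0 \<le> y" for y :: real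
    using that exp_ge_add_one_self[of "- y"] by simp_all
  note g = gb[OF h(1), folded g_def] gb[OF h(2), folded g'_def]
  have gg: "0 \<le> 1 - g * g'" "1 - g * g' \<le> h + h'"
  proof -
    have "g * g' = exp (- (h + h'))" by (simp add: g_def g'_def exp_add[symmetric])
    then show "0 \<le> 1 - g * g'" "1 - g * g' \<le> h + h'"
      using gb[of "h + h'"] h by simp_all
  qed
  have X: "\<bar>X\<bar> \<le> x + h + h'"
  proof -
    define A where "A = (\<kappa> - 1) * (g * g')"
    define B where "B = 1 - g * g'"
    have "X = A - B" by (simp add: X_def A_def B_def algebra_simps)
    moreover have "0 \<le> A" "A \<le> \<kappa> - 1"
      unfolding A_def using \<kappa> g gg mult_left_mono[of "g * g'" 1 "\<kappa> - 1"] by auto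
    ultimately show ?thesis using gg[folded B_def] \<kappa> by linarith
  qed
  have W: "\<bar>W\<bar> \<le> b / 2" using V R b unfolding W_def by linarith
  have "exp (t - h - h') = E * g * g'" by (simp add: E_def g_def g'_def exp_add[symmetric])
  then have "(U - V - V' + R) * (\<kappa> * exp (t - h - h')) = (U + W) * E * (1 + X)"
    by (simp add: X_def W_def algebra_simps)
  also have "\<dots> = (U + U * t + W + W * t) + U * e2 + W * e2 + U * X + U * (E - 1) * X + W * E * X"
    by (simp add: e2_def algebra_simps)
  \<comment> \<open>Only the product \<open>(1 - g) * (1 - g')\<close> involves both copies and is
    estimated. In the remaining terms \<open>U\<close> is multiplied by a constant or by a function
    of one copy, and their expectations vanish.\<close>
  also have "U * X = \<kappa> * U * (1 - g) * (1 - g') + (\<kappa> * (U * g) + \<kappa> * (U * g') - (\<kappa> + 1) * U)"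
    by (simp add: X_def algebra_simps)
  finally have eq: "(U - V - V' + R) * (\<kappa> * exp (t - h - h'))
    = (U * e2 + W * e2 + \<kappa> * U * (1 - g) * (1 - g') + U * (E - 1) * X + W * E * X)
     + (U + U * t + W + W * t + \<kappa> * (U * g) + \<kappa> * (U * g') - (\<kappa> + 1) * U)"
    by simp
  have "U * e2 \<le> (7/6 * b) * (3/5 * t\<^sup>2)"
    using U E b by (intro mult_mono) auto
  \<comment> \<open>Since \<open>e2\<close> is nonnegative, an upper bound of \<open>W\<close>
    suffices here, and \<open>W \<le> R\<close> discards \<open>V\<close> and
    \<open>V'\<close>.\<close>
  moreover have "W * e2 \<le> (6/25 * b) * (3/5 * t\<^sup>2)"
    using R V E b by (intro mult_mono) (auto simp: W_def)
  moreover have "\<kappa> * U * (1 - g) * (1 - g') \<le> 103/100 * (7/6 * b) * h * (1/25)"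
  proof -
    have "\<kappa> * U * (1 - g) * (1 - g') \<le> \<kappa> * \<bar>U\<bar> * (1 - g) * (1 - g')"
      using \<kappa> g by (intro mult_right_mono mult_left_mono) auto
    also have "\<dots> \<le> 103/100 * (7/6 * b) * h * (1/25)"
      using \<kappa> U g h b by (intro mult_mono mult_nonneg_nonneg) auto
    finally show ?thesis .
  qed
  moreover have "U * (E - 1) * X \<le> (7/6 * b) * (11/25) * (x + h + h')"
  proof -
    have "U * (E - 1) * X \<le> \<bar>U * (E - 1) * X\<bar>" by simp
    also have "\<dots> = \<bar>U\<bar> * \<bar>E - 1\<bar> * \<bar>X\<bar>" by (simp add: abs_mult)
    also have "\<dots> \<le> (7/6 * b) * (11/25) * (x + h + h')"
      using U E X b by (intro mult_mono mult_nonneg_nonneg) auto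
    finally show ?thesis .
  qed
  moreover have "W * E * X \<le> (b / 2) * (36/25) * (x + h + h')"
  proof -
    have "W * E * X \<le> \<bar>W * E * X\<bar>" by simp
    also have "\<dots> = \<bar>W\<bar> * E * \<bar>X\<bar>" using Epos by (simp add: abs_mult)
    also have "\<dots> \<le> (b / 2) * (36/25) * (x + h + h')"
      using W E X b Epos by (intro mult_mono mult_nonneg_nonneg) auto
    finally show ?thesis .
  qed
  \<comment> \<open>The coefficient of \<open>t\<^sup>2\<close> is
    \<open>7/6 * 3/5 + 6/25 * 3/5\<close>; that of \<open>x + h + h'\<close> is
    \<open>7/6 * 11/25 + 1/2 * 36/25\<close> rounded up, and \<open>1/20\<close> is
    \<open>103/100 * 7/6 * 1/25\<close> rounded up.\<close>
  moreover have "(7/6 * b) * (3/5 * t\<^sup>2) + (6/25 * b) * (3/5 * t\<^sup>2) + 103/100 * (7/6 * b) * h * (1/25)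
     + (7/6 * b) * (11/25) * (x + h + h') + (b / 2) * (36/25) * (x + h + h')
     \<le> b * (844/1000 * t\<^sup>2 + 1234/1000 * (x + h + h') + 1/20 * h)"
  proof -
    have "0 \<le> b * t\<^sup>2" "0 \<le> b * h" "0 \<le> b * (x + h + h')"
      using b h X abs_ge_zero[of X] by (auto intro!: mult_nonneg_nonneg)
    moreover have "(7/6 * b) * (3/5 * t\<^sup>2) + (6/25 * b) * (3/5 * t\<^sup>2) + 103/100 * (7/6 * b) * h * (1/25)
     + (7/6 * b) * (11/25) * (x + h + h') + (b / 2) * (36/25) * (x + h + h')
      = 844/1000 * (b * t\<^sup>2) + 721/15000 * (b * h) + 37/30 * (b * (x + h + h'))"
      by (simp add: distrib_left)
    moreover have "b * (844/1000 * t\<^sup>2 + 1234/1000 * (x + h + h') + 1/20 * h)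
      = 844/1000 * (b * t\<^sup>2) + 1/20 * (b * h) + 1234/1000 * (b * (x + h + h'))"
      by (simp add: distrib_left)
    ultimately show ?thesis by linarith
  qed
  ultimately show ?thesis unfolding eq W_def g_def g'_def by linarith
qed


lemma (in pair_prob_space) has_bochner_integral_times:
  fixes a :: "'a \<Rightarrow> real" and b :: "'b \<Rightarrow> real"
  assumes a: "integrable M1 a" and b: "integrable M2 b"
  shows "has_bochner_integral (M1 \<Otimes>\<^sub>M M2) (\<lambda>p. a (fst p) * b (snd p)) ((\<integral>x. a x \<partial>M1) * (\<integral>y. b y \<partial>M2))"
proof -
  note [measurable] = borel_measurable_integrable[OF a] borel_measurable_integrable[OF b]
  have int: "integrable (M1 \<Otimes>\<^sub>M M2) (\<lambda>p. a (fst p) * b (snd p))"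
  proof (rule Fubini_integrable)
    show "integrable M1 (\<lambda>x. \<integral>y. norm (a (fst (x, y)) * b (snd (x, y))) \<partial>M2)"
      using a b by (simp add: abs_mult)
    show "AE x in M1. integrable M2 (\<lambda>y. a (fst (x, y)) * b (snd (x, y)))"
      using b by simp
  qed measurable
  then show ?thesis
    using integral_fst'[OF int] by (simp add: has_bochner_integral_iff)
qed

text \<open>The termwise bound \<open>\<bar>a i * b i\<bar> \<le> ((a i)\<^sup>2 + (b i)\<^sup>2) /
  2\<close> covers the forms in two copies of \<open>Y\<close> and those in one copy alike.\<close>

lemma sum_products_le:
  fixes a b :: "'i::finite \<Rightarrow> real"
  assumes "(\<Sum>i\<in>UNIV. (a i)\<^sup>2) \<le> B" "(\<Sum>i\<in>UNIV. (b i)\<^sup>2) \<le> B" "\<And>i. \<bar>c i\<bar> \<le> K" "0 \<le> K"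
  shows "\<bar>\<Sum>i\<in>UNIV. c i * (a i * b i)\<bar> \<le> K * B"
proof -
  have "\<bar>\<Sum>i\<in>UNIV. c i * (a i * b i)\<bar> \<le> (\<Sum>i\<in>UNIV. \<bar>c i * (a i * b i)\<bar>)" by (rule sum_abs)
  also have "\<dots> \<le> (\<Sum>i\<in>UNIV. K * (((a i)\<^sup>2 + (b i)\<^sup>2) / 2))"
  proof (rule sum_mono)
    fix i
    have "\<bar>a i * b i\<bar> \<le> ((a i)\<^sup>2 + (b i)\<^sup>2) / 2"
      using sum_squares_bound[of "\<bar>a i\<bar>" "\<bar>b i\<bar>"] by (simp add: abs_mult)
    then show "\<bar>c i * (a i * b i)\<bar> \<le> K * (((a i)\<^sup>2 + (b i)\<^sup>2) / 2)"
      unfolding abs_mult[of "c i"] using assms(3,4) by (intro mult_mono) auto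
  qed
  also have "\<dots> = K * (((\<Sum>i\<in>UNIV. (a i)\<^sup>2) + (\<Sum>i\<in>UNIV. (b i)\<^sup>2)) / 2)"
    by (simp add: sum_distrib_left[symmetric] sum_divide_distrib[symmetric] sum.distrib)
  also have "\<dots> \<le> K * B" using assms by (intro mult_left_mono) auto
  finally show ?thesis .
qed

text \<open>The number \<open>\<nu>\<close> is \<open>m + 1\<close>: it counts the Gaussian summands
  contained in \<open>v\<close>, including the one about to be replaced by \<open>Y\<close>.\<close>

locale bounded_summand = normal_shift v Q s Y C
  for v :: "'i::finite \<Rightarrow> real" and Q :: "'w measure" and s Y C +
  fixes \<beta> \<nu> :: real
  assumes \<beta>: "0 < \<beta>" and \<nu>: "1 \<le> \<nu>" and v_eq: "\<And>i. v i = 3 * \<beta>\<^sup>2 + \<nu> * s i"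
    and Y_sq: "\<And>\<omega>. (\<Sum>i\<in>UNIV. (Y i \<omega>)\<^sup>2) \<le> \<beta>\<^sup>2"
    and Y_mean: "\<And>i. (\<integral>\<omega>. Y i \<omega> \<partial>Q) = 0"
    and Y_cov: "\<And>i j. (\<integral>\<omega>. Y i \<omega> * Y j \<omega> \<partial>Q) = (if i = j then s i else 0)"
begin

section \<open>Size of the covariance relative to the total variance\<close>

lemma Y_int: "integrable Q (Y i)"
  using Y_bound by (intro Q.integrable_const_bound[where B=C]) auto

lemma YY_int: "integrable Q (\<lambda>\<omega>. Y i \<omega> * Y j \<omega>)"
proof (rule Q.integrable_const_bound[where B="C * C"])
  have "0 \<le> C" using Y_bound[of undefined undefined] by linarith
  then show "AE \<omega> in Q. norm (Y i \<omega> * Y j \<omega>) \<le> C * C"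
    unfolding real_norm_def abs_mult by (intro AE_I2 mult_mono Y_bound) auto
qed simp

lemma s_sum: "(\<Sum>i\<in>UNIV. s i) \<le> \<beta>\<^sup>2"
proof -
  have "(\<Sum>i\<in>UNIV. s i) = (\<integral>\<omega>. (\<Sum>i\<in>UNIV. Y i \<omega> * Y i \<omega>) \<partial>Q)"
    using YY_int by (subst Bochner_Integration.integral_sum) (auto simp: Y_cov)
  also have "\<dots> \<le> (\<integral>\<omega>. \<beta>\<^sup>2 \<partial>Q)"
    using Y_sq YY_int by (intro integral_mono) (auto simp: power2_eq_square)
  finally show ?thesis by (simp add: Q.prob_space)
qed

lemma s_le: "s i \<le> \<beta>\<^sup>2"
  using s_sum member_le_sum[of i UNIV s] s_nonneg by force

text \<open>\<open>r i\<close> is the correlation in the Mehler kernel. From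
  \<open>s i \<le> \<beta>\<^sup>2\<close> follows \<open>(\<nu> + 3) * s i \<le> v i\<close>, that
  is \<open>r i \<le> \<epsilon>\<close>. The sum of the squares of all \<open>r i\<close> is at
  most \<open>DD\<close>, and the bound to be proved for one step is
  \<open>5 * \<beta> * sqrt DD\<close>.\<close>

definition \<epsilon> where "\<epsilon> = 1 / (\<nu> + 3)"
definition DD where "DD = real CARD('i) * \<epsilon>\<^sup>2"
definition r where "r i = s i / v i"
definition q where "q i = 1 - (r i)\<^sup>2"

lemma \<epsilon>_pos: "0 < \<epsilon>" using \<nu> by (simp add: \<epsilon>_def)

lemma r_bounds: "0 \<le> r i" "r i \<le> \<epsilon>"
proof -
  show "0 \<le> r i" using s_nonneg v_pos[of i] by (simp add: r_def)
  have "(\<nu> + 3) * s i \<le> v i" unfolding v_eq using s_le[of i] by (simp add: algebra_simps)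
  then show "r i \<le> \<epsilon>" unfolding r_def \<epsilon>_def using v_pos[of i] \<nu> by (simp add: field_simps)
qed

lemma v_ge: "3 * \<beta>\<^sup>2 \<le> v i" using \<nu> s_nonneg[of i] by (simp add: v_eq)

lemma \<epsilon>_le_DD: "\<epsilon>\<^sup>2 \<le> DD"
proof -
  have "1 * \<epsilon>\<^sup>2 \<le> real CARD('i) * \<epsilon>\<^sup>2" by (intro mult_right_mono) (auto simp: Suc_leI)
  then show ?thesis by (simp add: DD_def)
qed

lemma DD_nonneg: "0 \<le> DD" by (simp add: DD_def)

lemma r2_sum: "(\<Sum>i\<in>UNIV. (r i)\<^sup>2) \<le> DD"
proof -
  have "(\<Sum>i\<in>UNIV. (r i)\<^sup>2) \<le> (\<Sum>i\<in>(UNIV::'i set). \<epsilon>\<^sup>2)"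
    using r_bounds by (intro sum_mono power_mono) auto
  then show ?thesis by (simp add: DD_def)
qed

text \<open>The threshold \<open>1/20\<close> is where the direct coupling takes over: its squared
  cost is at most \<open>5/4 * \<beta>\<^sup>2\<close>, which is
  \<open>25 * \<beta>\<^sup>2 * DD\<close> at \<open>DD = 1/20\<close>. Below the threshold
  \<open>\<epsilon> \<le> 9/40\<close> and all \<open>q i\<close> are at least
  \<open>19/20\<close>.\<close>

context
  assumes small: "DD \<le> 1/20"
begin

lemma \<epsilon>_le: "\<epsilon> \<le> 9/40"
proof (rule ccontr)
  assume "\<not> \<epsilon> \<le> 9/40"
  then have "(9/40)\<^sup>2 < \<epsilon>\<^sup>2" by (intro power_strict_mono) auto
  then show False using \<epsilon>_le_DD small by (simp add: power2_eq_square)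
qed

lemma r2_le: "(r i)\<^sup>2 \<le> \<epsilon>\<^sup>2" "(r i)\<^sup>2 \<le> 1/20"
  using power_mono[OF r_bounds(2,1), of i 2] \<epsilon>_le_DD small by auto

lemma q_bounds: "19/20 \<le> q i" "q i \<le> 1" "0 < q i"
  using r2_le[of i] by (auto simp: q_def)

lemma inv_q: "1 / q i \<le> 20/19" "1 / (q i)\<^sup>2 \<le> 400/361" "1 / (q i)^3 \<le> 8000/6859"
proof -
  show *: "1 / q i \<le> 20/19" using q_bounds[of i] by (simp add: field_simps)
  have "0 \<le> 1 / q i" using q_bounds[of i] by simp
  from power_mono[OF * this, of 2] power_mono[OF * this, of 3]
  show "1 / (q i)\<^sup>2 \<le> 400/361" "1 / (q i)^3 \<le> 8000/6859" by (simp_all add: power_divide)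
qed

text \<open>Coefficients after substituting \<open>s = r * v\<close>: \<open>cd\<close> and
  \<open>ch\<close> belong to the exponent of \<open>K2\<close> (see \<open>K2_eq\<close>),
  \<open>ca\<close> and \<open>cv\<close> to \<open>(v i)\<^sup>2 * \<psi> i\<close> (see
  \<open>\<psi>_eq\<close>). The index \<open>i\<close> counts coordinates in which the covariance
  is diagonal.\<close>

definition ca where "ca i = (1 + (r i)\<^sup>2) / (q i)\<^sup>2"
definition cd where "cd i = 1 / (v i * q i)"
definition ch where "ch i = r i / (2 * v i * q i)"
definition cv where "cv i = r i / (q i)\<^sup>2"

lemma ca_bounds: "0 \<le> ca i" "ca i \<le> 7/6"
proof -
  show "0 \<le> ca i" by (simp add: ca_def)
  have "ca i = (1 + (r i)\<^sup>2) * (1 / (q i)\<^sup>2)" by (simp add: ca_def)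
  also have "\<dots> \<le> (1 + 1/20) * (400/361)" using r2_le[of i] inv_q[of i] by (intro mult_mono) auto
  finally show "ca i \<le> 7/6" by simp
qed

lemma cd_bounds: "0 \<le> cd i" "cd i \<le> 20 / (57 * \<beta>\<^sup>2)"
proof -
  show "0 \<le> cd i" using v_pos[of i] q_bounds[of i] by (simp add: cd_def)
  have "3 * \<beta>\<^sup>2 * (19/20) \<le> v i * q i" using v_ge[of i] q_bounds[of i] v_pos[of i] by (intro mult_mono) auto
  then have "cd i \<le> 1 / (3 * \<beta>\<^sup>2 * (19/20))" unfolding cd_def using \<beta> by (intro divide_left_mono) (auto intro!: mult_pos_pos v_pos q_bounds(3))
  then show "cd i \<le> 20 / (57 * \<beta>\<^sup>2)" by simp
qed

lemma ch_bounds: "0 \<le> ch i" "ch i \<le> 1 / (25 * \<beta>\<^sup>2)"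
proof -
  have ch: "ch i = r i / 2 * cd i" by (simp add: ch_def cd_def)
  show "0 \<le> ch i" unfolding ch using r_bounds cd_bounds by simp
  have "ch i \<le> (9/40) / 2 * (20 / (57 * \<beta>\<^sup>2))"
    unfolding ch using r_bounds[of i] cd_bounds[of i] \<epsilon>_le by (intro mult_mono) auto
  also have "\<dots> \<le> 1 / (25 * \<beta>\<^sup>2)" using \<beta> by (simp add: field_simps)
  finally show "ch i \<le> 1 / (25 * \<beta>\<^sup>2)" .
qed

lemma cv_bounds: "0 \<le> cv i" "cv i \<le> 1/4"
proof -
  have cv: "cv i = r i * (1 / (q i)\<^sup>2)" by (simp add: cv_def)
  show "0 \<le> cv i" unfolding cv using r_bounds[of i] by simp
  have "cv i \<le> (9/40) * (400/361)" unfolding cv using r_bounds[of i] inv_q[of i] \<epsilon>_le by (intro mult_mono) auto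
  then show "cv i \<le> 1/4" by simp
qed

text \<open>\<open>U\<close> and \<open>t\<close> are bilinear in the two copies of
  \<open>Y\<close>, while \<open>h\<close> and \<open>V\<close> are quadratic in a single copy; the
  vanishing expectations below rest on this distinction. \<open>R\<close> and
  \<open>\<kappa>\<close> are deterministic.\<close>

definition U where "U p = (\<Sum>i\<in>UNIV. ca i * (Y i (fst p) * Y i (snd p)))"
definition t where "t p = (\<Sum>i\<in>UNIV. cd i * (Y i (fst p) * Y i (snd p)))"
definition h where "h \<omega> = (\<Sum>i\<in>UNIV. ch i * (Y i \<omega> * Y i \<omega>))"
definition V where "V \<omega> = (\<Sum>i\<in>UNIV. cv i * (Y i \<omega> * Y i \<omega>))"
definition R where "R = (\<Sum>i\<in>UNIV. s i * r i / q i)"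
definition \<kappa> where "\<kappa> = (\<Prod>i\<in>UNIV. 1 / sqrt (q i))"

lemma v2s2_q: "(v i)\<^sup>2 - (s i)\<^sup>2 = (v i)\<^sup>2 * q i"
  using v_pos[of i] by (simp add: q_def r_def power_divide field_simps)

lemma K2_eq: "K2 i \<eta> \<eta>' = 1 / sqrt (q i) * exp (cd i * (\<eta> * \<eta>') - ch i * (\<eta> * \<eta>) - ch i * (\<eta>' * \<eta>'))"
proof -
  have pos: "0 < v i" "0 < q i" using v_pos q_bounds by auto
  have s: "s i = r i * v i" using pos by (simp add: r_def)
  have "v i / sqrt ((v i)\<^sup>2 - (s i)\<^sup>2) = 1 / sqrt (q i)"
    unfolding v2s2_q using pos by (simp add: real_sqrt_mult)
  moreover have "(v * \<eta> * \<eta>' - (r * v) * (\<eta>\<^sup>2 + \<eta>'\<^sup>2) / 2) / (v\<^sup>2 * q)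
     = 1 / (v * q) * (\<eta> * \<eta>') - r / (2 * v * q) * (\<eta> * \<eta>) - r / (2 * v * q) * (\<eta>' * \<eta>')" if "0 < v" "0 < q" for v q r :: real
    using that by (simp add: field_simps power2_eq_square)
  ultimately show ?thesis
    unfolding K2_def cd_def ch_def using pos v2s2_q[of i] s by simp
qed

lemma \<psi>_eq: "(v i)\<^sup>2 * \<psi> i \<eta> \<eta>' = ca i * (\<eta> * \<eta>') - cv i * (\<eta> * \<eta>) - cv i * (\<eta>' * \<eta>') + s i * r i / q i"
proof -
  have pos: "0 < v i" "0 < q i" using v_pos q_bounds by auto
  have "v\<^sup>2 * ((v * \<eta> - (r * v) * \<eta>') * (v * \<eta>' - (r * v) * \<eta>) / (v\<^sup>2 * q)\<^sup>2 + (r * v)\<^sup>2 / (v * (v\<^sup>2 * q)))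
     = (1 + r\<^sup>2) / q\<^sup>2 * (\<eta> * \<eta>') - r / q\<^sup>2 * (\<eta> * \<eta>) - r / q\<^sup>2 * (\<eta>' * \<eta>') + r * v * r / q" if "0 < v" "0 < q" for v q r :: real
  proof -
    have "(v * \<eta> - (r * v) * \<eta>') * (v * \<eta>' - (r * v) * \<eta>) = v\<^sup>2 * ((1 + r\<^sup>2) * (\<eta> * \<eta>') - r * (\<eta> * \<eta>) - r * (\<eta>' * \<eta>'))"
      by (simp add: power2_eq_square algebra_simps)
    moreover have "v\<^sup>2 * (v\<^sup>2 * Z / (v\<^sup>2 * q)\<^sup>2 + (r * v)\<^sup>2 / (v * (v\<^sup>2 * q))) = Z / q\<^sup>2 + r * v * r / q" for Z
      using that by (simp add: power2_eq_square field_simps)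
    ultimately show ?thesis by (simp add: diff_divide_distrib)
  qed
  from this[OF pos, of "r i"] show ?thesis
    unfolding \<psi>_def v2s2_q ca_def cv_def using pos by (simp add: r_def)
qed

lemma prod_K2: "(\<Prod>j\<in>UNIV. K2 j (Y j (fst p)) (Y j (snd p))) = \<kappa> * exp (t p - h (fst p) - h (snd p))"
  unfolding K2_eq prod.distrib \<kappa>_def t_def h_def
  by (simp add: exp_sum[symmetric] sum_subtractf)

lemma sum_\<psi>: "(\<Sum>i\<in>UNIV. (v i)\<^sup>2 * \<psi> i (Y i (fst p)) (Y i (snd p))) = U p - V (fst p) - V (snd p) + R"
  unfolding \<psi>_eq U_def V_def R_def by (simp add: sum.distrib sum_subtractf)

lemma U_bound: "\<bar>U p\<bar> \<le> 7/6 * \<beta>\<^sup>2"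
  unfolding U_def using Y_sq ca_bounds by (intro sum_products_le) auto

lemma t_bound: "\<bar>t p\<bar> \<le> 9/25"
proof -
  \<comment> \<open>The constant is \<open>1/3\<close>, from the smoothing in
    \<open>3 * \<beta>\<^sup>2 \<le> v i\<close>, times the bound \<open>20/19\<close> of
    \<open>1 / q i\<close>.\<close>
  have "\<bar>t p\<bar> \<le> 20 / (57 * \<beta>\<^sup>2) * \<beta>\<^sup>2"
    unfolding t_def using Y_sq cd_bounds \<beta> by (intro sum_products_le) auto
  also have "\<dots> = 20/57" using \<beta> by simp
  finally show ?thesis by simp
qed

lemma h_bound: "0 \<le> h \<omega>" "h \<omega> \<le> 1/25"
proof -
  show "0 \<le> h \<omega>" unfolding h_def by (intro sum_nonneg mult_nonneg_nonneg[OF ch_bounds(1) zero_le_square])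
  have "\<bar>h \<omega>\<bar> \<le> 1 / (25 * \<beta>\<^sup>2) * \<beta>\<^sup>2"
    unfolding h_def using Y_sq ch_bounds \<beta> by (intro sum_products_le) auto
  then show "h \<omega> \<le> 1/25" using \<beta> by simp
qed

lemma V_bound: "0 \<le> V \<omega>" "V \<omega> \<le> \<beta>\<^sup>2 / 4"
proof -
  show "0 \<le> V \<omega>" unfolding V_def by (intro sum_nonneg mult_nonneg_nonneg[OF cv_bounds(1) zero_le_square])
  have "\<bar>V \<omega>\<bar> \<le> 1/4 * \<beta>\<^sup>2"
    unfolding V_def using Y_sq cv_bounds by (intro sum_products_le) auto
  then show "V \<omega> \<le> \<beta>\<^sup>2 / 4" by simp
qed

lemma R_bound: "0 \<le> R" "R \<le> 6/25 * \<beta>\<^sup>2"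
proof -
  show "0 \<le> R" unfolding R_def using s_nonneg r_bounds q_bounds
    by (intro sum_nonneg divide_nonneg_pos mult_nonneg_nonneg) auto
  have "R \<le> (\<Sum>i\<in>UNIV. s i * (9/40 * (20/19)))"
    unfolding R_def
  proof (rule sum_mono)
    fix i
    have "r i * (1 / q i) \<le> 9/40 * (20/19)" using r_bounds[of i] \<epsilon>_le inv_q[of i] q_bounds[of i] by (intro mult_mono) auto
    then show "s i * r i / q i \<le> s i * (9/40 * (20/19))"
      using mult_left_mono[OF _ s_nonneg[of i]] by (metis mult.assoc times_divide_eq_right mult_1_right)
  qed
  also have "\<dots> = (\<Sum>i\<in>UNIV. s i) * (9/40 * (20/19))" by (simp only: sum_distrib_right)
  also have "\<dots> \<le> \<beta>\<^sup>2 * (9/40 * (20/19))" using s_sum by (intro mult_right_mono) auto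
  also have "\<dots> \<le> 6/25 * \<beta>\<^sup>2" by simp
  finally show "R \<le> 6/25 * \<beta>\<^sup>2" .
qed

text \<open>A product over all coordinates, estimated by the exponential of the sum of the squared
  correlations. This is why smallness is demanded of \<open>DD\<close>, which contains the
  dimension, and not of \<open>\<epsilon>\<close> alone.\<close>

lemma \<kappa>_bounds: "1 \<le> \<kappa>" "\<kappa> - 1 \<le> 11/20 * DD" "\<kappa> \<le> 103/100"
proof -
  have one: "1 \<le> 1 / sqrt (q i)" for i using q_bounds[of i] by simp
  show "1 \<le> \<kappa>" unfolding \<kappa>_def using one by (intro prod_ge_1) auto
  have "1 / sqrt (q i) \<le> exp (10/19 * (r i)\<^sup>2)" for i
  proof -
    have "1 / q i = 1 + (r i)\<^sup>2 * (1 / q i)" using q_bounds[of i] by (simp add: q_def field_simps)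
    also have "\<dots> \<le> 1 + (r i)\<^sup>2 * (20/19)" using inv_q[of i] by (intro add_left_mono mult_left_mono) auto
    also have "\<dots> \<le> exp ((r i)\<^sup>2 * (20/19))" using exp_ge_add_one_self by simp
    also have "\<dots> = (exp (10/19 * (r i)\<^sup>2))\<^sup>2" by (simp add: power2_eq_square exp_add[symmetric])
    finally have "sqrt (1 / q i) \<le> exp (10/19 * (r i)\<^sup>2)" by (intro real_le_lsqrt) (auto simp: less_imp_le q_bounds)
    then show ?thesis by (simp add: real_sqrt_divide)
  qed
  then have "\<kappa> \<le> (\<Prod>i\<in>UNIV. exp (10/19 * (r i)\<^sup>2))"
    unfolding \<kappa>_def using one by (intro prod_mono) (auto intro: less_imp_le q_bounds)
  also have "\<dots> = exp (10/19 * (\<Sum>i\<in>UNIV. (r i)\<^sup>2))" by (simp add: exp_sum[symmetric] sum_distrib_left)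
  also have "\<dots> \<le> exp (10/19 * DD)" using r2_sum by simp
  also have "\<dots> \<le> 1 + 10/19 * DD + (10/19 * DD)\<^sup>2"
    using \<epsilon>_le_DD zero_le_power2[of \<epsilon>] small by (intro exp_bound) linarith+
  also have "(10/19 * DD)\<^sup>2 \<le> 10/19 * DD * (10/19 * (1/20))"
    unfolding power2_eq_square using \<epsilon>_le_DD zero_le_power2[of \<epsilon>] small by (intro mult_left_mono) linarith+
  finally show "\<kappa> - 1 \<le> 11/20 * DD" using \<epsilon>_le_DD zero_le_power2[of \<epsilon>] by linarith
  then show "\<kappa> \<le> 103/100" using small by linarith
qed

text \<open>Independence of the two copies. The index type is arbitrary because
  \<open>double_bilinear\<close> applies it to pairs of coordinates.\<close>

lemma bilinear_expectation:
  fixes a b :: "'k \<Rightarrow> 'w \<Rightarrow> real"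
  assumes "\<And>i. integrable Q (a i)" "\<And>i. integrable Q (b i)"
  shows "has_bochner_integral QQ (\<lambda>p. \<Sum>i\<in>A. c i * (a i (fst p) * b i (snd p)))
    (\<Sum>i\<in>A. c i * ((\<integral>\<omega>. a i \<omega> \<partial>Q) * (\<integral>\<omega>. b i \<omega> \<partial>Q)))"
proof -
  interpret QQ: pair_prob_space Q Q ..
  show ?thesis
    using assms by (intro has_bochner_integral_sum has_bochner_integral_mult_right QQ.has_bochner_integral_times)
qed

lemma fst_snd_expectation:
  fixes a :: "'w \<Rightarrow> real"
  assumes "integrable Q a"
  shows "has_bochner_integral QQ (\<lambda>p. a (fst p)) (\<integral>\<omega>. a \<omega> \<partial>Q)" "has_bochner_integral QQ (\<lambda>p. a (snd p)) (\<integral>\<omega>. a \<omega> \<partial>Q)"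
proof -
  interpret QQ: pair_prob_space Q Q ..
  have "integrable Q (\<lambda>_. 1::real)" by simp
  from QQ.has_bochner_integral_times[OF assms this] QQ.has_bochner_integral_times[OF this assms]
  show "has_bochner_integral QQ (\<lambda>p. a (fst p)) (\<integral>\<omega>. a \<omega> \<partial>Q)" "has_bochner_integral QQ (\<lambda>p. a (snd p)) (\<integral>\<omega>. a \<omega> \<partial>Q)"
    by (simp_all add: Q.prob_space)
qed

lemma bounded_times_Y:
  assumes [measurable]: "a \<in> borel_measurable Q" and "\<And>\<omega>. \<bar>a \<omega>\<bar> \<le> B"
  shows "integrable Q (\<lambda>\<omega>. a \<omega> * Y i \<omega>)"
proof (rule Q.integrable_const_bound[where B="B * C"])
  have "0 \<le> B" using assms(2)[of undefined] by linarith
  then show "AE \<omega> in Q. norm (a \<omega> * Y i \<omega>) \<le> B * C"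
    unfolding real_norm_def abs_mult by (intro AE_I2 mult_mono Y_bound assms(2)) auto
qed simp

lemma hV_meas[measurable]: "h \<in> borel_measurable Q" "V \<in> borel_measurable Q"
  unfolding h_def V_def by measurable

lemma E_U: "has_bochner_integral QQ U 0"
  using bilinear_expectation[where A=UNIV, OF Y_int Y_int, of ca] by (simp add: U_def[abs_def] Y_mean)

lemma E_t: "has_bochner_integral QQ t 0"
  using bilinear_expectation[where A=UNIV, OF Y_int Y_int, of cd] by (simp add: t_def[abs_def] Y_mean)

text \<open>In the double sum the pair \<open>i\<close>, \<open>j\<close> contributes the square of
  the covariance of \<open>Y i\<close> and \<open>Y j\<close>, so only the diagonal
  survives.\<close>

lemma double_bilinear:
  "has_bochner_integral QQ (\<lambda>p. (\<Sum>i\<in>UNIV. c i * (Y i (fst p) * Y i (snd p))) * t p) (\<Sum>i\<in>UNIV. c i * cd i * (s i)\<^sup>2)"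
proof -
  have "has_bochner_integral QQ (\<lambda>p. \<Sum>ij\<in>UNIV. (c (fst ij) * cd (snd ij)) * ((Y (fst ij) (fst p) * Y (snd ij) (fst p)) * (Y (fst ij) (snd p) * Y (snd ij) (snd p))))
     (\<Sum>ij\<in>UNIV. (c (fst ij) * cd (snd ij)) * ((if fst ij = snd ij then s (fst ij) else 0) * (if fst ij = snd ij then s (fst ij) else 0)))"
    using bilinear_expectation[where A=UNIV and a="\<lambda>ij \<omega>. Y (fst ij) \<omega> * Y (snd ij) \<omega>" and b="\<lambda>ij \<omega>. Y (fst ij) \<omega> * Y (snd ij) \<omega>" and c="\<lambda>ij. c (fst ij) * cd (snd ij)"]
    by (simp add: YY_int Y_cov)
  moreover have "(\<Sum>ij\<in>UNIV. (c (fst ij) * cd (snd ij)) * ((Y (fst ij) (fst p) * Y (snd ij) (fst p)) * (Y (fst ij) (snd p) * Y (snd ij) (snd p))))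
     = (\<Sum>i\<in>UNIV. c i * (Y i (fst p) * Y i (snd p))) * t p" for p
    unfolding t_def sum_product UNIV_Times_UNIV[symmetric] sum.cartesian_product
    by (intro sum.cong) (auto simp: mult_ac)
  moreover have "(\<Sum>ij\<in>UNIV. (c (fst ij) * cd (snd ij)) * ((if fst ij = snd ij then s (fst ij) else 0) * (if fst ij = snd ij then s (fst ij) else 0)))
     = (\<Sum>i\<in>UNIV. c i * cd i * (s i)\<^sup>2)"
  proof -
    have "(\<Sum>ij\<in>UNIV. (c (fst ij) * cd (snd ij)) * ((if fst ij = snd ij then s (fst ij) else 0) * (if fst ij = snd ij then s (fst ij) else 0)))
       = (\<Sum>i\<in>UNIV. \<Sum>j\<in>UNIV. if i = j then c i * cd i * (s i)\<^sup>2 else 0)"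
      unfolding sum.cartesian_product UNIV_Times_UNIV
      by (intro sum.cong) (auto simp: power2_eq_square)
    then show ?thesis by simp
  qed
  ultimately show ?thesis by simp
qed

text \<open>The extra factor depends on one copy only, and the other copy enters linearly with mean
  zero. The same reason applies to \<open>E_Ug\<close>.\<close>

lemma E_Vt: "has_bochner_integral QQ (\<lambda>p. V (fst p) * t p) 0" "has_bochner_integral QQ (\<lambda>p. V (snd p) * t p) 0"
proof -
  have i: "integrable Q (\<lambda>\<omega>. V \<omega> * Y i \<omega>)" for i
    using V_bound by (intro bounded_times_Y[where B="\<beta>\<^sup>2 / 4"]) auto
  have "V (fst p) * t p = (\<Sum>i\<in>UNIV. cd i * ((V (fst p) * Y i (fst p)) * Y i (snd p)))"
    "V (snd p) * t p = (\<Sum>i\<in>UNIV. cd i * (Y i (fst p) * (V (snd p) * Y i (snd p))))" for p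
    by (simp_all add: t_def sum_distrib_left mult_ac)
  then show "has_bochner_integral QQ (\<lambda>p. V (fst p) * t p) 0" "has_bochner_integral QQ (\<lambda>p. V (snd p) * t p) 0"
    using bilinear_expectation[where A=UNIV, OF i Y_int, of cd] bilinear_expectation[where A=UNIV, OF Y_int i, of cd]
    by (simp_all add: Y_mean)
qed

lemma E_Ug: "has_bochner_integral QQ (\<lambda>p. U p * exp (- h (fst p))) 0" "has_bochner_integral QQ (\<lambda>p. U p * exp (- h (snd p))) 0"
proof -
  have i: "integrable Q (\<lambda>\<omega>. exp (- h \<omega>) * Y i \<omega>)" for i
    using h_bound by (intro bounded_times_Y[where B=1]) auto
  have "U p * exp (- h (fst p)) = (\<Sum>i\<in>UNIV. ca i * ((exp (- h (fst p)) * Y i (fst p)) * Y i (snd p)))"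
    "U p * exp (- h (snd p)) = (\<Sum>i\<in>UNIV. ca i * (Y i (fst p) * (exp (- h (snd p)) * Y i (snd p))))" for p
    by (simp_all add: U_def sum_distrib_left mult_ac)
  then show "has_bochner_integral QQ (\<lambda>p. U p * exp (- h (fst p))) 0" "has_bochner_integral QQ (\<lambda>p. U p * exp (- h (snd p))) 0"
    using bilinear_expectation[where A=UNIV, OF i Y_int, of ca] bilinear_expectation[where A=UNIV, OF Y_int i, of ca]
    by (simp_all add: Y_mean)
qed

lemma diag_expectation: "has_bochner_integral Q (\<lambda>\<omega>. \<Sum>i\<in>UNIV. c i * (Y i \<omega> * Y i \<omega>)) (\<Sum>i\<in>UNIV. c i * s i)"
  using YY_int Y_cov by (intro has_bochner_integral_sum has_bochner_integral_mult_right) (auto simp: has_bochner_integral_iff)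

lemma E_h: "integrable Q h" "(\<integral>\<omega>. h \<omega> \<partial>Q) = (\<Sum>i\<in>UNIV. ch i * s i)"
  using diag_expectation[of ch] unfolding h_def[abs_def, symmetric] has_bochner_integral_iff by auto

lemma E_V: "integrable Q V" "(\<integral>\<omega>. V \<omega> \<partial>Q) = (\<Sum>i\<in>UNIV. cv i * s i)"
  using diag_expectation[of cv] unfolding V_def[abs_def, symmetric] has_bochner_integral_iff by auto

lemma cd_s: "cd i * s i = r i / q i"
  using v_pos[of i] q_bounds[of i] by (simp add: cd_def r_def)

lemma Eh_le: "(\<Sum>i\<in>UNIV. ch i * s i) \<le> 10/19 * DD"
proof -
  have "ch i * s i \<le> (r i)\<^sup>2 * (10/19)" for i
  proof -
    have "ch i * s i = r i / 2 * (cd i * s i)" by (simp add: ch_def cd_def)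
    also have "\<dots> = (r i)\<^sup>2 / 2 * (1 / q i)" by (simp add: cd_s power2_eq_square)
    also have "\<dots> \<le> (r i)\<^sup>2 / 2 * (20/19)" using inv_q by (intro mult_left_mono) auto
    finally show ?thesis by simp
  qed
  then have "(\<Sum>i\<in>UNIV. ch i * s i) \<le> (\<Sum>i\<in>UNIV. (r i)\<^sup>2 * (10/19))" by (rule sum_mono)
  also have "\<dots> = (\<Sum>i\<in>UNIV. (r i)\<^sup>2) * (10/19)" by (rule sum_distrib_right[symmetric])
  finally show ?thesis using r2_sum by linarith
qed

lemma Et2_le: "(\<Sum>i\<in>UNIV. cd i * cd i * (s i)\<^sup>2) \<le> 400/361 * DD"
proof -
  have "cd i * cd i * (s i)\<^sup>2 \<le> (r i)\<^sup>2 * (400/361)" for i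
  proof -
    have "cd i * cd i * (s i)\<^sup>2 = (cd i * s i)\<^sup>2" by (simp add: power2_eq_square mult_ac)
    also have "\<dots> = (r i)\<^sup>2 * (1 / (q i)\<^sup>2)" by (simp add: cd_s power_divide)
    also have "\<dots> \<le> (r i)\<^sup>2 * (400/361)" using inv_q by (intro mult_left_mono) auto
    finally show ?thesis .
  qed
  then have "(\<Sum>i\<in>UNIV. cd i * cd i * (s i)\<^sup>2) \<le> (\<Sum>i\<in>UNIV. (r i)\<^sup>2 * (400/361))" by (rule sum_mono)
  also have "\<dots> = (\<Sum>i\<in>UNIV. (r i)\<^sup>2) * (400/361)" by (rule sum_distrib_right[symmetric])
  finally show ?thesis using r2_sum by linarith
qed

text \<open>The first order terms cancel because the covariances of the two vectors agree.\<close>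

lemma cancellation: "(\<Sum>i\<in>UNIV. ca i * cd i * (s i)\<^sup>2) + R - 2 * (\<Sum>i\<in>UNIV. cv i * s i) \<le> 28/100 * \<beta>\<^sup>2 * DD"
proof -
  have summand: "ca i * cd i * (s i)\<^sup>2 + s i * r i / q i - 2 * (cv i * s i) \<le> s i * (28/100 * DD)" for i
  proof -
    have "ca i * cd i * (s i)\<^sup>2 = ca i * s i * (cd i * s i)" by (simp add: power2_eq_square)
    also have "\<dots> = s i * r i * ((1 + (r i)\<^sup>2) * (1 / q i)^3)"
      by (simp add: cd_s ca_def power2_eq_square power3_eq_cube)
    finally have "ca i * cd i * (s i)\<^sup>2 + s i * r i / q i - 2 * (cv i * s i)
      = s i * r i * ((1 + (r i)\<^sup>2) * (1 / q i)^3 + 1 / q i - 2 * (1 / q i)\<^sup>2)"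
      by (simp add: cv_def algebra_simps power_divide)
    \<comment> \<open>To leading order the three terms are \<open>1 + 1 - 2\<close>. Over the common
      denominator \<open>(q i)^3\<close> the numerator is the square of \<open>r i\<close> plus the
      square of \<open>1 - q i\<close>, and \<open>1 - q i\<close> is itself the square of
      \<open>r i\<close>.\<close>
    also have "(1 + (r i)\<^sup>2) * (1 / q i)^3 + 1 / q i - 2 * (1 / q i)\<^sup>2 = (r i)\<^sup>2 * (1 + (r i)\<^sup>2) * (1 / (q i)^3)"
    proof -
      have gen: "(1 + x) * (1 / y)^3 + 1 / y - 2 * (1 / y)\<^sup>2 = (1 + x + y\<^sup>2 - 2 * y) * (1 / y^3)" if "y \<noteq> 0" for x y :: real
        using that by (simp add: field_simps power2_eq_square power3_eq_cube)
      have "1 + (r i)\<^sup>2 + (q i)\<^sup>2 - 2 * q i = (r i)\<^sup>2 * (1 + (r i)\<^sup>2)"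
        unfolding q_def by (simp add: power2_eq_square algebra_simps)
      then show ?thesis using gen[of "q i" "(r i)\<^sup>2"] q_bounds[of i] by simp
    qed
    also have "s i * r i * ((r i)\<^sup>2 * (1 + (r i)\<^sup>2) * (1 / (q i)^3)) \<le> s i * (9/40) * (DD * (21/20) * (8000/6859))"
      using s_nonneg[of i] r_bounds[of i] \<epsilon>_le r2_le[of i] order_trans[OF r2_le(1)[of i] \<epsilon>_le_DD] DD_nonneg inv_q[of i] q_bounds[of i]
      by (intro mult_mono mult_nonneg_nonneg) auto
    also have "\<dots> \<le> s i * (28/100 * DD)"
    proof -
      have "0 \<le> s i * DD" using s_nonneg[of i] \<epsilon>_le_DD zero_le_power2[of \<epsilon>] by (intro mult_nonneg_nonneg) linarith+
      then show ?thesis by simp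
    qed
    finally show ?thesis .
  qed
  have "(\<Sum>i\<in>UNIV. ca i * cd i * (s i)\<^sup>2) + R - 2 * (\<Sum>i\<in>UNIV. cv i * s i)
      = (\<Sum>i\<in>UNIV. ca i * cd i * (s i)\<^sup>2 + s i * r i / q i - 2 * (cv i * s i))"
    by (simp add: R_def sum.distrib sum_subtractf sum_distrib_left)
  also have "\<dots> \<le> (\<Sum>i\<in>UNIV. s i * (28/100 * DD))" by (intro sum_mono summand)
  also have "\<dots> = (\<Sum>i\<in>UNIV. s i) * (28/100 * DD)" by (simp only: sum_distrib_right)
  also have "\<dots> \<le> \<beta>\<^sup>2 * (28/100 * DD)"
    using s_sum \<epsilon>_le_DD zero_le_power2[of \<epsilon>] by (intro mult_right_mono) linarith+
  finally show ?thesis by simp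
qed

lemma energy_le_small: "energy \<le> 4 * \<beta>\<^sup>2 * DD"
proof -
  define x where "x = 11/20 * DD"
  \<comment> \<open>The majorant of \<open>energy_pointwise\<close> at
    \<open>b = \<beta>\<^sup>2\<close>, multiplied out so that the expectation of each term is
    known.\<close>
  let ?G = "\<lambda>p. \<beta>\<^sup>2 * (844/1000 * (t p * t p) + 1234/1000 * (x + h (fst p) + h (snd p)) + 1/20 * h (fst p))
      + (U p + U p * t p + (R - V (fst p) - V (snd p)) + (R * t p - V (fst p) * t p - V (snd p) * t p)
         + \<kappa> * (U p * exp (- h (fst p))) + \<kappa> * (U p * exp (- h (snd p))) - (\<kappa> + 1) * U p)"
  have const: "has_bochner_integral QQ (\<lambda>p. c) c" for c :: real
    using prob_space.prob_space[OF QQ_prob] prob_space.finite_measure[OF QQ_prob]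
    by (simp add: has_bochner_integral_iff finite_measure.integrable_const)
  note Eh = fst_snd_expectation[OF E_h(1), unfolded E_h(2)]
  note EV = fst_snd_expectation[OF E_V(1), unfolded E_V(2)]
  have Ut: "has_bochner_integral QQ (\<lambda>p. U p * t p) (\<Sum>i\<in>UNIV. ca i * cd i * (s i)\<^sup>2)"
    using double_bilinear[of ca] by (simp add: U_def)
  have tt: "has_bochner_integral QQ (\<lambda>p. t p * t p) (\<Sum>i\<in>UNIV. cd i * cd i * (s i)\<^sup>2)"
    using double_bilinear[of cd] by (simp add: t_def)
  let ?Eh = "\<Sum>i\<in>UNIV. ch i * s i" and ?EV = "\<Sum>i\<in>UNIV. cv i * s i"
  let ?E = "\<beta>\<^sup>2 * (844/1000 * (\<Sum>i\<in>UNIV. cd i * cd i * (s i)\<^sup>2) + 1234/1000 * (x + ?Eh + ?Eh) + 1/20 * ?Eh)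
      + (0 + (\<Sum>i\<in>UNIV. ca i * cd i * (s i)\<^sup>2) + (R - ?EV - ?EV) + (R * 0 - 0 - 0) + \<kappa> * 0 + \<kappa> * 0 - (\<kappa> + 1) * 0)"
  have G: "has_bochner_integral QQ ?G ?E"
    by (intro has_bochner_integral_add has_bochner_integral_diff has_bochner_integral_mult_right
        const Eh EV Ut tt E_U E_t E_Vt E_Ug)
  let ?P = "\<lambda>p. (\<Prod>j\<in>UNIV. K2 j (Y j (fst p)) (Y j (snd p))) * (\<Sum>i\<in>UNIV. (v i)\<^sup>2 * \<psi> i (Y i (fst p)) (Y i (snd p)))"
  have intP: "integrable QQ ?P"
  proof -
    have "integrable QQ (\<lambda>p. \<Sum>i\<in>UNIV. (v i)\<^sup>2 * ((\<Prod>j\<in>UNIV. K2 j (Y j (fst p)) (Y j (snd p))) * \<psi> i (Y i (fst p)) (Y i (snd p))))"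
      by (intro Bochner_Integration.integrable_sum integrable_mult_right D_energy(3))
    then show ?thesis by (simp add: sum_distrib_left mult_ac)
  qed
  have "energy \<le> (\<integral>p. ?G p \<partial>QQ)"
    unfolding energy_def
  proof (rule integral_mono[OF intP])
    show "integrable QQ ?G" using G by (simp add: has_bochner_integral_iff)
    fix p
    have "V (fst p) + V (snd p) \<le> \<beta>\<^sup>2 / 2" using V_bound(2)[of "fst p"] V_bound(2)[of "snd p"] by linarith
    from energy_pointwise[OF t_bound U_bound V_bound(1) V_bound(1) this R_bound h_bound(1) h_bound(1) h_bound(2) \<kappa>_bounds(1,3,2)]
    have "(U p - V (fst p) - V (snd p) + R) * (\<kappa> * exp (t p - h (fst p) - h (snd p))) \<le> ?G p"
      by (simp add: x_def power2_eq_square left_diff_distrib)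
    then show "?P p \<le> ?G p"
      unfolding prod_K2 sum_\<psi> by (simp only: mult.commute)
  qed
  also have "\<dots> = ?E" using G by (simp add: has_bochner_integral_iff)
  also have "\<dots> \<le> \<beta>\<^sup>2 * (844/1000 * (400/361 * DD) + 1234/1000 * (x + 10/19 * DD + 10/19 * DD) + 1/20 * (10/19 * DD)) + 28/100 * \<beta>\<^sup>2 * DD"
    using cancellation Eh_le Et2_le by (intro add_mono mult_left_mono) auto
  \<comment> \<open>With \<open>x = 11/20 * DD\<close> the coefficients of
    \<open>\<beta>\<^sup>2 * DD\<close> add up to less than \<open>3.22\<close>.\<close>
  also have "\<dots> \<le> 4 * \<beta>\<^sup>2 * DD"
  proof -
    have "0 \<le> \<beta>\<^sup>2 * DD" using DD_nonneg by simp
    then show ?thesis by (simp add: x_def algebra_simps)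
  qed
  finally show ?thesis .
qed

end

end


locale summand_coords = bounded_summand v Q s Y C \<beta> \<nu> + orthonormal_coords e
  for v :: "'i::finite \<Rightarrow> real" and Q :: "'w measure" and s Y C \<beta> \<nu> and e :: "'i \<Rightarrow> 'a::euclidean_space"
begin

sublocale shift_coords v Q s Y C e
  by unfold_locales

lemma sqrt_DD: "5 * \<beta> * sqrt DD = 5 * sqrt (real CARD('i)) * \<beta> / (\<nu> + 3)"
  using \<epsilon>_pos by (simp add: DD_def real_sqrt_mult \<epsilon>_def)

text \<open>For small \<open>DD\<close> the energy bound enters through
  \<open>(2 + sqrt 2) * sqrt 2 = 2 * sqrt 2 + 2\<close>, which is below \<open>5\<close>. For large
  \<open>DD\<close> the direct coupling already costs no more than the claim.\<close>

lemma W2_summand: "W2 (distr \<Pi>n borel vec) \<rho>1 \<le> ennreal (5 * sqrt (real CARD('i)) * \<beta> / (\<nu> + 3))"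
proof (cases "DD \<le> 1/20")
  case True
  have s2: "sqrt 2 \<le> 3/2" by (rule real_le_lsqrt) (auto simp: power2_eq_square)
  have "(2 + sqrt 2) * sqrt (energy / 2) \<le> (2 + sqrt 2) * sqrt (2 * \<beta>\<^sup>2 * DD)"
    using energy_le_small[OF True] by (intro mult_left_mono) auto
  also have "\<dots> = (2 * sqrt 2 + 2) * (\<beta> * sqrt DD)"
    using \<beta> by (simp add: real_sqrt_mult algebra_simps)
  also have "\<dots> \<le> 5 * (\<beta> * sqrt DD)"
    using s2 \<beta> DD_nonneg by (intro mult_right_mono) auto
  finally have "(2 + sqrt 2) * sqrt (energy / 2) \<le> 5 * \<beta> * sqrt DD" by simp
  then show ?thesis
    unfolding sqrt_DD using W2_energy by (meson ennreal_leI order_trans)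
next
  case False
  \<comment> \<open>The difference of the roots is \<open>s i\<close> divided by their sum, hence
    its square is at most \<open>(s i)\<^sup>2 / v i = s i * r i\<close>; and
    \<open>r i \<le> 1/4\<close> because \<open>1 \<le> \<nu>\<close>.\<close>
  have "(sqrt (v i) - sqrt (v i - s i))\<^sup>2 \<le> s i * (1/4)" for i
  proof -
    have a: "0 < v i" "0 \<le> v i - s i" using v_pos[of i] a_pos[of i] by auto
    have "(sqrt (v i) - sqrt (v i - s i)) * sqrt (v i) \<le> (sqrt (v i) - sqrt (v i - s i)) * (sqrt (v i) + sqrt (v i - s i))"
      using a s_nonneg[of i] by (intro mult_left_mono) auto
    also have "\<dots> = s i" using a by (simp add: algebra_simps)
    finally have "((sqrt (v i) - sqrt (v i - s i)) * sqrt (v i))\<^sup>2 \<le> (s i)\<^sup>2"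
      using a s_nonneg[of i] by (intro power_mono mult_nonneg_nonneg) auto
    then have "(sqrt (v i) - sqrt (v i - s i))\<^sup>2 * v i \<le> (s i)\<^sup>2"
      unfolding power_mult_distrib using a by simp
    then have "(sqrt (v i) - sqrt (v i - s i))\<^sup>2 \<le> (s i)\<^sup>2 / v i"
      using a by (simp only: pos_le_divide_eq)
    also have "\<dots> = s i * r i" by (simp add: r_def power2_eq_square)
    also have "\<dots> \<le> s i * (1/4)"
    proof -
      have "\<epsilon> \<le> 1/4" using \<nu> by (simp add: \<epsilon>_def field_simps)
      then show ?thesis using r_bounds[of i] s_nonneg[of i] by (intro mult_left_mono) auto
    qed
    finally show ?thesis .
  qed
  moreover have "(\<integral>\<omega>. (Y i \<omega>)\<^sup>2 \<partial>Q) = s i" for i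
    using Y_cov[of i i] by (simp add: power2_eq_square)
  ultimately have "(\<Sum>i\<in>UNIV. (sqrt (v i) - sqrt (v i - s i))\<^sup>2 + (\<integral>\<omega>. (Y i \<omega>)\<^sup>2 \<partial>Q)) \<le> (\<Sum>i\<in>UNIV. s i * (5/4))"
    by (intro sum_mono) (simp add: field_simps)
  also have "\<dots> = (\<Sum>i\<in>UNIV. s i) * (5/4)" by (rule sum_distrib_right[symmetric])
  also have "\<dots> \<le> \<beta>\<^sup>2 * (5/4)" using s_sum by simp
  also have "\<dots> \<le> 25 * \<beta>\<^sup>2 * DD"
    using False mult_left_mono[of "1/20" DD "25 * \<beta>\<^sup>2"] by simp
  finally have "sqrt (\<Sum>i\<in>UNIV. (sqrt (v i) - sqrt (v i - s i))\<^sup>2 + (\<integral>\<omega>. (Y i \<omega>)\<^sup>2 \<partial>Q)) \<le> sqrt (25 * \<beta>\<^sup>2 * DD)"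
    by (rule real_sqrt_le_mono)
  also have "\<dots> = 5 * \<beta> * sqrt DD" using \<beta> by (simp add: real_sqrt_mult)
  finally show ?thesis
    unfolding sqrt_DD using W2_trivial by (meson ennreal_leI order_trans)
qed

end

section \<open>Diagonalising the covariance matrix\<close>

text \<open>The first-order condition at a maximum of the Rayleigh quotient, obtained from one
  explicit perturbation \<open>u + \<tau> *\<^sub>R w\<close> in place of a derivative.\<close>

lemma quadratic_maximum_orthogonal:
  fixes f :: "'a::euclidean_space \<Rightarrow> 'a"
  assumes lin: "linear f" and sym: "\<And>x y. x \<bullet> f y = f x \<bullet> y"
    and S: "subspace S" and u: "u \<in> S" "norm u = 1" and max: "\<And>x. x \<in> S \<Longrightarrow> norm x = 1 \<Longrightarrow> x \<bullet> f x \<le> u \<bullet> f u"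
    and w: "w \<in> S" "u \<bullet> w = 0"
  shows "u \<bullet> f w = 0"
proof (rule ccontr)
  assume b0: "u \<bullet> f w \<noteq> 0"
  have le: "x \<bullet> f x \<le> (u \<bullet> f u) * (x \<bullet> x)" if "x \<in> S" for x
  proof (cases "x = 0")
    case False
    have "(inverse (norm x) *\<^sub>R x) \<bullet> f (inverse (norm x) *\<^sub>R x) \<le> u \<bullet> f u"
      using False that S by (intro max) (auto simp: subspace_scale)
    then have "(x \<bullet> f x) / (norm x)\<^sup>2 \<le> u \<bullet> f u"
      by (simp add: linear_scale[OF lin] power2_eq_square divide_inverse mult_ac)
    then show ?thesis using False by (simp add: power2_norm_eq_inner pos_divide_le_eq)
  qed (simp add: linear_0[OF lin])
  define a b c d where "a = u \<bullet> f u" and "b = u \<bullet> f w" and "c = w \<bullet> f w" and "d = w \<bullet> w"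
  define K where "K = \<bar>a * d - c\<bar> + 1"
  \<comment> \<open>The maximiser of \<open>2 * \<tau> * b - \<tau>\<^sup>2 * K\<close>: the gain
    linear in \<open>\<tau>\<close> beats the quadratic loss by \<open>b\<^sup>2 / K\<close>, which
    contradicts maximality unless \<open>b = 0\<close>.\<close>
  define \<tau> where "\<tau> = b / K"
  have K: "0 < K" "a * d - c < K" by (auto simp: K_def)
  have "(u + \<tau> *\<^sub>R w) \<bullet> f (u + \<tau> *\<^sub>R w) \<le> a * ((u + \<tau> *\<^sub>R w) \<bullet> (u + \<tau> *\<^sub>R w))"
    unfolding a_def using u w S by (intro le) (auto simp: subspace_add subspace_scale)
  moreover have "w \<bullet> f u = b" using sym[of w u] by (simp add: b_def inner_commute)
  moreover have "u \<bullet> u = 1" using u by (simp add: norm_eq_1)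
  ultimately have "a + 2 * \<tau> * b + \<tau> * \<tau> * c \<le> a * (1 + \<tau> * \<tau> * d)"
    using w by (simp add: linear_add[OF lin] linear_scale[OF lin] inner_add_left inner_add_right
        a_def[symmetric] b_def[symmetric] c_def[symmetric] d_def[symmetric] inner_commute[of w u] algebra_simps)
  then have "2 * (\<tau> * b) \<le> \<tau> * \<tau> * (a * d - c)" by (simp add: algebra_simps)
  also have "\<dots> \<le> \<tau> * \<tau> * K" using K by (intro mult_left_mono) auto
  also have "\<dots> = \<tau> * b" using K by (simp add: \<tau>_def)
  finally have "\<tau> * b \<le> 0" by simp
  moreover have "\<tau> * b = b\<^sup>2 / K" by (simp add: \<tau>_def power2_eq_square)
  ultimately show False using b0 K by (simp add: b_def divide_le_0_iff)
qed

text \<open>The spectral theorem by induction on the number of vectors. The last clause is the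
  invariant that makes it work: \<open>f\<close> maps the orthogonal complement of \<open>B\<close>
  into itself. The next vector is a maximiser of \<open>x \<bullet> f x\<close> on the unit sphere
  of that complement.\<close>

lemma ex_orthonormal_diagonal:
  fixes f :: "'a::euclidean_space \<Rightarrow> 'a"
  assumes lin: "linear f" and sym: "\<And>x y. x \<bullet> f y = f x \<bullet> y" and "n \<le> DIM('a)"
  shows "\<exists>B. finite B \<and> card B = n \<and> (\<forall>x\<in>B. norm x = 1) \<and> (\<forall>x\<in>B. \<forall>y\<in>B. x \<noteq> y \<longrightarrow> x \<bullet> y = 0 \<and> x \<bullet> f y = 0)
    \<and> (\<forall>w. (\<forall>x\<in>B. x \<bullet> w = 0) \<longrightarrow> (\<forall>x\<in>B. x \<bullet> f w = 0))"
  using \<open>n \<le> DIM('a)\<close>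
proof (induction n)
  case 0
  then show ?case by (intro exI[of _ "{}"]) auto
next
  case (Suc n)
  then obtain B where B: "finite B" "card B = n" "\<forall>x\<in>B. norm x = 1"
    and orth: "\<forall>x\<in>B. \<forall>y\<in>B. x \<noteq> y \<longrightarrow> x \<bullet> y = 0 \<and> x \<bullet> f y = 0"
    and perp: "\<forall>w. (\<forall>x\<in>B. x \<bullet> w = 0) \<longrightarrow> (\<forall>x\<in>B. x \<bullet> f w = 0)" by auto
  define S where "S = {w. \<forall>x\<in>B. x \<bullet> w = 0}"
  have S: "subspace S" unfolding S_def subspace_def by (auto simp: inner_add_right)
  have "dim B < DIM('a)" using dim_le_card[of B B] B Suc.prems by (simp add: span_superset)
  then obtain z where z: "z \<noteq> 0" "\<And>y. y \<in> span B \<Longrightarrow> orthogonal z y"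
    using orthogonal_to_subspace_exists[of B] by blast
  have "z \<in> S" using z(2) by (auto simp: S_def orthogonal_def inner_commute span_base)
  then have ne: "inverse (norm z) *\<^sub>R z \<in> S \<inter> sphere 0 1"
    using z(1) S by (auto simp: subspace_scale)
  have "compact (S \<inter> sphere 0 1)"
    using closed_subspace[OF S] compact_sphere by (simp add: closed_Int_compact)
  moreover have "continuous_on (S \<inter> sphere 0 1) (\<lambda>x. x \<bullet> f x)"
    using lin by (intro continuous_intros linear_continuous_on linear_conv_bounded_linear[THEN iffD1])
  ultimately obtain u where u: "u \<in> S \<inter> sphere 0 1" "\<And>x. x \<in> S \<inter> sphere 0 1 \<Longrightarrow> x \<bullet> f x \<le> u \<bullet> f u"
    using continuous_attains_sup[of "S \<inter> sphere 0 1" "\<lambda>x. x \<bullet> f x"] ne by blast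
  have uS: "u \<in> S" "norm u = 1" using u by auto
  have uw: "u \<bullet> f w = 0" if "w \<in> S" "u \<bullet> w = 0" for w
    using u uS that by (intro quadratic_maximum_orthogonal[OF lin sym S]) auto
  have "u \<notin> B" using uS by (auto simp: S_def norm_eq_1)
  have uB: "x \<bullet> u = 0" "x \<bullet> f u = 0" "u \<bullet> x = 0" "u \<bullet> f x = 0" if "x \<in> B" for x
    using that uS(1) perp sym[of u x] by (auto simp: S_def inner_commute)
  show ?case
  proof (intro exI[of _ "insert u B"] conjI)
    show "\<forall>x\<in>insert u B. \<forall>y\<in>insert u B. x \<noteq> y \<longrightarrow> x \<bullet> y = 0 \<and> x \<bullet> f y = 0"
      using uB orth by auto
    show "\<forall>w. (\<forall>x\<in>insert u B. x \<bullet> w = 0) \<longrightarrow> (\<forall>x\<in>insert u B. x \<bullet> f w = 0)"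
      using uw perp by (auto simp: S_def)
  qed (use B uS \<open>u \<notin> B\<close> in auto)
qed

lemma ex_diagonal_coords:
  fixes A :: "real ^ 'd ^ 'd"
  assumes "transpose A = A"
  obtains e :: "'d \<Rightarrow> real ^ 'd" where "\<And>i j. e i \<bullet> e j = (if i = j then 1 else 0)"
    "\<And>i j. i \<noteq> j \<Longrightarrow> e i \<bullet> (A *v e j) = 0"
proof -
  have "x \<bullet> (A *v y) = (A *v x) \<bullet> y" for x y
  proof -
    have "x v* A = A *v x" using vector_transpose_matrix[of x A] assms by simp
    then show ?thesis using dot_lmul_matrix[of x A y] by simp
  qed
  from ex_orthonormal_diagonal[of "\<lambda>x. A *v x", OF matrix_vector_mul_linear this order_refl]
  obtain B where B: "finite B" "card B = CARD('d)" "\<forall>x\<in>B. norm x = 1"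
    and orth: "\<forall>x\<in>B. \<forall>y\<in>B. x \<noteq> y \<longrightarrow> x \<bullet> y = 0 \<and> x \<bullet> (A *v y) = 0"
    by auto
  obtain e where e: "bij_betw e (UNIV :: 'd set) B"
    using finite_same_card_bij[of "UNIV :: 'd set" B] B by auto
  have eB: "e i \<in> B" for i using e by (auto simp: bij_betw_def)
  have inj: "e i = e j \<longleftrightarrow> i = j" for i j using e by (auto simp: bij_betw_def inj_on_def)
  show ?thesis
    using eB inj orth B(3) by (intro that[of e]) (auto simp: norm_eq_1)
qed

text \<open>As many orthonormal vectors as dimensions span the space, so the remainder
  \<open>z\<close> of the expansion is orthogonal to itself.\<close>

lemma (in orthonormal_coords) vec_coords:
  assumes "CARD('i) = DIM('a)"
  shows "vec (\<lambda>i. x \<bullet> e i) = x"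
proof -
  have inj: "inj e"
  proof (rule injI)
    fix i j assume "e i = e j"
    then show "i = j" using orth[of i j] orth[of i i] by (auto split: if_splits)
  qed
  have e0: "e i \<noteq> 0" for i using orth[of i i] by auto
  have "pairwise orthogonal (range e)"
    unfolding pairwise_def orthogonal_def using orth by auto
  then have "independent (range e)"
    using e0 by (intro pairwise_orthogonal_independent) auto
  moreover have "card (range e) = DIM('a)" using inj assms by (simp add: card_image)
  ultimately have sp: "span (range e) = UNIV"
    using card_ge_dim_independent[of "range e" UNIV] by auto
  define z where "z = x - vec (\<lambda>i. x \<bullet> e i)"
  have "z \<bullet> e j = 0" for j
    by (simp add: z_def vec_def inner_diff_left inner_sum_left orth if_distrib cong: if_cong)
  then have "orthogonal z y" if "y \<in> range e" for y using that by (auto simp: orthogonal_def)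
  then have "orthogonal z z" using orthogonal_to_span[of z "range e" z] sp by (auto simp: orthogonal_commute)
  then show ?thesis by (simp add: z_def orthogonal_self)
qed

section \<open>Fourier inversion for smoothed Gaussian vectors\<close>

abbreviation "stdn \<equiv> std_normal_distribution"

interpretation stdn: real_distribution stdn
  by (rule real_dist_normal_dist)

lemma integral_iexp_std: "(\<integral>y. iexp (t * y) \<partial>stdn) = complex_of_real (exp (- (t\<^sup>2) / 2))"
  using char_std_normal_distribution by (simp add: char_def fun_eq_iff)

text \<open>Up to scaling the normal density is its own Fourier transform. Writing it as an integral
  of exponentials against a probability measure gives the inversion formula in the one case where it
  is used, without integrability questions.\<close>

lemma normal_density_fourier:
  assumes "0 < w"
  shows "complex_of_real (normal_density 0 (sqrt w) u) = complex_of_real (1 / sqrt (2 * pi * w)) * (\<integral>y. iexp (u / sqrt w * y) \<partial>stdn)"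
  using assms unfolding integral_iexp_std normal_density_sqrt[OF assms]
  by (simp add: power_divide)

text \<open>The additional Gaussian factor changes the variance from \<open>w\<close> to
  \<open>b\<close>: the substitution \<open>z = c * y\<close> with \<open>c = sqrt (b / w)\<close>
  absorbs it into the standard normal density.\<close>

lemma normal_density_fourier_weighted:
  assumes "0 < w" "w \<le> b"
  shows "complex_of_real (1 / sqrt (2 * pi * w)) * (\<integral>y. iexp (x / sqrt w * y) * complex_of_real (exp (- ((b - w) * y\<^sup>2 / (2 * w)))) \<partial>stdn)
    = complex_of_real (normal_density 0 (sqrt b) x)"
proof -
  define c where "c = sqrt (b / w)"
  have b: "0 < b" and c: "0 < c" "c\<^sup>2 = b / w" using assms by (auto simp: c_def)
  have dens: "std_normal_density y * exp (- ((b - w) * y\<^sup>2 / (2 * w))) = std_normal_density (0 + c * y)" for y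
  proof -
    have "- (y\<^sup>2 / 2) + - ((b - w) * y\<^sup>2 / (2 * w)) = - ((0 + c * y)\<^sup>2 / 2)"
      using assms c(2) by (simp add: power_mult_distrib field_simps)
    then have "exp (- (y\<^sup>2 / 2)) * exp (- ((b - w) * y\<^sup>2 / (2 * w))) = exp (- ((0 + c * y)\<^sup>2 / 2))"
      by (simp only: exp_add[symmetric])
    then show ?thesis by (simp add: std_normal_density_def)
  qed
  have xc: "x / sqrt b * (c * y) = x / sqrt w * y" for y
    using assms b by (simp add: c_def real_sqrt_divide)
  have "(\<integral>y. iexp (x / sqrt w * y) * complex_of_real (exp (- ((b - w) * y\<^sup>2 / (2 * w)))) \<partial>stdn)
     = (\<integral>y. std_normal_density y *\<^sub>R (iexp (x / sqrt w * y) * complex_of_real (exp (- ((b - w) * y\<^sup>2 / (2 * w))))) \<partial>lborel)"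
    by (subst integral_density) auto
  also have "\<dots> = (\<integral>y. (\<lambda>z. std_normal_density z *\<^sub>R iexp (x / sqrt b * z)) (0 + c * y) \<partial>lborel)"
  proof (intro Bochner_Integration.integral_cong refl)
    fix y
    have "complex_of_real (std_normal_density y) * complex_of_real (exp (- ((b - w) * y\<^sup>2 / (2 * w)))) = complex_of_real (std_normal_density (0 + c * y))"
      by (simp only: dens of_real_mult[symmetric])
    moreover have "A *\<^sub>R (z * complex_of_real B) = (complex_of_real A * complex_of_real B) * z" for A B z
      by (simp add: scaleR_conv_of_real mult_ac)
    moreover have "x / sqrt b * (0 + c * y) = x / sqrt w * y" by (simp only: add_0 xc)
    ultimately show "std_normal_density y *\<^sub>R (iexp (x / sqrt w * y) * complex_of_real (exp (- ((b - w) * y\<^sup>2 / (2 * w)))))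
      = (\<lambda>z. std_normal_density z *\<^sub>R iexp (x / sqrt b * z)) (0 + c * y)"
      by (simp only: scaleR_conv_of_real)
  qed
  also have "\<dots> = (1 / c) *\<^sub>R (\<integral>z. std_normal_density z *\<^sub>R iexp (x / sqrt b * z) \<partial>lborel)"
    using lborel_integral_real_affine[of c "\<lambda>z. std_normal_density z *\<^sub>R iexp (x / sqrt b * z)" 0] c(1) by simp
  also have "(\<integral>z. std_normal_density z *\<^sub>R iexp (x / sqrt b * z) \<partial>lborel) = (\<integral>z. iexp (x / sqrt b * z) \<partial>stdn)"
    by (subst integral_density) auto
  also have "\<dots> = complex_of_real (exp (- (x\<^sup>2 / (2 * b))))"
    unfolding integral_iexp_std using b by (simp add: power_divide)
  finally have *: "(\<integral>y. iexp (x / sqrt w * y) * complex_of_real (exp (- ((b - w) * y\<^sup>2 / (2 * w)))) \<partial>stdn)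
     = (1 / c) *\<^sub>R complex_of_real (exp (- (x\<^sup>2 / (2 * b))))" .
  have "1 / sqrt (2 * pi * w) * (1 / c) = 1 / sqrt (2 * pi * b)"
    using assms b by (simp add: c_def real_sqrt_mult real_sqrt_divide)
  then show ?thesis unfolding * normal_density_sqrt[OF b] scaleR_conv_of_real
    by (simp only: mult.assoc[symmetric] of_real_mult[symmetric] diff_zero)
qed

lemma norm_prod_iexp: "norm (\<Prod>i\<in>A. iexp (a i)) = 1"
  by (simp add: prod_norm[symmetric])

lemma prod_iexp: "finite A \<Longrightarrow> (\<Prod>i\<in>A. iexp (a i)) = iexp (\<Sum>i\<in>A. a i)"
  by (simp add: exp_sum sum_distrib_left)

text \<open>Only the characteristic function of \<open>G\<close> is known; by \<open>normal_density_fourier\<close> the smoothed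
  density is a Fourier integral of it.\<close>

lemma smoothed_gaussian_density:
  fixes G :: "'i::finite \<Rightarrow> 'v \<Rightarrow> real"
  assumes "prob_space N" and [measurable]: "\<And>i. G i \<in> borel_measurable N"
    and char: "\<And>y. (\<integral>\<omega>. iexp (\<Sum>i\<in>UNIV. y i * G i \<omega>) \<partial>N) = complex_of_real (exp (- (\<Sum>i\<in>UNIV. (y i)\<^sup>2 * \<tau> i) / 2))"
    and w: "0 < w" and \<tau>: "\<And>i. 0 \<le> \<tau> i"
  shows "(\<integral>\<omega>. (\<Prod>i\<in>UNIV. normal_density 0 (sqrt w) (x i - G i \<omega>)) \<partial>N)
    = (\<Prod>i\<in>UNIV. normal_density 0 (sqrt (w + \<tau> i)) (x i))"
proof -
  interpret N: prob_space N by fact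
  let ?P = "PiM (UNIV :: 'i set) (\<lambda>_. stdn)"
  interpret product_prob_space "\<lambda>_::'i. stdn" UNIV
    by unfold_locales
  interpret NP: pair_prob_space N ?P ..
  let ?c = "complex_of_real (1 / sqrt (2 * pi * w))"
  have [measurable]: "(\<lambda>y. y i) \<in> borel_measurable ?P" for i
    using measurable_component_singleton[of i UNIV "\<lambda>_. stdn"] by simp
  have [measurable]: "(\<lambda>p. snd p i) \<in> borel_measurable (N \<Otimes>\<^sub>M ?P)" for i
    by (rule measurable_compose[OF measurable_snd]) simp
  have prod_int: "(\<Prod>i\<in>UNIV. (\<integral>y. g i y \<partial>stdn)) = (\<integral>y. (\<Prod>i\<in>UNIV. g i (y i)) \<partial>?P)"
    if "\<And>i. integrable stdn (g i)" for g :: "'i \<Rightarrow> real \<Rightarrow> complex"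
    by (rule product_integral_prod[symmetric]) (auto intro: that)
  have int_exp: "integrable stdn (\<lambda>y. iexp (a * y) * complex_of_real (exp (- (d * y\<^sup>2))))" if "0 \<le> d" for a d :: real
    by (rule stdn.integrable_const_bound[where B=1]) (auto simp: norm_mult that)
  have int_iexp: "integrable stdn (\<lambda>y. iexp (a * y))" for a :: real
    using int_exp[of 0 a] by simp
  have "complex_of_real (\<integral>\<omega>. (\<Prod>i\<in>UNIV. normal_density 0 (sqrt w) (x i - G i \<omega>)) \<partial>N)
     = (\<integral>\<omega>. (\<Prod>i\<in>UNIV. complex_of_real (normal_density 0 (sqrt w) (x i - G i \<omega>))) \<partial>N)"
    by (simp add: integral_complex_of_real[symmetric])
  also have "\<dots> = (\<integral>\<omega>. (\<Prod>i\<in>(UNIV::'i set). ?c) * (\<integral>y. (\<Prod>i\<in>UNIV. iexp ((x i - G i \<omega>) / sqrt w * y i)) \<partial>?P) \<partial>N)"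
    unfolding normal_density_fourier[OF w] prod.distrib prod_int[OF int_iexp] ..
  also have "\<dots> = (\<Prod>i\<in>(UNIV::'i set). ?c) * (\<integral>\<omega>. (\<integral>y. (\<Prod>i\<in>UNIV. iexp ((x i - G i \<omega>) / sqrt w * y i)) \<partial>?P) \<partial>N)"
    by simp
  \<comment> \<open>The integrand has modulus \<open>1\<close> and both measures are probabilities.
    After the exchange the inner integral is, up to a phase, the characteristic function of
    \<open>G\<close> at \<open>- y / sqrt w\<close>.\<close>
  also have "(\<integral>\<omega>. (\<integral>y. (\<Prod>i\<in>UNIV. iexp ((x i - G i \<omega>) / sqrt w * y i)) \<partial>?P) \<partial>N)
     = (\<integral>y. (\<integral>\<omega>. (\<Prod>i\<in>UNIV. iexp ((x i - G i \<omega>) / sqrt w * y i)) \<partial>N) \<partial>?P)"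
  proof (rule NP.Fubini_integral[symmetric])
    show "integrable (N \<Otimes>\<^sub>M ?P) (\<lambda>(\<omega>, y). \<Prod>i\<in>UNIV. iexp ((x i - G i \<omega>) / sqrt w * y i))"
      by (rule NP.P.integrable_const_bound[where B=1]) (auto simp: split_beta' norm_prod_iexp simp del: of_real_mult of_real_divide of_real_diff)
  qed
  also have "\<dots> = (\<integral>y. (\<Prod>i\<in>UNIV. iexp (x i / sqrt w * y i) * complex_of_real (exp (- (\<tau> i / (2 * w) * (y i)\<^sup>2)))) \<partial>?P)"
  proof (intro Bochner_Integration.integral_cong refl)
    fix y :: "'i \<Rightarrow> real"
    have "(\<integral>\<omega>. (\<Prod>i\<in>UNIV. iexp ((x i - G i \<omega>) / sqrt w * y i)) \<partial>N)
       = (\<integral>\<omega>. iexp (\<Sum>i\<in>UNIV. x i / sqrt w * y i) * iexp (\<Sum>i\<in>UNIV. (- y i / sqrt w) * G i \<omega>) \<partial>N)"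
    proof (intro Bochner_Integration.integral_cong refl)
      fix \<omega>
      have "(\<Sum>i\<in>UNIV. (x i - G i \<omega>) / sqrt w * y i) = (\<Sum>i\<in>UNIV. x i / sqrt w * y i) + (\<Sum>i\<in>UNIV. (- y i / sqrt w) * G i \<omega>)"
        unfolding sum.distrib[symmetric] by (intro sum.cong refl) (simp add: diff_divide_distrib algebra_simps)
      then show "(\<Prod>i\<in>UNIV. iexp ((x i - G i \<omega>) / sqrt w * y i)) = iexp (\<Sum>i\<in>UNIV. x i / sqrt w * y i) * iexp (\<Sum>i\<in>UNIV. (- y i / sqrt w) * G i \<omega>)"
        unfolding prod_iexp[OF finite] by (simp only: of_real_add distrib_left exp_add)
    qed
    also have "\<dots> = iexp (\<Sum>i\<in>UNIV. x i / sqrt w * y i) * complex_of_real (exp (- (\<Sum>i\<in>UNIV. (- y i / sqrt w)\<^sup>2 * \<tau> i) / 2))"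
      unfolding char[of "\<lambda>i. - y i / sqrt w", symmetric] by (rule integral_mult_right_zero)
    also have "- (\<Sum>i\<in>UNIV. (- y i / sqrt w)\<^sup>2 * \<tau> i) / 2 = (\<Sum>i\<in>UNIV. - (\<tau> i / (2 * w) * (y i)\<^sup>2))"
      using w by (simp add: power_divide sum_negf sum_divide_distrib mult_ac)
    also have "iexp (\<Sum>i\<in>UNIV. x i / sqrt w * y i) * complex_of_real (exp (\<Sum>i\<in>UNIV. - (\<tau> i / (2 * w) * (y i)\<^sup>2)))
      = (\<Prod>i\<in>UNIV. iexp (x i / sqrt w * y i) * complex_of_real (exp (- (\<tau> i / (2 * w) * (y i)\<^sup>2))))"
      unfolding prod_iexp[OF finite, symmetric] exp_sum[OF finite] of_real_prod prod.distrib ..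
    finally show "(\<integral>\<omega>. (\<Prod>i\<in>UNIV. iexp ((x i - G i \<omega>) / sqrt w * y i)) \<partial>N)
      = (\<Prod>i\<in>UNIV. iexp (x i / sqrt w * y i) * complex_of_real (exp (- (\<tau> i / (2 * w) * (y i)\<^sup>2))))" .
  qed
  also have "\<dots> = (\<Prod>i\<in>UNIV. (\<integral>y. iexp (x i / sqrt w * y) * complex_of_real (exp (- (\<tau> i / (2 * w) * y\<^sup>2))) \<partial>stdn))"
    by (intro prod_int[symmetric] int_exp) (use w \<tau> in simp)
  also have "(\<Prod>i\<in>(UNIV::'i set). ?c) * \<dots>
     = (\<Prod>i\<in>UNIV. ?c * (\<integral>y. iexp (x i / sqrt w * y) * complex_of_real (exp (- ((w + \<tau> i - w) * y\<^sup>2 / (2 * w)))) \<partial>stdn))"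
    unfolding prod.distrib by simp
  also have "\<dots> = complex_of_real (\<Prod>i\<in>UNIV. normal_density 0 (sqrt (w + \<tau> i)) (x i))"
    using w \<tau> by (subst normal_density_fourier_weighted) auto
  finally show ?thesis by (simp only: of_real_eq_iff)
qed

section \<open>Moments and characteristic functions of Gaussian vectors\<close>

lemma normal_law_moments:
  assumes "0 \<le> \<sigma>"
  shows "integrable (normal_law m \<sigma>) (\<lambda>x. x)" "(\<integral>x. x \<partial>normal_law m \<sigma>) = m"
    and "integrable (normal_law m \<sigma>) (\<lambda>x. x\<^sup>2)" "(\<integral>x. x\<^sup>2 \<partial>normal_law m \<sigma>) = m\<^sup>2 + \<sigma>\<^sup>2"
proof -
  have "integrable (normal_law m \<sigma>) (\<lambda>x. x) \<and> (\<integral>x. x \<partial>normal_law m \<sigma>) = m \<and>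
    integrable (normal_law m \<sigma>) (\<lambda>x. x\<^sup>2) \<and> (\<integral>x. x\<^sup>2 \<partial>normal_law m \<sigma>) = m\<^sup>2 + \<sigma>\<^sup>2"
  proof (cases "\<sigma> = 0")
    case True
    have int: "has_bochner_integral (return borel m) h (h m)" if [measurable]: "h \<in> borel_measurable borel" for h :: "real \<Rightarrow> real"
    proof -
      have "integrable (return borel m) h"
        by (rule integrableI_bounded) (auto simp: nn_integral_return)
      then show ?thesis using that by (simp add: has_bochner_integral_iff integral_return)
    qed
    have "normal_law m \<sigma> = return borel m" using True by (simp add: normal_law_def)
    then show ?thesis
      using int[of "\<lambda>x. x"] int[of "\<lambda>x. x\<^sup>2"] True unfolding has_bochner_integral_iff by simp
  next
    case False
    then have \<sigma>: "0 < \<sigma>" using assms by simp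
    have 1: "has_bochner_integral lborel (\<lambda>x. normal_density m \<sigma> x * x) m"
      using normal_moment_nz_1[OF \<sigma>] .
    have 2: "has_bochner_integral lborel (\<lambda>x. normal_density m \<sigma> x * x\<^sup>2) (m\<^sup>2 + \<sigma>\<^sup>2)"
      using integral_quadratic_normal[OF \<sigma>, of m m "-1" m "-1"] by (simp add: power2_eq_square)
    have "has_bochner_integral (density lborel (\<lambda>x. ennreal (normal_density m \<sigma> x))) (\<lambda>x. x) m"
      using 1 by (intro has_bochner_integral_density) auto
    moreover have "has_bochner_integral (density lborel (\<lambda>x. ennreal (normal_density m \<sigma> x))) (\<lambda>x. x\<^sup>2) (m\<^sup>2 + \<sigma>\<^sup>2)"
      using 2 by (intro has_bochner_integral_density) auto
    ultimately show ?thesis using False by (simp add: normal_law_def has_bochner_integral_iff)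
  qed
  then show "integrable (normal_law m \<sigma>) (\<lambda>x. x)" "(\<integral>x. x \<partial>normal_law m \<sigma>) = m"
    "integrable (normal_law m \<sigma>) (\<lambda>x. x\<^sup>2)" "(\<integral>x. x\<^sup>2 \<partial>normal_law m \<sigma>) = m\<^sup>2 + \<sigma>\<^sup>2" by auto
qed

lemma integral_iexp_normal_law:
  assumes "0 \<le> \<sigma>"
  shows "(\<integral>x. iexp x \<partial>normal_law 0 \<sigma>) = complex_of_real (exp (- (\<sigma>\<^sup>2) / 2))"
proof (cases "\<sigma> = 0")
  case True
  then show ?thesis by (simp add: normal_law_def integral_return)
next
  case False
  then have \<sigma>: "0 < \<sigma>" using assms by simp
  have "normal_law 0 \<sigma> = distr stdn borel (\<lambda>z. 0 + \<sigma> * z)"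
    using distr_normal_affine[of 1 \<sigma> 0 0] \<sigma> by (simp add: normal_law_def)
  then have "(\<integral>x. iexp x \<partial>normal_law 0 \<sigma>) = (\<integral>z. iexp (0 + \<sigma> * z) \<partial>stdn)"
    by (simp add: integral_distr)
  also have "\<dots> = (\<integral>z. iexp (\<sigma> * z) \<partial>stdn)" by (simp only: add_0)
  finally show ?thesis unfolding integral_iexp_std .
qed

text \<open>The definition of a Gaussian vector speaks of each linear functional separately and with
  unknown parameters. Integrability comes first, since only then does a vanishing Bochner integral
  mean that the mean is zero; mean and second moment afterwards identify \<open>m\<close> and
  \<open>\<sigma>\<close>.\<close>

lemma gaussian_vector_facts:
  fixes Z :: "'v \<Rightarrow> 'a::euclidean_space"
  assumes "prob_space N" and g: "gaussian_vector N Z" and mean: "(\<integral>\<omega>. Z \<omega> \<partial>N) = 0"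
  shows "Z \<in> borel_measurable N" "integrable N Z" "integrable N (\<lambda>\<omega>. (u \<bullet> Z \<omega>) * (u' \<bullet> Z \<omega>))"
    and "(\<integral>\<omega>. iexp (u \<bullet> Z \<omega>) \<partial>N) = complex_of_real (exp (- (\<integral>\<omega>. (u \<bullet> Z \<omega>)\<^sup>2 \<partial>N) / 2))"
proof -
  interpret prob_space N by fact
  show Zm[measurable]: "Z \<in> borel_measurable N" using g by (simp add: gaussian_vector_def)
  have ex: "\<exists>m \<sigma>. 0 \<le> \<sigma> \<and> distr N borel (\<lambda>\<omega>. u \<bullet> Z \<omega>) = normal_law m \<sigma>" for u
    using g by (auto simp: gaussian_vector_def)
  have lin: "integrable N (\<lambda>\<omega>. u \<bullet> Z \<omega>)" "integrable N (\<lambda>\<omega>. (u \<bullet> Z \<omega>)\<^sup>2)" for u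
  proof -
    obtain m \<sigma> where \<sigma>: "0 \<le> \<sigma>" and d: "distr N borel (\<lambda>\<omega>. u \<bullet> Z \<omega>) = normal_law m \<sigma>" using ex by blast
    show "integrable N (\<lambda>\<omega>. u \<bullet> Z \<omega>)" "integrable N (\<lambda>\<omega>. (u \<bullet> Z \<omega>)\<^sup>2)"
      using normal_law_moments(1,3)[OF \<sigma>, of m] unfolding d[symmetric]
      by (simp_all add: integrable_distr_eq)
  qed
  show int: "integrable N Z"
  proof -
    have "integrable N (\<lambda>\<omega>. \<Sum>b\<in>Basis. (b \<bullet> Z \<omega>) *\<^sub>R b)" using lin by auto
    moreover have "(\<Sum>b\<in>Basis. (b \<bullet> Z \<omega>) *\<^sub>R b) = Z \<omega>" for \<omega>
      unfolding inner_commute[of _ "Z \<omega>"] by (rule euclidean_representation)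
    ultimately show ?thesis by simp
  qed
  show "integrable N (\<lambda>\<omega>. (u \<bullet> Z \<omega>) * (u' \<bullet> Z \<omega>))"
  proof (rule Bochner_Integration.integrable_bound)
    show "integrable N (\<lambda>\<omega>. (u \<bullet> Z \<omega>)\<^sup>2 + (u' \<bullet> Z \<omega>)\<^sup>2)" using lin by auto
    have "\<bar>a * b\<bar> \<le> a\<^sup>2 + b\<^sup>2" for a b :: real
    proof -
      have "2 * \<bar>a\<bar> * \<bar>b\<bar> \<le> a\<^sup>2 + b\<^sup>2" using sum_squares_bound[of "\<bar>a\<bar>" "\<bar>b\<bar>"] by simp
      moreover have "0 \<le> \<bar>a\<bar> * \<bar>b\<bar>" by simp
      ultimately show ?thesis unfolding abs_mult by linarith
    qed
    then show "AE \<omega> in N. norm ((u \<bullet> Z \<omega>) * (u' \<bullet> Z \<omega>)) \<le> norm ((u \<bullet> Z \<omega>)\<^sup>2 + (u' \<bullet> Z \<omega>)\<^sup>2)"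
      unfolding real_norm_def by (simp del: abs_mult)
  qed simp
  obtain m \<sigma> where \<sigma>: "0 \<le> \<sigma>" and d: "distr N borel (\<lambda>\<omega>. u \<bullet> Z \<omega>) = normal_law m \<sigma>" using ex by blast
  have "m = (\<integral>\<omega>. u \<bullet> Z \<omega> \<partial>N)"
    using normal_law_moments(2)[OF \<sigma>, of m] unfolding d[symmetric] by (simp add: integral_distr)
  also have "\<dots> = 0" using int mean by simp
  finally have m: "m = 0" .
  have "(\<integral>\<omega>. (u \<bullet> Z \<omega>)\<^sup>2 \<partial>N) = \<sigma>\<^sup>2"
    using normal_law_moments(4)[OF \<sigma>, of m] unfolding d[symmetric] by (simp add: integral_distr m)
  moreover have "(\<integral>\<omega>. iexp (u \<bullet> Z \<omega>) \<partial>N) = complex_of_real (exp (- (\<sigma>\<^sup>2) / 2))"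
    using integral_iexp_normal_law[OF \<sigma>] unfolding m[symmetric] d[symmetric] by (simp add: integral_distr)
  ultimately show "(\<integral>\<omega>. iexp (u \<bullet> Z \<omega>) \<partial>N) = complex_of_real (exp (- (\<integral>\<omega>. (u \<bullet> Z \<omega>)\<^sup>2 \<partial>N) / 2))"
    by simp
qed

lemma covariance_bilinear:
  fixes X :: "'w \<Rightarrow> real ^ 'd"
  assumes "prob_space M" and int: "integrable M X" and int2: "\<And>u u'. integrable M (\<lambda>\<omega>. (u \<bullet> X \<omega>) * (u' \<bullet> X \<omega>))"
    and mean: "(\<integral>\<omega>. X \<omega> \<partial>M) = 0"
  shows "(\<integral>\<omega>. (u \<bullet> X \<omega>) * (u' \<bullet> X \<omega>) \<partial>M) = u \<bullet> (covariance_matrix M X *v u')"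
    and "transpose (covariance_matrix M X) = covariance_matrix M X"
proof -
  have ax: "X \<omega> $ i = axis i 1 \<bullet> X \<omega>" for \<omega> i by (simp add: inner_axis' )
  have m0: "(\<integral>\<omega>. X \<omega> $ i \<partial>M) = 0" for i
    unfolding ax using int mean by simp
  have c: "covariance_matrix M X $ i $ j = (\<integral>\<omega>. X \<omega> $ i * X \<omega> $ j \<partial>M)" for i j
    by (simp add: covariance_matrix_def m0)
  have i2: "integrable M (\<lambda>\<omega>. X \<omega> $ i * X \<omega> $ j)" for i j
    unfolding ax by (rule int2)
  have "(\<integral>\<omega>. (u \<bullet> X \<omega>) * (u' \<bullet> X \<omega>) \<partial>M) = (\<integral>\<omega>. (\<Sum>i\<in>UNIV. \<Sum>j\<in>UNIV. (u $ i * u' $ j) * (X \<omega> $ i * X \<omega> $ j)) \<partial>M)"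
    unfolding inner_vec_def sum_product by (simp add: mult_ac)
  also have "\<dots> = (\<Sum>i\<in>UNIV. \<Sum>j\<in>UNIV. (u $ i * u' $ j) * covariance_matrix M X $ i $ j)"
    unfolding c by (simp add: Bochner_Integration.integral_sum Bochner_Integration.integrable_sum i2)
  also have "\<dots> = u \<bullet> (covariance_matrix M X *v u')"
    by (simp add: inner_vec_def matrix_vector_mult_def sum_distrib_left mult_ac)
  finally show "(\<integral>\<omega>. (u \<bullet> X \<omega>) * (u' \<bullet> X \<omega>) \<partial>M) = u \<bullet> (covariance_matrix M X *v u')" .
  show "transpose (covariance_matrix M X) = covariance_matrix M X"
    by (simp add: vec_eq_iff transpose_def c mult.commute)
qed

section \<open>Replacing the summands one by one\<close>

definition normal_coords :: "('i::finite \<Rightarrow> real) \<Rightarrow> ('i \<Rightarrow> real) measure" where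
  "normal_coords v = PiM UNIV (\<lambda>i. density lborel (\<lambda>z. ennreal (normal_density 0 (sqrt (v i)) z)))"

lemma prob_normal_coords: "(\<And>i. 0 < v i) \<Longrightarrow> prob_space (normal_coords v)"
  unfolding normal_coords_def by (intro prob_space_PiM prob_space_normal_density) simp

lemma (in orthonormal_coords) vec_normal_coords[measurable]: "vec \<in> borel_measurable (normal_coords v)"
  unfolding normal_coords_def by (rule vec_meas) simp

lemma (in orthonormal_coords) normal_coords_second_moment:
  assumes "\<And>i. 0 < v i"
  shows "(\<integral>\<^sup>+ x. ennreal ((norm (vec x))\<^sup>2) \<partial>normal_coords v) = ennreal (\<Sum>i\<in>UNIV. v i)"
proof -
  interpret normal_product v by unfold_locales fact
  have [measurable]: "(\<lambda>x. x i) \<in> borel_measurable \<Pi>n" for i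
    using measurable_component_singleton[of i UNIV \<gamma>] by simp
  have one: "(\<integral>\<^sup>+ x. ennreal ((x i)\<^sup>2) \<partial>\<Pi>n) = ennreal (v i)" for i
  proof -
    have "(\<integral>\<^sup>+ x. ennreal ((x i)\<^sup>2) \<partial>\<Pi>n) = (\<integral>\<^sup>+ x. \<integral>\<^sup>+ z. ennreal (z\<^sup>2) \<partial>\<gamma> i \<partial>\<Pi>n)"
      by (subst resample[where i=i]) auto
    also have "\<dots> = (\<integral>\<^sup>+ z. ennreal (z\<^sup>2) \<partial>\<gamma> i)" by (simp add: P.emeasure_space_1[simplified])
    also have "\<dots> = (\<integral>\<^sup>+ z. ennreal (nd i z * z\<^sup>2) \<partial>lborel)"
      by (subst nn_integral_density) (auto simp: ennreal_mult)
    also have "\<dots> = ennreal (v i)"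
      using integral_quadratic_normal[of "sqrt (v i)" 0 0 "-1" 0 "-1"] v_pos[of i]
      by (subst nn_integral_eq_integral) (auto simp: has_bochner_integral_iff power2_eq_square)
    finally show ?thesis .
  qed
  have "(\<integral>\<^sup>+ x. ennreal ((norm (vec x))\<^sup>2) \<partial>normal_coords v) = (\<integral>\<^sup>+ x. (\<Sum>i\<in>UNIV. ennreal ((x i)\<^sup>2)) \<partial>\<Pi>n)"
    unfolding normal_coords_def norm_vec by (simp add: sum_ennreal)
  also have "\<dots> = (\<Sum>i\<in>UNIV. ennreal (v i))" by (subst nn_integral_sum) (auto simp: one)
  finally show ?thesis using v_pos by (simp add: sum_ennreal less_imp_le)
qed

text \<open>\<open>G\<close> may be degenerate and have no density, but its smoothing has one.
  Relative to the normal law with variances \<open>w + \<tau> i\<close> this density is constantly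
  \<open>1\<close>, by \<open>smoothed_gaussian_density\<close>.\<close>

lemma gaussian_convolution:
  fixes e :: "'i::finite \<Rightarrow> 'a::ordered_euclidean_space" and G :: "'i \<Rightarrow> 'v \<Rightarrow> real"
  assumes e: "orthonormal_coords e" and "prob_space N" and Gm[measurable]: "\<And>i. G i \<in> borel_measurable N"
    and char: "\<And>y. (\<integral>\<omega>. iexp (\<Sum>i\<in>UNIV. y i * G i \<omega>) \<partial>N) = complex_of_real (exp (- (\<Sum>i\<in>UNIV. (y i)\<^sup>2 * \<tau> i) / 2))"
    and w: "0 < w" and \<tau>: "\<And>i. 0 \<le> \<tau> i"
  shows "distr N borel (\<lambda>\<omega>. orthonormal_coords.vec e (\<lambda>i. G i \<omega>)) \<star> distr (normal_coords (\<lambda>_. w)) borel (orthonormal_coords.vec e)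
    = distr (normal_coords (\<lambda>i. w + \<tau> i)) borel (orthonormal_coords.vec e)"
proof -
  interpret N: prob_space N by fact
  interpret orthonormal_coords e by fact
  have b_pos: "0 < w + \<tau> i" for i using w \<tau>[of i] by simp
  interpret np: normal_product "\<lambda>i. w + \<tau> i" by unfold_locales (rule b_pos)
  interpret pair_sigma_finite N np.\<Pi>n ..
  have [measurable]: "(\<lambda>\<omega>. vec (\<lambda>i. G i \<omega>)) \<in> borel_measurable N" unfolding vec_def by measurable
  have [measurable]: "vec \<in> borel_measurable np.\<Pi>n" by (rule vec_meas) simp
  let ?k = "\<lambda>i x \<eta>. normal_density 0 (sqrt w) (x - \<eta>) / np.nd i x"
  have [measurable]: "(\<lambda>p. snd p i) \<in> borel_measurable (N \<Otimes>\<^sub>M np.\<Pi>n)" for i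
    using measurable_compose[OF measurable_snd measurable_component_singleton[of i UNIV np.\<gamma>]] by simp
  have [measurable]: "(\<lambda>p. G i (fst p)) \<in> borel_measurable (N \<Otimes>\<^sub>M np.\<Pi>n)" for i
    by (rule measurable_compose[OF measurable_fst Gm])
  have km[measurable]: "(\<lambda>(\<omega>, x). ennreal (\<Prod>i\<in>UNIV. ?k i (x i) (G i \<omega>)) * indicator S (vec x)) \<in> borel_measurable (N \<Otimes>\<^sub>M np.\<Pi>n)"
    if [measurable]: "S \<in> sets borel" for S
    unfolding split_beta' by measurable
  show ?thesis
  proof (rule measure_eqI)
    fix S assume "S \<in> sets (distr N borel (\<lambda>\<omega>. vec (\<lambda>i. G i \<omega>)) \<star> distr (normal_coords (\<lambda>_. w)) borel vec)"
    then have S[measurable]: "S \<in> sets borel" by simp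
    have shift: "(\<integral>\<^sup>+ u. indicator S (vec (\<lambda>i. G i \<omega>) + vec u) \<partial>normal_coords (\<lambda>_. w))
       = (\<integral>\<^sup>+ x. ennreal (\<Prod>i\<in>UNIV. ?k i (x i) (G i \<omega>)) * indicator S (vec x) \<partial>np.\<Pi>n)" for \<omega>
    proof -
      \<comment> \<open>A one-point probability space: \<open>W_shift\<close> is applied with the
        constant vector \<open>G \<omega>\<close> in the role of \<open>Y\<close> and
        \<open>\<tau>\<close> in the role of \<open>s\<close>, which leaves noise of variance
        \<open>w\<close>.\<close>
      interpret R: prob_space "return (count_space (UNIV :: unit set)) ()" by (rule prob_space_return) simp
      interpret s: shift_coords "\<lambda>i. w + \<tau> i" "return (count_space (UNIV :: unit set)) ()" \<tau> "\<lambda>i _. G i \<omega>" "\<Sum>i\<in>UNIV. \<bar>G i \<omega>\<bar>" e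
        using w \<tau> by unfold_locales (auto intro: member_le_sum)
      have nd: "normal_density \<eta> \<sigma> x = normal_density 0 \<sigma> (x - \<eta>)" for \<eta> \<sigma> x by (simp add: normal_density_def)
      have "s.W UNIV x () = (\<Prod>i\<in>UNIV. ?k i (x i) (G i \<omega>))" for x
        unfolding s.W_def s.k_def nd[of "G _ \<omega>"] by simp
      then show ?thesis using s.W_shift[OF S, of "()"] by (simp add: normal_coords_def)
    qed
    have one: "(\<integral>\<^sup>+ \<omega>. ennreal (\<Prod>i\<in>UNIV. ?k i (x i) (G i \<omega>)) \<partial>N) = 1" for x
    proof -
      have ndpos: "0 < np.nd i z" for i z using b_pos by (simp add: normal_density_pos)
      have bd: "normal_density 0 (sqrt w) z \<le> 1 / sqrt (2 * pi * w)" for z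
        unfolding normal_density_sqrt[OF w] using w by (simp add: divide_right_mono)
      have int: "integrable N (\<lambda>\<omega>. \<Prod>i\<in>UNIV. normal_density 0 (sqrt w) (x i - G i \<omega>))"
      proof (rule N.integrable_const_bound)
        have "(\<Prod>i\<in>UNIV. normal_density 0 (sqrt w) (x i - G i \<omega>)) \<le> (\<Prod>i\<in>(UNIV :: 'i set). 1 / sqrt (2 * pi * w))" for \<omega>
          by (intro prod_mono) (auto intro: bd)
        then show "AE \<omega> in N. norm (\<Prod>i\<in>UNIV. normal_density 0 (sqrt w) (x i - G i \<omega>)) \<le> (\<Prod>i\<in>(UNIV :: 'i set). 1 / sqrt (2 * pi * w))"
          by (simp add: abs_of_nonneg prod_nonneg del: prod_constant)
      qed measurable
      have "(\<integral>\<^sup>+ \<omega>. ennreal (\<Prod>i\<in>UNIV. ?k i (x i) (G i \<omega>)) \<partial>N)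
          = (\<integral>\<^sup>+ \<omega>. ennreal ((\<Prod>i\<in>UNIV. normal_density 0 (sqrt w) (x i - G i \<omega>)) / (\<Prod>i\<in>UNIV. np.nd i (x i))) \<partial>N)"
        by (simp add: prod_dividef)
      also have "\<dots> = ennreal ((\<integral>\<omega>. (\<Prod>i\<in>UNIV. normal_density 0 (sqrt w) (x i - G i \<omega>)) \<partial>N) / (\<Prod>i\<in>UNIV. np.nd i (x i)))"
        using int by (subst nn_integral_eq_integral) (auto intro!: divide_nonneg_nonneg prod_nonneg)
      also have "(\<integral>\<omega>. (\<Prod>i\<in>UNIV. normal_density 0 (sqrt w) (x i - G i \<omega>)) \<partial>N) = (\<Prod>i\<in>UNIV. np.nd i (x i))"
        by (rule smoothed_gaussian_density[OF N.prob_space_axioms Gm char w \<tau>])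
      also have "(\<Prod>i\<in>UNIV. np.nd i (x i)) / (\<Prod>i\<in>UNIV. np.nd i (x i)) = 1"
        using ndpos by (simp add: less_imp_neq[symmetric])
      finally show ?thesis by simp
    qed
    have "emeasure (distr N borel (\<lambda>\<omega>. vec (\<lambda>i. G i \<omega>)) \<star> distr (normal_coords (\<lambda>_. w)) borel vec) S
        = (\<integral>\<^sup>+ \<omega>. \<integral>\<^sup>+ x. ennreal (\<Prod>i\<in>UNIV. ?k i (x i) (G i \<omega>)) * indicator S (vec x) \<partial>np.\<Pi>n \<partial>N)"
      using w by (subst emeasure_convolution_distr) (auto simp: shift intro: N.prob_space_axioms prob_normal_coords)
    also have "\<dots> = (\<integral>\<^sup>+ x. \<integral>\<^sup>+ \<omega>. ennreal (\<Prod>i\<in>UNIV. ?k i (x i) (G i \<omega>)) * indicator S (vec x) \<partial>N \<partial>np.\<Pi>n)"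
      by (rule Fubini'[symmetric]) (rule km[OF S])
    also have "\<dots> = (\<integral>\<^sup>+ x. indicator S (vec x) \<partial>np.\<Pi>n)"
      by (intro nn_integral_cong, subst nn_integral_multc) (auto simp: one)
    also have "\<dots> = emeasure (distr (normal_coords (\<lambda>i. w + \<tau> i)) borel vec) S"
      unfolding normal_coords_def by (simp flip: nn_integral_indicator add: nn_integral_distr)
    finally show "emeasure (distr N borel (\<lambda>\<omega>. vec (\<lambda>i. G i \<omega>)) \<star> distr (normal_coords (\<lambda>_. w)) borel vec) S
      = emeasure (distr (normal_coords (\<lambda>i. w + \<tau> i)) borel vec) S" .
  qed simp
qed

lemma (in prob_space) indep_var_sum:
  fixes X :: "nat \<Rightarrow> 'a \<Rightarrow> 'b::{second_countable_topology, topological_comm_monoid_add}"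
  assumes I: "finite I" "i \<notin> I" and indep: "indep_vars (\<lambda>_. borel) X (insert i I)"
  shows "indep_var borel (\<lambda>\<omega>. \<Sum>j\<in>I. X j \<omega>) borel (X i)"
proof -
  have "indep_var
    borel ((\<lambda>f. \<Sum>j\<in>I. f j) \<circ> (\<lambda>\<omega>. restrict (\<lambda>j. X j \<omega>) I))
    borel ((\<lambda>f. f i) \<circ> (\<lambda>\<omega>. restrict (\<lambda>j. X j \<omega>) {i}))"
    using I by (intro indep_var_compose[OF indep_var_restrict[OF indep]]) auto
  also have "((\<lambda>f. f i) \<circ> (\<lambda>\<omega>. restrict (\<lambda>j. X j \<omega>) {i})) = X i"
    by auto
  also have "((\<lambda>f. \<Sum>j\<in>I. f j) \<circ> (\<lambda>\<omega>. restrict (\<lambda>j. X j \<omega>) I)) = (\<lambda>\<omega>. \<Sum>j\<in>I. X j \<omega>)"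
    by (auto cong: rev_conj_cong)
  finally show ?thesis .
qed

text \<open>The term \<open>j = 0\<close> is \<open>1/4\<close>, and every later one is at most
  \<open>1 / (j + 1) \<le> ln (j + 1) - ln j\<close>. Starting at \<open>1/4\<close> leaves room for
  the two smoothing errors.\<close>

lemma harmonic_shifted_le:
  assumes "1 \<le> n"
  shows "(\<Sum>j<n. 1 / (real j + 4)) \<le> 1/4 + ln (real n)"
  using assms
proof (induction n rule: nat_induct_at_least)
  case (Suc n)
  have "1 - real n / real (Suc n) \<le> - ln (real n / real (Suc n))"
    using ln_le_minus_one[of "real n / real (Suc n)"] Suc.hyps by simp
  also have "\<dots> = ln (real (Suc n)) - ln (real n)"
    using Suc.hyps by (simp add: ln_div)
  finally have "1 / real (Suc n) \<le> ln (real (Suc n)) - ln (real n)"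
    by (simp add: field_simps)
  moreover have "1 / (real n + 4) \<le> 1 / real (Suc n)" by (simp add: frac_le)
  ultimately show ?case using Suc.IH by simp
qed simp

text \<open>\<open>W2_summand\<close> stated for random vectors, in the orthonormal coordinates
  \<open>e\<close> that diagonalise the covariance; the value \<open>\<nu> = m + 1\<close> turns
  \<open>\<nu> + 3\<close> into \<open>m + 4\<close>.\<close>

lemma W2_swap_summand:
  fixes X :: "'w \<Rightarrow> real ^ 'd" and e :: "'d \<Rightarrow> real ^ 'd"
  assumes "prob_space M" and Xm[measurable]: "X \<in> borel_measurable M" and e: "orthonormal_coords e"
    and mean: "(\<integral>\<omega>. X \<omega> \<partial>M) = 0" and bound: "AE \<omega> in M. norm (X \<omega>) \<le> \<beta>" and "0 < \<beta>"
    and diag: "\<And>i j. e i \<bullet> (covariance_matrix M X *v e j) = (if i = j then s i else 0)"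
  shows "W2 (distr (normal_coords (\<lambda>i. 3 * \<beta>\<^sup>2 + real (Suc m) * s i)) borel (orthonormal_coords.vec e))
      (distr M borel X \<star> distr (normal_coords (\<lambda>i. 3 * \<beta>\<^sup>2 + real m * s i)) borel (orthonormal_coords.vec e))
    \<le> ennreal (5 * sqrt (real CARD('d)) * \<beta> / (real m + 4))"
proof -
  interpret M: prob_space M by fact
  interpret orthonormal_coords e by fact
  \<comment> \<open>The bound on \<open>X\<close> holds only almost surely, while the locale
    requires it at every point. Setting \<open>X\<close> to \<open>0\<close> where it fails changes
    neither law nor moments.\<close>
  define X' where "X' \<omega> = (if norm (X \<omega>) \<le> \<beta> then X \<omega> else 0)" for \<omega>
  have X'm[measurable]: "X' \<in> borel_measurable M" unfolding X'_def by measurable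
  have ae: "AE \<omega> in M. X' \<omega> = X \<omega>" using bound by eventually_elim (simp add: X'_def)
  have bd: "norm (X' \<omega>) \<le> \<beta>" for \<omega> using \<open>0 < \<beta>\<close> by (simp add: X'_def)
  have ubd: "\<bar>u \<bullet> X' \<omega>\<bar> \<le> norm u * \<beta>" for u \<omega>
    using Cauchy_Schwarz_ineq2[of u "X' \<omega>"] mult_left_mono[OF bd[of \<omega>], of "norm u"] by simp
  have int: "integrable M X'" using bd by (intro M.integrable_const_bound[where B=\<beta>]) auto
  have int2: "integrable M (\<lambda>\<omega>. (u \<bullet> X' \<omega>) * (u' \<bullet> X' \<omega>))" for u u'
    using \<open>0 < \<beta>\<close> by (intro M.integrable_const_bound[where B="(norm u * \<beta>) * (norm u' * \<beta>)"])
      (auto simp: abs_mult intro!: mult_mono ubd)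
  have mean': "(\<integral>\<omega>. X' \<omega> \<partial>M) = 0"
    using mean ae by (subst integral_cong_AE[where g=X]) auto
  have cov': "covariance_matrix M X' = covariance_matrix M X"
  proof -
    have comp: "(\<lambda>x. x $ i) \<in> borel_measurable borel" for i :: 'd
      by (intro borel_measurable_continuous_onI continuous_intros)
    note [measurable] = measurable_compose[OF Xm comp] measurable_compose[OF X'm comp]
    have 1: "(\<integral>\<omega>. X' \<omega> $ i \<partial>M) = (\<integral>\<omega>. X \<omega> $ i \<partial>M)" for i
      using ae by (intro integral_cong_AE) auto
    have "(\<integral>\<omega>. (X' \<omega> $ i - c) * (X' \<omega> $ j - d) \<partial>M) = (\<integral>\<omega>. (X \<omega> $ i - c) * (X \<omega> $ j - d) \<partial>M)" for i j c d
      using ae by (intro integral_cong_AE) auto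
    then show ?thesis by (simp add: covariance_matrix_def 1)
  qed
  have cov: "(\<integral>\<omega>. (e i \<bullet> X' \<omega>) * (e j \<bullet> X' \<omega>) \<partial>M) = (if i = j then s i else 0)" for i j
    using covariance_bilinear(1)[OF M.prob_space_axioms int int2 mean', of "e i" "e j"] diag by (simp add: cov')
  have s0: "0 \<le> s i" for i
  proof -
    have "0 \<le> (\<integral>\<omega>. (e i \<bullet> X' \<omega>) * (e i \<bullet> X' \<omega>) \<partial>M)" by (intro integral_nonneg_AE) auto
    then show ?thesis by (simp add: cov)
  qed
  have vX: "vec (\<lambda>i. e i \<bullet> X' \<omega>) = X' \<omega>" for \<omega>
    using vec_coords[of "X' \<omega>"] by (simp add: inner_commute)
  let ?v = "\<lambda>i. 3 * \<beta>\<^sup>2 + real (Suc m) * s i"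
  have ve: "?v i = (3 * \<beta>\<^sup>2 + real m * s i) + s i" for i by (simp add: algebra_simps)
  have pos: "0 < 3 * \<beta>\<^sup>2 + real m * s i" for i using \<open>0 < \<beta>\<close> s0[of i] by (simp add: add_pos_nonneg)
  interpret S: summand_coords ?v M s "\<lambda>i \<omega>. e i \<bullet> X' \<omega>" \<beta> \<beta> "real (Suc m)" e
  proof unfold_locales
    show "0 < ?v i" for i unfolding ve using pos[of i] s0[of i] by linarith
    show "s i < ?v i" for i unfolding ve using pos[of i] by linarith
    show "\<bar>e i \<bullet> X' \<omega>\<bar> \<le> \<beta>" for i \<omega> using ubd[of "e i" \<omega>] orth[of i i] by (simp add: norm_eq_1[symmetric])
    show "(\<Sum>i\<in>UNIV. (e i \<bullet> X' \<omega>)\<^sup>2) \<le> \<beta>\<^sup>2" for \<omega>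
      unfolding norm_vec[symmetric] vX using bd[of \<omega>] by (intro power_mono) auto
    show "(\<integral>\<omega>. e i \<bullet> X' \<omega> \<partial>M) = 0" for i using int mean' by simp
  qed (use \<open>0 < \<beta>\<close> s0 cov in auto)
  have va: "?v i - s i = 3 * \<beta>\<^sup>2 + real m * s i" for i by (simp add: algebra_simps)
  have S1: "sets S.\<rho>1 = sets borel" unfolding S.\<rho>1_def by simp
  have "S.\<rho>1 = (distr M borel X \<star> distr (normal_coords (\<lambda>i. 3 * \<beta>\<^sup>2 + real m * s i)) borel vec)"
  proof (rule measure_eqI)
    fix A assume "A \<in> sets S.\<rho>1"
    then have A[measurable]: "A \<in> sets borel" unfolding S1 .
    have "emeasure S.\<rho>1 A = (\<integral>\<^sup>+ y. indicator A y \<partial>S.\<rho>1)"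
      using A by (intro nn_integral_indicator[symmetric]) (simp only: S1)
    also have "\<dots> = (\<integral>\<^sup>+ \<omega>. \<integral>\<^sup>+ u. indicator A (X' \<omega> + vec u) \<partial>normal_coords (\<lambda>i. 3 * \<beta>\<^sup>2 + real m * s i) \<partial>M)"
      unfolding S.nn_integral_\<rho>1[OF borel_measurable_indicator[OF A]] vX va normal_coords_def ..
    also have "\<dots> = (\<integral>\<^sup>+ \<omega>. \<integral>\<^sup>+ u. indicator A (X \<omega> + vec u) \<partial>normal_coords (\<lambda>i. 3 * \<beta>\<^sup>2 + real m * s i) \<partial>M)"
      using ae by (intro nn_integral_cong_AE) auto
    also have "\<dots> = emeasure (distr M borel X \<star> distr (normal_coords (\<lambda>i. 3 * \<beta>\<^sup>2 + real m * s i)) borel vec) A"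
      using pos by (subst emeasure_convolution_distr) (auto intro: M.prob_space_axioms prob_normal_coords)
    finally show "emeasure S.\<rho>1 A = emeasure (distr M borel X \<star> distr (normal_coords (\<lambda>i. 3 * \<beta>\<^sup>2 + real m * s i)) borel vec) A" .
  qed (simp only: S1 sets_convolution)
  then show ?thesis
    using S.W2_summand unfolding normal_coords_def by (simp only: of_nat_Suc) (simp add: add_ac)
qed

text \<open>The sum is left unnormalised, so that each of the \<open>n\<close> steps exchanges
  covariance \<open>\<Sigma>\<close> for \<open>\<Sigma>\<close> with the same smoothing; the
  scaling by \<open>1 / sqrt n\<close> comes last.\<close>

lemma W2_sum_gaussian:
  fixes M :: "'w measure" and N :: "'v measure"
    and X :: "nat \<Rightarrow> 'w \<Rightarrow> real ^ 'd" and Z :: "'v \<Rightarrow> real ^ 'd"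
  assumes M: "prob_space M" and N: "prob_space N" and n: "1 \<le> n" and "0 < \<beta>"
    and indep: "prob_space.indep_vars M (\<lambda>_. borel) X {1..n}"
    and mean: "\<And>i. i \<in> {1..n} \<Longrightarrow> (\<integral>\<omega>. X i \<omega> \<partial>M) = 0"
    and cov: "\<And>i. i \<in> {1..n} \<Longrightarrow> covariance_matrix M (X i) = \<Sigma>"
    and bound: "\<And>i. i \<in> {1..n} \<Longrightarrow> AE \<omega> in M. norm (X i \<omega>) \<le> \<beta>"
    and Z: "gaussian_vector N Z" "(\<integral>\<omega>. Z \<omega> \<partial>N) = 0" "covariance_matrix N Z = \<Sigma>"
  shows "W2 (distr M borel (\<lambda>\<omega>. \<Sum>i=1..n. X i \<omega>)) (distr N borel (\<lambda>\<omega>. sqrt (real n) *\<^sub>R Z \<omega>))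
    \<le> ennreal (5 * sqrt (real CARD('d)) * \<beta> * (1 + ln (real n)))"
proof -
  interpret M: prob_space M by fact
  interpret N: prob_space N by fact
  have Xm[measurable]: "X i \<in> borel_measurable M" if "i \<in> {1..n}" for i
    using indep that by (auto simp: M.indep_vars_def)
  note Zfacts = gaussian_vector_facts[OF N Z(1,2)]
  note [measurable] = Zfacts(1)
  note Zcov = covariance_bilinear[OF N Zfacts(2,3) Z(2), unfolded Z(3)]
  obtain e :: "'d \<Rightarrow> real ^ 'd" where e: "\<And>i j. e i \<bullet> e j = (if i = j then 1 else 0)"
    and off: "\<And>i j. i \<noteq> j \<Longrightarrow> e i \<bullet> (\<Sigma> *v e j) = 0"
    using ex_diagonal_coords[OF Zcov(2)] by metis
  interpret orthonormal_coords e by unfold_locales (rule e)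
  define s where "s i = e i \<bullet> (\<Sigma> *v e i)" for i
  have s0: "0 \<le> s i" for i
    unfolding s_def Zcov(1)[symmetric] by (intro integral_nonneg_AE) auto
  have diag: "e i \<bullet> (\<Sigma> *v e j) = (if i = j then s i else 0)" for i j
    using off by (simp add: s_def)
  define Nk where "Nk m = distr (normal_coords (\<lambda>i. 3 * \<beta>\<^sup>2 + real m * s i)) borel vec" for m
  define T where "T k = distr M borel (\<lambda>\<omega>. \<Sum>i=1..k. X i \<omega>)" for k
  define c where "c = 5 * sqrt (real CARD('d)) * \<beta>"
  have c0: "0 \<le> c" using \<open>0 < \<beta>\<close> by (simp add: c_def)
  have vpos: "0 < 3 * \<beta>\<^sup>2 + real m * s i" for m i using \<open>0 < \<beta>\<close> s0[of i] by (simp add: add_pos_nonneg)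
  have pNk: "prob_space (Nk m)" "sets (Nk m) = sets borel" for m
    unfolding Nk_def by (auto intro!: prob_space.prob_space_distr prob_normal_coords vpos)
  have Sm[measurable]: "(\<lambda>\<omega>. \<Sum>i=1..k. X i \<omega>) \<in> borel_measurable M" if "k \<le> n" for k
    using that by (intro borel_measurable_sum Xm) auto
  have pT: "prob_space (T k)" "sets (T k) = sets borel" if "k \<le> n" for k
    unfolding T_def using Sm[OF that] by (auto intro: M.prob_space_distr)
  have T_Suc: "T (Suc k) = (T k \<star> distr M borel (X (Suc k)))" if "Suc k \<le> n" for k
  proof -
    have "M.indep_vars (\<lambda>_. borel) X (insert (Suc k) {1..k})"
      using that by (intro M.indep_vars_subset[OF indep]) auto
    then have "M.indep_var borel (\<lambda>\<omega>. \<Sum>j=1..k. X j \<omega>) borel (X (Suc k))"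
      by (intro M.indep_var_sum) auto
    from M.sum_indep_random_variable[OF this] show ?thesis
      using that Sm[of k] Xm[of "Suc k"] by (simp add: T_def add.commute)
  qed
  \<comment> \<open>The index \<open>m\<close> counts Gaussian summands:
    \<open>T (n - m) \<star> Nk m\<close> keeps the first \<open>n - m\<close> of the
    \<open>X i\<close> and has \<open>m\<close> normal ones besides the smoothing. Independence
    splits off one factor of the partial sum, and by \<open>W2_convolution_le\<close> the untouched
    factor \<open>T k\<close> costs nothing.\<close>
  have chain: "W2 (T (n - m) \<star> Nk m) (T n \<star> Nk 0) \<le> ennreal (c * (\<Sum>j<m. 1 / (real j + 4)))" if "m \<le> n" for m
    using that
  proof (induction m)
    case 0
    have "prob_space (T n \<star> Nk 0)"
    proof -
      interpret a: prob_space "T n" by (rule pT) simp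
      interpret b: prob_space "Nk 0" by (rule pNk)
      interpret pair_prob_space "T n" "Nk 0" ..
      have [measurable_cong]: "sets (T n) = sets borel" "sets (Nk 0) = sets borel" using pT pNk by auto
      show ?thesis unfolding convolution_def by (rule prob_space_distr) simp
    qed
    from W2_distr_le[OF this, of "\<lambda>x. x" "\<lambda>x. x" 0]
    have "W2 (T n \<star> Nk 0) (T n \<star> Nk 0) \<le> ennreal 0"
      by (simp add: distr_id2)
    then show ?case by simp
  next
    case (Suc m)
    define k where "k = n - Suc m"
    have k: "Suc k = n - m" "Suc k \<le> n" "k \<le> n" using Suc.prems by (auto simp: k_def)
    let ?\<mu> = "distr M borel (X (Suc k))"
    have p\<mu>: "prob_space ?\<mu>" using k Xm[of "Suc k"] by (intro M.prob_space_distr) auto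
    have "W2 (Nk (Suc m)) (?\<mu> \<star> Nk m) \<le> ennreal (c / (real m + 4))"
      unfolding Nk_def c_def using k
      by (intro W2_swap_summand M Xm orthonormal_coords_axioms mean bound \<open>0 < \<beta>\<close>) (auto simp: cov diag)
    then have "W2 (T k \<star> Nk (Suc m)) (T k \<star> (?\<mu> \<star> Nk m)) \<le> ennreal (c / (real m + 4))"
      using c0 by (intro W2_convolution_le pT k) auto
    also have "(T k \<star> (?\<mu> \<star> Nk m)) = (T (Suc k) \<star> Nk m)"
      unfolding T_Suc[OF k(2)] using pT[OF k(3)] p\<mu> pNk
      by (intro convolution_associative prob_space.finite_measure) auto
    finally have "W2 (T k \<star> Nk (Suc m)) (T n \<star> Nk 0) \<le> ennreal (c / (real m + 4) + c * (\<Sum>j<m. 1 / (real j + 4)))"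
      using Suc c0 unfolding k(1) by (intro W2_triangle_le) (auto intro!: sum_nonneg mult_nonneg_nonneg)
    then show ?case unfolding k_def[symmetric] by (simp add: distrib_left add.commute)
  qed
  have T0: "(T 0 \<star> Nk n) = Nk n"
  proof (rule measure_eqI)
    fix A assume "A \<in> sets (T 0 \<star> Nk n)"
    then have A[measurable]: "A \<in> sets borel" by simp
    have "emeasure (T 0 \<star> Nk n) A = (\<integral>\<^sup>+ \<omega>. \<integral>\<^sup>+ u. indicator A (vec u) \<partial>normal_coords (\<lambda>i. 3 * \<beta>\<^sup>2 + real n * s i) \<partial>M)"
      unfolding T_def Nk_def using vpos
      by (subst emeasure_convolution_distr) (auto intro: M prob_normal_coords)
    also have "\<dots> = emeasure (Nk n) A"
      unfolding Nk_def by (simp flip: nn_integral_indicator add: nn_integral_distr M.emeasure_space_1)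
    finally show "emeasure (T 0 \<star> Nk n) A = emeasure (Nk n) A" .
  qed (simp add: pNk)
  let ?Zn = "distr N borel (\<lambda>\<omega>. sqrt (real n) *\<^sub>R Z \<omega>)"
  \<comment> \<open>The chain ends in a product normal law. This identifies it as the smoothing of
    \<open>sqrt n\<close> times \<open>Z\<close>, through the characteristic function of
    \<open>Z\<close> in the coordinates \<open>e\<close>.\<close>
  have Zn: "(?Zn \<star> Nk 0) = Nk n"
  proof -
    define G where "G i \<omega> = e i \<bullet> (sqrt (real n) *\<^sub>R Z \<omega>)" for i \<omega>
    have char: "(\<integral>\<omega>. iexp (\<Sum>i\<in>UNIV. y i * G i \<omega>) \<partial>N) = complex_of_real (exp (- (\<Sum>i\<in>UNIV. (y i)\<^sup>2 * (real n * s i)) / 2))" for y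
    proof -
      define u where "u = sqrt (real n) *\<^sub>R vec y"
      have u: "(\<Sum>i\<in>UNIV. y i * G i \<omega>) = u \<bullet> Z \<omega>" for \<omega>
        by (simp add: u_def G_def vec_def inner_sum_left sum_distrib_left mult_ac)
      have "(\<integral>\<omega>. (u \<bullet> Z \<omega>)\<^sup>2 \<partial>N) = u \<bullet> (\<Sigma> *v u)"
        unfolding power2_eq_square by (rule Zcov(1))
      also have "\<dots> = (\<Sum>i\<in>UNIV. (y i)\<^sup>2 * (real n * s i))"
      proof -
        have "u \<bullet> (\<Sigma> *v u) = real n * (vec y \<bullet> (\<Sigma> *v vec y))"
          by (simp add: u_def matrix_vector_mult_scaleR mult.assoc[symmetric])
        also have "\<Sigma> *v vec y = (\<Sum>j\<in>UNIV. y j *\<^sub>R (\<Sigma> *v e j))"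
          unfolding vec_def by (simp add: linear_sum[OF matrix_vector_mul_linear] matrix_vector_mult_scaleR)
        also have "vec y \<bullet> (\<Sum>j\<in>UNIV. y j *\<^sub>R (\<Sigma> *v e j)) = (\<Sum>i\<in>UNIV. \<Sum>j\<in>UNIV. if i = j then y i * (y i * s i) else 0)"
          unfolding vec_def inner_sum_left inner_sum_right
          by (subst sum.swap, intro sum.cong refl) (auto simp: diag)
        finally show ?thesis by (simp add: sum_distrib_left power2_eq_square mult_ac)
      qed
      finally show ?thesis unfolding u Zfacts(4) by simp
    qed
    have vG: "vec (\<lambda>i. G i \<omega>) = sqrt (real n) *\<^sub>R Z \<omega>" for \<omega>
      using vec_coords[of "sqrt (real n) *\<^sub>R Z \<omega>"] by (simp add: G_def inner_commute)
    have [measurable]: "G i \<in> borel_measurable N" for i unfolding G_def by measurable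
    have "(distr N borel (\<lambda>\<omega>. vec (\<lambda>i. G i \<omega>)) \<star> distr (normal_coords (\<lambda>_. 3 * \<beta>\<^sup>2)) borel vec)
      = distr (normal_coords (\<lambda>i. 3 * \<beta>\<^sup>2 + real n * s i)) borel vec"
      using \<open>0 < \<beta>\<close> s0 by (intro gaussian_convolution orthonormal_coords_axioms N char) auto
    then show ?thesis by (simp add: vG Nk_def)
  qed
  define a where "a = sqrt 3 * sqrt (real CARD('d)) * \<beta>"
  have a0: "0 \<le> a" using \<open>0 < \<beta>\<close> by (simp add: a_def)
  have noise: "(\<integral>\<^sup>+ y. ennreal ((norm y)\<^sup>2) \<partial>Nk 0) \<le> ennreal (a\<^sup>2)"
  proof -
    have "(\<integral>\<^sup>+ y. ennreal ((norm y)\<^sup>2) \<partial>Nk 0) = (\<integral>\<^sup>+ x. ennreal ((norm (vec x))\<^sup>2) \<partial>normal_coords (\<lambda>_. 3 * \<beta>\<^sup>2))"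
      unfolding Nk_def by (simp add: nn_integral_distr)
    also have "\<dots> = ennreal (\<Sum>i\<in>(UNIV :: 'd set). 3 * \<beta>\<^sup>2)"
      using \<open>0 < \<beta>\<close> by (intro normal_coords_second_moment) simp
    also have "(\<Sum>i\<in>(UNIV :: 'd set). 3 * \<beta>\<^sup>2) = a\<^sup>2" by (simp add: a_def power_mult_distrib)
    finally show ?thesis by simp
  qed
  have "W2 ?Zn (Nk n) \<le> ennreal a"
    unfolding Zn[symmetric] using noise a0 pNk
    by (intro W2_add_noise) (auto intro: N.prob_space_distr)
  moreover have "W2 (Nk n) (T n \<star> Nk 0) \<le> ennreal (c * (\<Sum>j<n. 1 / (real j + 4)))"
    using chain[of n] by (simp add: T0)
  ultimately have 1: "W2 ?Zn (T n \<star> Nk 0) \<le> ennreal (a + c * (\<Sum>j<n. 1 / (real j + 4)))"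
    using a0 c0 by (intro W2_triangle_le) (auto intro!: mult_nonneg_nonneg sum_nonneg)
  have "W2 (T n) (T n \<star> Nk 0) \<le> ennreal a"
    using noise a0 pNk pT by (intro W2_add_noise) auto
  then have 2: "W2 (T n \<star> Nk 0) (T n) \<le> ennreal a" using a0 by (rule W2_sym_le)
  have "W2 ?Zn (T n) \<le> ennreal (a + c * (\<Sum>j<n. 1 / (real j + 4)) + a)"
    using W2_triangle_le[OF 1 2] a0 c0 by (simp add: mult_nonneg_nonneg sum_nonneg del: ennreal_plus)
  also have "\<dots> \<le> ennreal (c * (1 + ln (real n)))"
  proof (rule ennreal_leI)
    \<comment> \<open>\<open>15/8\<close> is \<open>3/8 * 5\<close>, so each smoothing costs at most
      \<open>3/8 * c\<close>; two of them and the first harmonic term \<open>1/4 * c\<close> make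
      exactly \<open>c\<close>.\<close>
    have "sqrt 3 \<le> 15/8" by (rule real_le_lsqrt) (auto simp: power2_eq_square)
    then have "sqrt 3 * (sqrt (real CARD('d)) * \<beta>) \<le> 15/8 * (sqrt (real CARD('d)) * \<beta>)"
      using \<open>0 < \<beta>\<close> by (intro mult_right_mono) auto
    then have "a \<le> 3/8 * c" by (simp add: a_def c_def)
    moreover have "c * (\<Sum>j<n. 1 / (real j + 4)) \<le> c * (1/4 + ln (real n))"
      using harmonic_shifted_le[OF n] c0 by (rule mult_left_mono)
    ultimately show "a + c * (\<Sum>j<n. 1 / (real j + 4)) + a \<le> c * (1 + ln (real n))"
      by (simp add: distrib_left)
  qed
  finally have "W2 ?Zn (T n) \<le> ennreal (c * (1 + ln (real n)))" .
  then have "W2 (T n) ?Zn \<le> ennreal (c * (1 + ln (real n)))"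
  proof (rule W2_sym_le)
    have "0 \<le> ln (real n)" using n by simp
    then show "0 \<le> c * (1 + ln (real n))" using c0 by simp
  qed
  then show ?thesis unfolding T_def c_def .
qed

theorem theorem1p1:
  fixes M :: "'w measure" and N :: "'v measure"
    and X :: "nat \<Rightarrow> 'w \<Rightarrow> real ^ 'd" and Z :: "'v \<Rightarrow> real ^ 'd"
    and \<Sigma> :: "real ^ 'd ^ 'd" and \<beta> :: real and n :: nat
  assumes "prob_space M" and "prob_space N"
    and "n \<ge> 1" and "\<beta> \<ge> 0"
    and "prob_space.indep_vars M (\<lambda>_. borel) X {1..n}"
    and "\<And>i. i \<in> {1..n} \<Longrightarrow> (\<integral>\<omega>. X i \<omega> \<partial>M) = 0"
    and "\<And>i. i \<in> {1..n} \<Longrightarrow> covariance_matrix M (X i) = \<Sigma>"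
    and "\<And>i. i \<in> {1..n} \<Longrightarrow> AE \<omega> in M. norm (X i \<omega>) \<le> \<beta>"
    and "gaussian_vector N Z"
    and "(\<integral>\<omega>. Z \<omega> \<partial>N) = 0" and "covariance_matrix N Z = \<Sigma>"
  shows "W2 (distr M borel (\<lambda>\<omega>. (1 / sqrt (real n)) *\<^sub>R (\<Sum>i = 1..n. X i \<omega>))) (distr N borel Z)
    \<le> ennreal (5 * sqrt (real CARD('d)) * \<beta> * (1 + ln (real n)) / sqrt (real n))"
proof (rule W2_le_limit)
  define K where "K = 5 * sqrt (real CARD('d)) * (1 + ln (real n)) / sqrt (real n)"
  have K: "0 < K" using assms(3) by (auto simp: K_def intro!: divide_pos_pos mult_pos_pos add_pos_nonneg)
  fix A assume "5 * sqrt (real CARD('d)) * \<beta> * (1 + ln (real n)) / sqrt (real n) < A"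
  then have "K * \<beta> < A" by (simp add: K_def mult_ac)
  \<comment> \<open>\<open>W2_sum_gaussian\<close> needs a positive bound, so
    \<open>\<beta>\<close>, which may be \<open>0\<close>, is enlarged to the value at which the
    estimate equals the given \<open>A\<close>. Letting \<open>A\<close> decrease to the claimed
    bound covers \<open>\<beta> = 0\<close> as well.\<close>
  define \<beta>' where "\<beta>' = A / K"
  have \<beta>': "\<beta> < \<beta>'" "0 < \<beta>'"
    using \<open>K * \<beta> < A\<close> K assms(4) le_less_trans[of 0 "K * \<beta>" A] by (auto simp: \<beta>'_def field_simps)
  have ae: "AE \<omega> in M. norm (X i \<omega>) \<le> \<beta>'" if "i \<in> {1..n}" for i
    using assms(8)[OF that] \<beta>' by (auto elim: eventually_mono)
  have Xm: "X i \<in> borel_measurable M" if "i \<in> {1..n}" for i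
    using assms(5) that by (auto simp: prob_space.indep_vars_def[OF assms(1)])
  have [measurable]: "(\<lambda>\<omega>. \<Sum>i = 1..n. X i \<omega>) \<in> borel_measurable M"
    by (intro borel_measurable_sum Xm)
  have [measurable]: "Z \<in> borel_measurable N" using assms(9) by (simp add: gaussian_vector_def)
  have "W2 (distr M borel (\<lambda>\<omega>. \<Sum>i=1..n. X i \<omega>)) (distr N borel (\<lambda>\<omega>. sqrt (real n) *\<^sub>R Z \<omega>))
    \<le> ennreal (5 * sqrt (real CARD('d)) * \<beta>' * (1 + ln (real n)))"
    using assms \<beta>' ae by (intro W2_sum_gaussian) auto
  then have "W2 (distr (distr M borel (\<lambda>\<omega>. \<Sum>i=1..n. X i \<omega>)) borel (\<lambda>x. (1 / sqrt (real n)) *\<^sub>R x))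
      (distr (distr N borel (\<lambda>\<omega>. sqrt (real n) *\<^sub>R Z \<omega>)) borel (\<lambda>x. (1 / sqrt (real n)) *\<^sub>R x))
    \<le> ennreal (1 / sqrt (real n) * (5 * sqrt (real CARD('d)) * \<beta>' * (1 + ln (real n))))"
    using assms(3) \<beta>' by (intro W2_scaleR_le) auto
  moreover have "1 / sqrt (real n) * (5 * sqrt (real CARD('d)) * \<beta>' * (1 + ln (real n))) = K * \<beta>'"
    by (simp add: K_def)
  moreover have "K * \<beta>' = A" using K by (simp add: \<beta>'_def)
  ultimately show "W2 (distr M borel (\<lambda>\<omega>. (1 / sqrt (real n)) *\<^sub>R (\<Sum>i = 1..n. X i \<omega>))) (distr N borel Z) \<le> ennreal A"
    using assms(3) by (simp add: distr_distr comp_def del: One_nat_def)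
qed

end
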